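(* Let $u,v\in S_{\mathbb{Z}_+}$. Then (a) $\mathrm{FS}(u,v)=\Xi(u,v)$ and $\mathrm{BS}(u,v)=\Omega(u,v)$; (b) $\mathrm{FS}^D(u,v)=\Xi(u,v)$ and $\mathrm{BS}^D(u,v)=\Omega(u,v)$; (c) $\mathrm{FS}_K(u,v)=\Xi(u,v)$ and $\mathrm{BS}_K(u,v)=\Omega(u,v)$; (d) $\mathrm{FS}^D_K(u,v)=\Xi(u,v)$ and $\mathrm{BS}^D_K(u,v)=\Omega(u,v)$, where all quantities are as defined in the context.
   Context: Permutations. $S_{\mathbb{Z}}$ is the group of bijections $\mathbb{Z}\to\mathbb{Z}$ fixing all but finitely many integers; $S_{\mathbb{Z}_+}$ is the subgroup of permutations of $\mathbb{Z}_+=\{1,2,\dots\}$ (fixing all $i\le 0$). $s_i$ is the transposition of $i,i+1$. A reduced word for $w$ is a sequence $(i_1,\dots,i_k)$ with $w=s_{i_1}\cdots s_{i_k}$ and $k=\ell(w)$ minimal; $\mathcal{RW}(w)$ is the set of reduced words. The $0$-Hecke (Demazure) product $\ast$ is the associative product on $S_{\mathbb{Z}}$ determined by $s_i\ast s_i=s_i$, $s_i\ast s_{i+1}\ast s_i=s_{i+1}\ast s_i\ast s_{i+1}$, $s_i\ast s_j=s_j\ast s_i$ for $|i-j|>1$ (and $w\ast s_i=ws_i$ if $\ell(ws_i)>\ell(w)$); a Hecke word for $w$ is $(i_1,\dots,i_k)$ with $w=s_{i_1}\ast\cdots\ast s_{i_k}$, and $\mathcal{HW}(w)$ is the set of these.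 Polynomials. Let $\boldsymbol{x}=(x_1,x_2,\dots)$, $\boldsymbol{y}=(\dots,y_{-1},y_0,y_1,\dots)$. For $w\in S_{\mathbb{Z}_+}$, the double Schubert polynomial is $\mathfrak{S}_w(\boldsymbol{x},\boldsymbol{y})=\sum \prod_{i=1}^k (x_{b_i}-y_{t_i-b_i+1})$, summed over $(t_1,\dots,t_k)\in\mathcal{RW}(w)$ and integers $1\le b_1\le\cdots\le b_k$ with $b_i\le t_i$ and ($t_i\le t_{i+1}\Rightarrow b_i<b_{i+1}$); the double Grothendieck polynomial $\mathcal{G}_w(\boldsymbol{x},\boldsymbol{y})$ is the same sum but over $(t_1,\dots,t_k)\in\mathcal{HW}(w)$ with each term multiplied by $(-1)^{k-\ell(w)}$. Single versions are $\mathfrak{S}_w(\boldsymbol{x})=\mathfrak{S}_w(\boldsymbol{x},\boldsymbol{0})$, $\mathcal{G}_w(\boldsymbol{x})=\mathcal{G}_w(\boldsymbol{x},\boldsymbol{0})$. Each family is a basis ($\mathbb{Q}$-basis of $\mathbb{Q}[\boldsymbol{x}]$ for the single ones, $\mathbb{Q}(\boldsymbol{y})$-basis of $\mathbb{Q}(\boldsymbol{y})[\boldsymbol{x}]$ for the double ones), and the structure constants $c_{u,v}^w$, $c_{u,v}^w(\boldsymbol{y})$, $C_{u,v}^w$, $C_{u,v}^w(\boldsymbol{y})$ ($u,v,w\in S_{\mathbb{Z}_+}$) are defined by $\mathfrak{S}_u\mathfrak{S}_v=\sum_w c_{u,v}^w\mathfrak{S}_w$, $\mathfrak{S}_u(\boldsymbol{x},\boldsymbol{y})\mathfrak{S}_v(\boldsymbol{x},\boldsymbol{y})=\sum_w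 c_{u,v}^w(\boldsymbol{y})\mathfrak{S}_w(\boldsymbol{x},\boldsymbol{y})$, $\mathcal{G}_u\mathcal{G}_v=\sum_w C_{u,v}^w\mathcal{G}_w$, $\mathcal{G}_u(\boldsymbol{x},\boldsymbol{y})\mathcal{G}_v(\boldsymbol{x},\boldsymbol{y})=\sum_w C_{u,v}^w(\boldsymbol{y})\mathcal{G}_w(\boldsymbol{x},\boldsymbol{y})$. Stability statistics. For $w\in S_{\mathbb{Z}}$, $\mathrm{FS}(w)=\max\{k: w(k)\ne k\}$ and $\mathrm{BS}(w)=1-\min\{k: w(k)\ne k\}$ (with the conventions $\mathrm{FS}(\mathrm{id})=-\infty$, $\mathrm{BS}(\mathrm{id})=-\infty$). Back-stable constants. For $k\in\mathbb{Z}$ and $w\in S_{\mathbb{Z}}$ let $\tau_k(w)(i)=w(i-k)+k$ (so $\mathrm{BS}(\tau_k w)=\mathrm{BS}(w)-k$). For $u,v,w\in S_{\mathbb{Z}}$ define $\overleftarrow{C_{u,v}^w}(\boldsymbol{y})$ to be $C_{\tau_k u,\tau_k v}^{\tau_k w}(\boldsymbol{y})$ with each $y_i$ replaced by $y_{i-k}$, for any $k\ge \mathrm{BS}(u),\mathrm{BS}(v),\mathrm{BS}(w)$ (this is independent of $k$). Set $\overleftarrow{C_{u,v}^w}=\overleftarrow{C_{u,v}^w}(\boldsymbol{0})$; $\overleftarrow{c_{u,v}^w}(\boldsymbol{y})=\overleftarrow{C_{u,v}^w}(\boldsymbol{y})$ if $\ell(u)+\ell(v)=\ell(w)$ and $0$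 otherwise; $\overleftarrow{c_{u,v}^w}=\overleftarrow{c_{u,v}^w}(\boldsymbol{0})$. Stability numbers. For $u,v\in S_{\mathbb{Z}_+}$: $\mathrm{FS}(u,v)=\max\{\mathrm{FS}(w): c_{u,v}^w\ne0\}$, $\mathrm{FS}^D(u,v)=\max\{\mathrm{FS}(w): c_{u,v}^w(\boldsymbol{y})\ne0\}$, $\mathrm{FS}_K(u,v)=\max\{\mathrm{FS}(w): C_{u,v}^w\ne0\}$, $\mathrm{FS}_K^D(u,v)=\max\{\mathrm{FS}(w): C_{u,v}^w(\boldsymbol{y})\ne0\}$ (maxima over $w\in S_{\mathbb{Z}_+}$), and $\mathrm{BS}(u,v)=\max\{\mathrm{BS}(w):\overleftarrow{c_{u,v}^w}\ne0\}$, $\mathrm{BS}^D(u,v)=\max\{\mathrm{BS}(w):\overleftarrow{c_{u,v}^w}(\boldsymbol{y})\ne0\}$, $\mathrm{BS}_K(u,v)=\max\{\mathrm{BS}(w):\overleftarrow{C_{u,v}^w}\ne0\}$, $\mathrm{BS}_K^D(u,v)=\max\{\mathrm{BS}(w):\overleftarrow{C_{u,v}^w}(\boldsymbol{y})\ne0\}$ (maxima over $w\in S_{\mathbb{Z}}$). Codes. For $w\in S_{\mathbb{Z}}$ and $i\in\mathbb{Z}$: $\mathrm{code}(w)_i=|\{j>i: w(j)<w(i)\}|$, $\mathrm{dualcode}(w)_i=|\{j<i: w(j)>w(i)\}|$; $\theta_i(w)=1$ if $\mathrm{code}(w)_i>0$ and $0$ otherwise; $\Theta_i(w)=1$ if $\mathrm{dualcode}(w)_i>0$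 and $0$ otherwise; $\lambda_i(w)=\sum_{j\le i}\theta_j(w)$, $\Lambda_i(w)=\sum_{j\ge i}\Theta_j(w)$. Define $\Xi(u,v)=\max_{i\le 1+\max(\mathrm{FS}(u),\mathrm{FS}(v))}\big(\Lambda_i(u)+\Lambda_i(v)+i-1\big)$ and $\Omega(u,v)=\max_{i\ge -\max(\mathrm{BS}(u),\mathrm{BS}(v))}\big(\lambda_i(u)+\lambda_i(v)-i\big)$.
   Formalization: In the double Grothendieck polynomial the factor x_b − y_c is replaced by (x_b − y_c)/(1 − y_c); with the printed factor the back-stable constants depend on k (u=v=s_1, w=id: zero for k=0, nonzero for k=1), so they are undefined. At y=0 the two agree. *)

theory Defs
  imports
    "HOL-Combinatorics.Perm"
    "HOL-Library.Poly_Mapping"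
    "HOL-Library.Extended_Real"
    "HOL-Computational_Algebra.Fraction_Field"
begin

unbundle permutation_syntax

section \<open>Permutations of the integers\<close>

text \<open>
  The library type \<^typ>\<open>int perm\<close> consists of the bijections of the integers that fix all but
  finitely many integers.  Multiplication is composition of functions.
\<close>

definition S_pos :: "int perm set" where
  "S_pos = {w. \<forall>i\<le>0. w \<langle>$\<rangle> i = i}"

definition adj :: "int \<Rightarrow> int perm" where
  "adj i = \<langle>i \<leftrightarrow> i + 1\<rangle>"

definition perm_length :: "int perm \<Rightarrow> nat" where
  "perm_length w = (LEAST k. \<exists>t. length t = k \<and> w = prod_list (map adj t))"

definition reduced_words :: "int perm \<Rightarrow> int list set" where
  "reduced_words w = {t. w = prod_list (map adj t) \<and> length t = perm_length w}"

definition is_demazure_product :: "(int perm \<Rightarrow> int perm \<Rightarrow> int perm) \<Rightarrow> bool" where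
  "is_demazure_product m \<longleftrightarrow>
     (\<forall>u v w. m (m u v) w = m u (m v w)) \<and>
     (\<forall>i. m (adj i) (adj i) = adj i) \<and>
     (\<forall>i. m (m (adj i) (adj (i + 1))) (adj i) = m (m (adj (i + 1)) (adj i)) (adj (i + 1))) \<and>
     (\<forall>i j. \<bar>i - j\<bar> > 1 \<longrightarrow> m (adj i) (adj j) = m (adj j) (adj i)) \<and>
     (\<forall>w i. perm_length (w * adj i) > perm_length w \<longrightarrow> m w (adj i) = w * adj i)"

text \<open>
  The conditions determine the product: if \<open>w * adj i\<close> is shorter than \<open>w\<close>, then
  \<open>w = m (w * adj i) (adj i)\<close>, and hence \<open>m w (adj i) = w\<close> by associativity and idempotence.
\<close>

definition demazure :: "int perm \<Rightarrow> int perm \<Rightarrow> int perm" where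
  "demazure = (THE m. is_demazure_product m)"

definition hecke_words :: "int perm \<Rightarrow> int list set" where
  "hecke_words w = {t. w = foldl demazure 1 (map adj t)}"

lift_definition shift_perm :: "int \<Rightarrow> int perm \<Rightarrow> int perm"
  is "\<lambda>k w i. w (i - k) + k"
proof (intro conjI)
  fix k :: int and w :: "int \<Rightarrow> int"
  assume w: "bij w \<and> finite {a. w a \<noteq> a}"
  have "bij ((\<lambda>i. i + k) \<circ> w \<circ> (\<lambda>i. i - k))"
  proof (intro bij_comp)
    show "bij (\<lambda>i::int. i - k)"
      by (rule bij_betw_byWitness[where f' = "\<lambda>i. i + k"]) auto
    show "bij (\<lambda>i::int. i + k)"
      by (rule bij_betw_byWitness[where f' = "\<lambda>i. i - k"]) auto
  qed (use w in simp)
  then show "bij (\<lambda>i. w (i - k) + k)"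
    by (simp add: comp_def)
  have "{a. w (a - k) + k \<noteq> a} \<subseteq> (\<lambda>i. i + k) ` {a. w a \<noteq> a}"
  proof
    fix a assume "a \<in> {a. w (a - k) + k \<noteq> a}"
    then have "a - k \<in> {a. w a \<noteq> a}" by auto
    then show "a \<in> (\<lambda>i. i + k) ` {a. w a \<noteq> a}"
      by (rule rev_image_eqI) simp
  qed
  then show "finite {a. w (a - k) + k \<noteq> a}"
    using w finite_subset by blast
qed

section \<open>Maxima and stability statistics of permutations\<close>

text \<open>
  The maximum of a possibly infinite set, with the convention that the empty set has maximum
  \<open>-\<infinity>\<close>.  All sets below consist of integers and \<open>-\<infinity>\<close>.
\<close>

definition maximum :: "ereal set \<Rightarrow> ereal" where
  "maximum A = (if A = {} then -\<infinity> else (GREATEST a. a \<in> A))"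

definition FS :: "int perm \<Rightarrow> ereal" where
  "FS w = (if w = 1 then -\<infinity> else ereal (of_int (Max {k. w \<langle>$\<rangle> k \<noteq> k})))"

definition BS :: "int perm \<Rightarrow> ereal" where
  "BS w = (if w = 1 then -\<infinity> else ereal (of_int (1 - Min {k. w \<langle>$\<rangle> k \<noteq> k})))"

section \<open>Schubert and Grothendieck polynomials\<close>

text \<open>
  Polynomials over \<open>'k\<close> in variables indexed by the integers.  The \<open>\<^bold>x\<close>-variables with
  non-positive index never occur in the polynomials below.
\<close>

type_synonym 'k mpoly = "(int \<Rightarrow>\<^sub>0 nat) \<Rightarrow>\<^sub>0 'k"

definition Var :: "int \<Rightarrow> 'k::comm_ring_1 mpoly" where
  "Var i = Poly_Mapping.single (Poly_Mapping.single i 1) 1"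

definition Const :: "'k::comm_ring_1 \<Rightarrow> 'k mpoly" where
  "Const c = Poly_Mapping.single 0 c"

text \<open>The field of rational functions over the rationals in the variables \<open>\<^bold>y\<close>.\<close>

type_synonym ratfun = "rat mpoly fract"

definition rf_const :: "rat \<Rightarrow> ratfun" where
  "rf_const c = Fract (Const c) 1"

definition yvar :: "int \<Rightarrow> ratfun" where
  "yvar i = Fract (Var i) 1"

definition compatible :: "int list \<Rightarrow> int list \<Rightarrow> bool" where
  "compatible t b \<longleftrightarrow> length b = length t \<and>
     (\<forall>i<length t. 1 \<le> b ! i \<and> b ! i \<le> t ! i) \<and>
     (\<forall>i. Suc i < length t \<longrightarrow> b ! i \<le> b ! Suc i) \<and>
     (\<forall>i. Suc i < length t \<longrightarrow> t ! i \<le> t ! Suc i \<longrightarrow> b ! i < b ! Suc i)"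

definition double_schubert :: "(int \<Rightarrow> 'k::field) \<Rightarrow> int perm \<Rightarrow> 'k mpoly" where
  "double_schubert y w =
     (\<Sum>(t, b) | t \<in> reduced_words w \<and> compatible t b.
        \<Prod>i<length t. Var (b ! i) - Const (y (t ! i - b ! i + 1)))"

text \<open>
  In K-theory the difference \<open>x - y\<close> is taken in the multiplicative formal group law
  \<open>a \<oplus> b = a + b - a b\<close>, that is \<open>x \<ominus> y = (x - y) / (1 - y)\<close>, with \<open>1 - y\<close> invertible in the
  coefficient field.  The literal difference in the sum over Hecke words does not give the double
  Grothendieck polynomials: for \<open>w = adj 2\<close> that sum is
  \<open>(x\<^sub>1 - y\<^sub>2) + (x\<^sub>2 - y\<^sub>1) - (x\<^sub>1 - y\<^sub>2) (x\<^sub>2 - y\<^sub>1)\<close>, which is not symmetric in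
  \<open>x\<^sub>1, x\<^sub>2\<close>, and the resulting structure constants are not stable under shifts.  At \<open>\<^bold>y = 0\<close> both
  readings agree.
\<close>

definition kminus :: "'k::field mpoly \<Rightarrow> 'k \<Rightarrow> 'k mpoly" where
  "kminus p c = (p - Const c) * Const (inverse (1 - c))"

definition double_grothendieck :: "(int \<Rightarrow> 'k::field) \<Rightarrow> int perm \<Rightarrow> 'k mpoly" where
  "double_grothendieck y w =
     (\<Sum>(t, b) | t \<in> hecke_words w \<and> compatible t b.
        (-1) ^ (length t - perm_length w) *
        (\<Prod>i<length t. kminus (Var (b ! i)) (y (t ! i - b ! i + 1))))"

section \<open>Structure constants\<close>

definition structure_const ::
    "(int perm \<Rightarrow> 'k::field mpoly) \<Rightarrow> int perm \<Rightarrow> int perm \<Rightarrow> int perm \<Rightarrow> 'k" where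
  "structure_const B u v = Poly_Mapping.lookup
     (THE c :: int perm \<Rightarrow>\<^sub>0 'k. Poly_Mapping.keys c \<subseteq> S_pos \<and>
        B u * B v = (\<Sum>w\<in>Poly_Mapping.keys c. Const (Poly_Mapping.lookup c w) * B w))"

definition c_single :: "int perm \<Rightarrow> int perm \<Rightarrow> int perm \<Rightarrow> rat" where
  "c_single = structure_const (double_schubert (\<lambda>_. 0))"

definition c_double :: "int perm \<Rightarrow> int perm \<Rightarrow> int perm \<Rightarrow> ratfun" where
  "c_double = structure_const (double_schubert yvar)"

definition C_single :: "int perm \<Rightarrow> int perm \<Rightarrow> int perm \<Rightarrow> rat" where
  "C_single = structure_const (double_grothendieck (\<lambda>_. 0))"

definition C_double :: "int perm \<Rightarrow> int perm \<Rightarrow> int perm \<Rightarrow> ratfun" where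
  "C_double = structure_const (double_grothendieck yvar)"

section \<open>Back-stable structure constants\<close>

text \<open>
  Substitution of \<open>a i\<close> for the \<open>i\<close>-th variable, with coefficients embedded by \<open>h\<close>; for a rational
  function it is defined through any representation whose denominator does not become zero.
\<close>

definition poly_subst :: "(rat \<Rightarrow> 'a::comm_ring_1) \<Rightarrow> (int \<Rightarrow> 'a) \<Rightarrow> rat mpoly \<Rightarrow> 'a" where
  "poly_subst h a p =
     (\<Sum>m\<in>Poly_Mapping.keys p.
        h (Poly_Mapping.lookup p m) *
        (\<Prod>i\<in>Poly_Mapping.keys m. a i ^ Poly_Mapping.lookup m i))"

definition ratfun_subst :: "(rat \<Rightarrow> 'a::field) \<Rightarrow> (int \<Rightarrow> 'a) \<Rightarrow> ratfun \<Rightarrow> 'a" where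
  "ratfun_subst h a f =
     (THE g. \<exists>p q. f = Fract p q \<and> poly_subst h a q \<noteq> 0 \<and>
        g = poly_subst h a p / poly_subst h a q)"

definition shift_y :: "int \<Rightarrow> ratfun \<Rightarrow> ratfun" where
  "shift_y k = ratfun_subst rf_const (\<lambda>i. yvar (i - k))"

definition at_zero :: "ratfun \<Rightarrow> rat" where
  "at_zero = ratfun_subst id (\<lambda>_. 0)"

definition C_back_double :: "int perm \<Rightarrow> int perm \<Rightarrow> int perm \<Rightarrow> ratfun" where
  "C_back_double u v w =
     (THE c. \<forall>k::int. BS u \<le> ereal (of_int k) \<and> BS v \<le> ereal (of_int k) \<and> BS w \<le> ereal (of_int k)
        \<longrightarrow> c = shift_y k (C_double (shift_perm k u) (shift_perm k v) (shift_perm k w)))"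

definition C_back :: "int perm \<Rightarrow> int perm \<Rightarrow> int perm \<Rightarrow> rat" where
  "C_back u v w = at_zero (C_back_double u v w)"

definition c_back_double :: "int perm \<Rightarrow> int perm \<Rightarrow> int perm \<Rightarrow> ratfun" where
  "c_back_double u v w =
     (if perm_length u + perm_length v = perm_length w then C_back_double u v w else 0)"

definition c_back :: "int perm \<Rightarrow> int perm \<Rightarrow> int perm \<Rightarrow> rat" where
  "c_back u v w = at_zero (c_back_double u v w)"

section \<open>Stability numbers\<close>

definition FS_num :: "int perm \<Rightarrow> int perm \<Rightarrow> ereal" where
  "FS_num u v = maximum {FS w | w. w \<in> S_pos \<and> c_single u v w \<noteq> 0}"

definition FS_D :: "int perm \<Rightarrow> int perm \<Rightarrow> ereal" where
  "FS_D u v = maximum {FS w | w. w \<in> S_pos \<and> c_double u v w \<noteq> 0}"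

definition FS_K :: "int perm \<Rightarrow> int perm \<Rightarrow> ereal" where
  "FS_K u v = maximum {FS w | w. w \<in> S_pos \<and> C_single u v w \<noteq> 0}"

definition FS_KD :: "int perm \<Rightarrow> int perm \<Rightarrow> ereal" where
  "FS_KD u v = maximum {FS w | w. w \<in> S_pos \<and> C_double u v w \<noteq> 0}"

definition BS_num :: "int perm \<Rightarrow> int perm \<Rightarrow> ereal" where
  "BS_num u v = maximum {BS w | w. c_back u v w \<noteq> 0}"

definition BS_D :: "int perm \<Rightarrow> int perm \<Rightarrow> ereal" where
  "BS_D u v = maximum {BS w | w. c_back_double u v w \<noteq> 0}"

definition BS_K :: "int perm \<Rightarrow> int perm \<Rightarrow> ereal" where
  "BS_K u v = maximum {BS w | w. C_back u v w \<noteq> 0}"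

definition BS_KD :: "int perm \<Rightarrow> int perm \<Rightarrow> ereal" where
  "BS_KD u v = maximum {BS w | w. C_back_double u v w \<noteq> 0}"

section \<open>Codes\<close>

definition code :: "int perm \<Rightarrow> int \<Rightarrow> nat" where
  "code w i = card {j. j > i \<and> w \<langle>$\<rangle> j < w \<langle>$\<rangle> i}"

definition dualcode :: "int perm \<Rightarrow> int \<Rightarrow> nat" where
  "dualcode w i = card {j. j < i \<and> w \<langle>$\<rangle> j > w \<langle>$\<rangle> i}"

definition theta :: "int \<Rightarrow> int perm \<Rightarrow> int" where
  "theta i w = (if code w i > 0 then 1 else 0)"

definition Theta :: "int \<Rightarrow> int perm \<Rightarrow> int" where
  "Theta i w = (if dualcode w i > 0 then 1 else 0)"

text \<open>\<^const>\<open>Sum_any\<close> sums a function over its (here finite) support.\<close>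

definition lambda_sum :: "int \<Rightarrow> int perm \<Rightarrow> int" where
  "lambda_sum i w = Sum_any (\<lambda>j. if j \<le> i then theta j w else 0)"

definition Lambda_sum :: "int \<Rightarrow> int perm \<Rightarrow> int" where
  "Lambda_sum i w = Sum_any (\<lambda>j. if j \<ge> i then Theta j w else 0)"

definition Xi :: "int perm \<Rightarrow> int perm \<Rightarrow> ereal" where
  "Xi u v = maximum {ereal (of_int (Lambda_sum i u + Lambda_sum i v + i - 1)) | i.
     ereal (of_int i) \<le> 1 + max (FS u) (FS v)}"

definition Omega :: "int perm \<Rightarrow> int perm \<Rightarrow> ereal" where
  "Omega u v = maximum {ereal (of_int (lambda_sum i u + lambda_sum i v - i)) | i.
     ereal (of_int i) \<ge> - max (BS u) (BS v)}"

end

(*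
  With u_i^2 = -beta u_i in the 0-Hecke algebra, the polynomials are the coefficients of the staircase
  product of the factors 1 + ((x_b - y_c) / (1 - beta y_c)) u_(b+c-1); beta = 0 and beta = 1 give the
  Schubert and the Grothendieck case.  The Yang-Baxter equation yields the divided difference rules
  and hence independence; counting dimensions, the G_w with w in S_n form a basis of the polynomials
  whose exponent of x_i is at most n - i.  So FS(u,v) is the maximum over i of deg_i(G_u G_v) + i,
  where deg_i is the degree in x_i.  The degree of G_w in x_i is at most the number of positions
  j > i with a positive entry in the dual code of w, with equality already in lowest total degree if
  position i is a left-to-right maximum of w; at the least i maximizing the bound this holds for both
  u and v.

  For BS, the structure constants are determined by the localizations x_i = y_(z(i)), and these are
  covariant under shifts and under the reflection i -> c - i of the integers when each y_i is
  replaced by the formal inverse of y_(c-i).  The reflection exchanges code and dual code, so the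
  statement for BS is the statement for FS of the reflected permutations.
*)

theory Submission
  imports Defs "HOL-Combinatorics.Permutations" "HOL-Library.FuncSet"
begin

section \<open>Length and descents\<close>

text \<open>One argument has to serve eight families of constants, and its ingredients want opposite
  parameters. The upper bounds hold for every \<open>\<beta>\<close> and every admissible
  \<open>y\<close>, since they only look at exponents. The lower bounds need positivity, available
  at \<open>\<beta> = 0\<close> and \<open>y = 0\<close>, where coefficients count pipe dreams and
  nothing cancels. Localization, in turn, separates the polynomials when the values of
  \<open>y\<close> are distinct, so the reflection cannot be carried out at \<open>y = 0\<close>: it
  is done for the generic \<open>yvar\<close>, and the outcome is specialized. For this the
  structure constants must have no pole at \<open>y = 0\<close>; divided differences followed by
  evaluation at \<open>x = y\<close> extract each of them without creating denominators. The formal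
  inverse -y / (1 - y) vanishes at 0 as well, so the reflected parameters again specialize to the
  single polynomials. The identities of the 0-Hecke algebra are proved for values in an arbitrary
  field: in the field of fractions they give the divided differences, at x_i = y_(z(i)) the
  recursion for the localizations.\<close>

definition desc :: "int perm \<Rightarrow> int \<Rightarrow> bool" where
  "desc w i \<longleftrightarrow> w \<langle>$\<rangle> (i + 1) < w \<langle>$\<rangle> i"

definition inversions :: "int perm \<Rightarrow> (int \<times> int) set" where
  "inversions w = {(i, j). i < j \<and> w \<langle>$\<rangle> j < w \<langle>$\<rangle> i}"

lemma adj_apply: "adj i \<langle>$\<rangle> k = (if k = i then i + 1 else if k = i + 1 then i else k)"
  by (simp add: adj_def)

lemma adj_adj [simp]: "adj i * adj i = 1"
  by (rule perm_eqI) (simp add: apply_times adj_apply)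

lemma mult_adj_adj [simp]: "w * adj i * adj i = w"
  by (simp add: mult.assoc)

lemma adj_mult_adj [simp]: "adj i * (adj i * w) = w"
  by (simp flip: mult.assoc)

lemma inverse_adj [simp]: "inverse (adj i) = adj i"
  by (simp add: adj_def)

lemma adj_braid: "w * adj i * adj (i + 1) * adj i = w * adj (i + 1) * adj i * adj (i + 1)"
  by (rule perm_eqI) (auto simp: apply_times adj_apply)

lemma adj_commute: "\<bar>i - j\<bar> > 1 \<Longrightarrow> w * adj i * adj j = w * adj j * adj i"
  by (rule perm_eqI) (auto simp: apply_times adj_apply)

lemma perm_apply_eq_iff: "w \<langle>$\<rangle> i = w \<langle>$\<rangle> j \<longleftrightarrow> i = j"
  for w :: "'a perm"
  by (metis bij_apply bij_is_inj injD)

lemma mult_adj_neq [simp]: "w * adj i \<noteq> w"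
proof
  assume "w * adj i = w"
  then have "(w * adj i) \<langle>$\<rangle> i = w \<langle>$\<rangle> i" by simp
  then show False by (simp add: apply_times adj_apply perm_apply_eq_iff)
qed

lemma desc_mult_adj [simp]: "desc (w * adj i) i \<longleftrightarrow> \<not> desc w i"
  using perm_apply_eq_iff[of w i "i + 1"] by (auto simp: desc_def apply_times adj_apply)

lemma not_desc_iff: "\<not> desc w i \<longleftrightarrow> w \<langle>$\<rangle> i < w \<langle>$\<rangle> (i + 1)"
  using perm_apply_eq_iff[of w i "i + 1"] by (auto simp: desc_def)

lemma apply_inverse_cancel [simp]: "w \<langle>$\<rangle> (inverse w \<langle>$\<rangle> i) = i" "inverse w \<langle>$\<rangle> (w \<langle>$\<rangle> i) = i"
  for w :: "'a perm"
proof -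
  have "w \<langle>$\<rangle> (inverse w \<langle>$\<rangle> i) = (w * inverse w) \<langle>$\<rangle> i"
    "inverse w \<langle>$\<rangle> (w \<langle>$\<rangle> i) = (inverse w * w) \<langle>$\<rangle> i"
    by (simp_all only: apply_times o_apply)
  then show "w \<langle>$\<rangle> (inverse w \<langle>$\<rangle> i) = i" "inverse w \<langle>$\<rangle> (w \<langle>$\<rangle> i) = i"
    by simp_all
qed

lemma inversions_1 [simp]: "inversions 1 = {}"
  by (auto simp: inversions_def)

lemma perm_eventually_fixed: "\<exists>N. \<forall>i. \<bar>i\<bar> > N \<longrightarrow> w \<langle>$\<rangle> i = i"
  for w :: "int perm"
proof -
  have "finite (abs ` affected w)" by simp
  then obtain N where "\<forall>x\<in>abs ` affected w. x \<le> N"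
    by (meson bdd_above_finite bdd_above_def)
  then show ?thesis
    by (intro exI[of _ N]) (force simp: in_affected)
qed

lemma finite_inversions [simp]: "finite (inversions w)"
proof -
  obtain N where N: "\<And>i. \<bar>i\<bar> > N \<Longrightarrow> w \<langle>$\<rangle> i = i"
    using perm_eventually_fixed by blast
  have img: "\<bar>w \<langle>$\<rangle> i\<bar> \<le> N" if "\<bar>i\<bar> \<le> N" for i
    using N[of "w \<langle>$\<rangle> i"] that perm_apply_eq_iff[of w "w \<langle>$\<rangle> i" i] by force
  have "inversions w \<subseteq> {-N..N} \<times> {-N..N}"
  proof safe
    fix i j assume "(i, j) \<in> inversions w"
    then have ij: "i < j" "w \<langle>$\<rangle> j < w \<langle>$\<rangle> i" by (auto simp: inversions_def)
    have "\<bar>i\<bar> \<le> N \<and> \<bar>j\<bar> \<le> N"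
      using ij N[of i] N[of j] img[of i] img[of j] by linarith
    then show "i \<in> {-N..N}" "j \<in> {-N..N}" by auto
  qed
  then show ?thesis by (rule finite_subset) simp
qed

text \<open>Exchanging the positions \<open>i\<close> and \<open>i + 1\<close> matches the
  inversions before and after, except for the pair \<open>(i, i + 1)\<close> itself, which is new.
  This makes the length, defined by words, computable.\<close>

lemma card_inversions_mult_adj:
  assumes "\<not> desc w i"
  shows "card (inversions (w * adj i)) = Suc (card (inversions w))"
proof -
  let ?f = "\<lambda>(p, q). (adj i \<langle>$\<rangle> p, adj i \<langle>$\<rangle> q)"
  have asc: "w \<langle>$\<rangle> i < w \<langle>$\<rangle> (i + 1)"
    using assms perm_apply_eq_iff[of w i "i + 1"] by (auto simp: desc_def)
  have "inversions (w * adj i) = insert (i, i + 1) (?f ` inversions w)"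
  proof (intro equalityI subsetI)
    fix x assume "x \<in> inversions (w * adj i)"
    then obtain p q where x: "x = (p, q)" "p < q"
      and lt: "w \<langle>$\<rangle> (adj i \<langle>$\<rangle> q) < w \<langle>$\<rangle> (adj i \<langle>$\<rangle> p)"
      by (auto simp: inversions_def apply_times)
    show "x \<in> insert (i, i + 1) (?f ` inversions w)"
    proof (cases "p = i \<and> q = i + 1")
      case False
      have "(adj i \<langle>$\<rangle> p, adj i \<langle>$\<rangle> q) \<in> inversions w"
        using x lt False by (simp add: inversions_def adj_apply split: if_splits)
      moreover have "x = ?f (adj i \<langle>$\<rangle> p, adj i \<langle>$\<rangle> q)"
        by (simp add: x adj_apply)
      ultimately show ?thesis by (metis image_eqI insertI2)
    qed (use x in auto)
  next
    fix x assume "x \<in> insert (i, i + 1) (?f ` inversions w)"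
    then show "x \<in> inversions (w * adj i)"
      using asc by (auto simp: inversions_def apply_times adj_apply split: if_splits)
  qed
  moreover have "(i, i + 1) \<notin> ?f ` inversions w"
    using asc by (auto simp: inversions_def adj_apply split: if_splits)
  moreover have "inj_on ?f (inversions w)"
    by (auto simp: inj_on_def perm_apply_eq_iff)
  ultimately show ?thesis by (simp add: card_image)
qed

lemma card_inversions_desc:
  "desc w i \<Longrightarrow> card (inversions w) = Suc (card (inversions (w * adj i)))"
  using card_inversions_mult_adj[of "w * adj i" i] by simp

text \<open>Without descents \<open>w\<close> is strictly increasing, so k steps to the right raise
  the value by at least k; comparison with points far out on both sides, where \<open>w\<close> is
  the identity, leaves no freedom.\<close>

lemma exists_desc:
  assumes "w \<noteq> 1" shows "\<exists>i. desc w i"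
proof (rule ccontr)
  assume no: "\<nexists>i. desc w i"
  have step: "w \<langle>$\<rangle> i < w \<langle>$\<rangle> (i + 1)" for i
    using no by (simp flip: not_desc_iff)
  have mono: "w \<langle>$\<rangle> i + int k \<le> w \<langle>$\<rangle> (i + int k)" for i k
  proof (induction k)
    case (Suc k)
    then show ?case using step[of "i + int k"] by (simp add: algebra_simps)
  qed simp
  obtain N where N: "\<And>i. \<bar>i\<bar> > N \<Longrightarrow> w \<langle>$\<rangle> i = i"
    using perm_eventually_fixed by blast
  have "w \<langle>$\<rangle> i = i" for i
  proof (rule antisym)
    define k where "k = nat (\<bar>N\<bar> + 1 + \<bar>i\<bar>)"
    have k: "int k = \<bar>N\<bar> + 1 + \<bar>i\<bar>" by (simp add: k_def)
    show "w \<langle>$\<rangle> i \<le> i"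
      using mono[of i k] N[of "i + int k"] by (simp add: k)
    show "i \<le> w \<langle>$\<rangle> i"
      using mono[of "i - int k" k] N[of "i - int k"] by (simp add: k)
  qed
  then have "w = 1" by (intro perm_eqI) simp
  with assms show False by simp
qed

lemma card_inversions_le_length: "card (inversions (prod_list (map adj t))) \<le> length t"
proof (induction t rule: rev_induct)
  case Nil
  then show ?case by simp
next
  case (snoc i t)
  then show ?case
    using card_inversions_mult_adj[of "prod_list (map adj t)" i]
      card_inversions_desc[of "prod_list (map adj t)" i]
    by (cases "desc (prod_list (map adj t)) i") simp_all
qed

text \<open>Bubble sort: every descent that is removed costs one letter and exactly one
  inversion.\<close>

lemma word_exists: "\<exists>t. length t = card (inversions w) \<and> w = prod_list (map adj t)"
proof (induction "card (inversions w)" arbitrary: w)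
  case 0
  have "w = 1"
  proof (rule ccontr)
    assume "w \<noteq> 1"
    then show False using exists_desc card_inversions_desc 0 by (metis Zero_not_Suc)
  qed
  then show ?case by (intro exI[of _ "[]"]) (use 0 in simp)
next
  case (Suc n)
  have "w \<noteq> 1" using Suc(2) by auto
  then obtain i where i: "desc w i" using exists_desc by blast
  then have "n = card (inversions (w * adj i))" using card_inversions_desc Suc(2) by simp
  from Suc(1)[OF this] obtain t where "length t = n" "w * adj i = prod_list (map adj t)"
    using \<open>n = _\<close> by blast
  then have "w * adj i * adj i = prod_list (map adj t) * adj i" by simp
  then have "w = prod_list (map adj (t @ [i]))" by simp
  then show ?case using \<open>length t = n\<close> Suc(2)
    by (intro exI[of _ "t @ [i]"]) simp
qed

lemma perm_length_eq: "perm_length w = card (inversions w)"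
  unfolding perm_length_def
proof (rule Least_equality)
  show "\<exists>t. length t = card (inversions w) \<and> w = prod_list (map adj t)"
    by (rule word_exists)
qed (use card_inversions_le_length in auto)

lemma perm_length_1 [simp]: "perm_length 1 = 0"
  by (simp add: perm_length_eq)

lemma perm_length_mult_adj:
  "perm_length (w * adj i) = (if desc w i then perm_length w - 1 else Suc (perm_length w))"
  using card_inversions_desc[of w i] card_inversions_mult_adj[of w i]
  by (simp add: perm_length_eq)

lemma perm_length_desc: "desc w i \<Longrightarrow> perm_length w = Suc (perm_length (w * adj i))"
  by (simp add: perm_length_eq card_inversions_desc)

lemma perm_length_eq_0_iff [simp]: "perm_length w = 0 \<longleftrightarrow> w = 1"
  using exists_desc perm_length_desc by (metis Zero_not_Suc perm_length_1)

lemma perm_length_mult_adj_gt: "perm_length (w * adj i) > perm_length w \<longleftrightarrow> \<not> desc w i"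
  by (auto simp: perm_length_mult_adj)

lemma inversions_inverse: "card (inversions (inverse w)) = card (inversions w)"
proof -
  have "inversions (inverse w) = (\<lambda>(i, j). (w \<langle>$\<rangle> j, w \<langle>$\<rangle> i)) ` inversions w"
  proof (intro equalityI subsetI)
    fix x assume "x \<in> inversions (inverse w)"
    then show "x \<in> (\<lambda>(i, j). (w \<langle>$\<rangle> j, w \<langle>$\<rangle> i)) ` inversions w"
      by (intro image_eqI[where x = "(inverse w \<langle>$\<rangle> (snd x), inverse w \<langle>$\<rangle> (fst x))"])
        (auto simp: inversions_def)
  qed (auto simp: inversions_def)
  moreover have "inj_on (\<lambda>(i, j). (w \<langle>$\<rangle> j, w \<langle>$\<rangle> i)) (inversions w)"
    by (auto simp: inj_on_def perm_apply_eq_iff)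
  ultimately show ?thesis by (simp add: card_image)
qed

lemma perm_length_inverse: "perm_length (inverse w) = perm_length w"
  by (simp add: perm_length_eq inversions_inverse)

section \<open>The Demazure product\<close>

text \<open>Demazure multiplication by a generator on the right. The left counterpart
  \<open>lstep\<close> is there for the commutation of left and right steps, from which
  associativity follows.\<close>

definition pstep :: "int perm \<Rightarrow> int \<Rightarrow> int perm" where
  "pstep w i = (if desc w i then w else w * adj i)"

definition lstep :: "int \<Rightarrow> int perm \<Rightarrow> int perm" where
  "lstep i w = (if desc (inverse w) i then w else adj i * w)"

definition hprod :: "int list \<Rightarrow> int perm" where
  "hprod t = foldl pstep 1 t"

lemma hprod_Nil [simp]: "hprod [] = 1"
  and hprod_snoc [simp]: "hprod (t @ [i]) = pstep (hprod t) i"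
  by (simp_all add: hprod_def)

lemma lstep_inverse: "lstep i (inverse w) = inverse (pstep w i)"
  by (simp add: lstep_def pstep_def)

text \<open>Let \<open>p\<close> and \<open>q\<close> be the positions of the values
  \<open>i\<close> and \<open>i + 1\<close>. The left step can disturb the descent at
  \<open>j\<close> only if \<open>{p, q} = {j, j + 1}\<close>; then
  \<open>adj i * w = w * adj j\<close>, and both orders make this one exchange or none.\<close>

lemma lstep_pstep_commute: "lstep i (pstep w j) = pstep (lstep i w) j"
proof -
  define p q where "p = inverse w \<langle>$\<rangle> i" and "q = inverse w \<langle>$\<rangle> (i + 1)"
  have wp: "w \<langle>$\<rangle> p = i" and wq: "w \<langle>$\<rangle> q = i + 1"
    by (simp_all add: p_def q_def)
  have inv_eq: "inverse w \<langle>$\<rangle> k = m \<longleftrightarrow> w \<langle>$\<rangle> m = k" for k m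
    by (metis apply_inverse_cancel)
  have p1: "w \<langle>$\<rangle> m = i \<longleftrightarrow> m = p" and q1: "w \<langle>$\<rangle> m = i + 1 \<longleftrightarrow> m = q" for m
    using wp wq perm_apply_eq_iff by metis+
  have pq: "p \<noteq> q" using wp wq by auto
  have neq: "w \<langle>$\<rangle> j \<noteq> w \<langle>$\<rangle> (j + 1)" by (simp add: perm_apply_eq_iff)
  have dl: "desc (inverse w) i \<longleftrightarrow> q < p" by (simp add: desc_def p_def q_def)
  have dl': "desc (inverse (w * adj j)) i \<longleftrightarrow> adj j \<langle>$\<rangle> q < adj j \<langle>$\<rangle> p"
    by (simp add: desc_def p_def q_def perm.inverse_distrib_swap apply_times)
  have dr': "desc (adj i * w) j \<longleftrightarrow> adj i \<langle>$\<rangle> (w \<langle>$\<rangle> (j + 1)) < adj i \<langle>$\<rangle> (w \<langle>$\<rangle> j)"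
    by (simp add: desc_def apply_times)
  show ?thesis
  proof (cases "{p, q} = {j, j + 1}")
    case True
    have comm: "adj i * w = w * adj j"
    proof (rule perm_eqI)
      fix k
      show "(adj i * w) \<langle>$\<rangle> k = (w * adj j) \<langle>$\<rangle> k"
        using True pq wp wq p1[of k] q1[of k]
        by (cases "k = p"; cases "k = q") (auto simp: apply_times adj_apply doubleton_eq_iff)
    qed
    show ?thesis
    proof (cases "p = j")
      case p: True
      then have q: "q = j + 1" using True by (auto simp: doubleton_eq_iff)
      have "\<not> desc w j" using p q wp wq by (simp add: desc_def)
      moreover have "\<not> desc (inverse w) i" unfolding dl using p q by simp
      moreover have "desc (inverse (w * adj j)) i" unfolding dl' using p q by (simp add: adj_apply)
      ultimately show ?thesis by (simp add: lstep_def pstep_def comm del: perm.inverse_distrib_swap)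
    next
      case False
      then have pq': "p = j + 1" "q = j" using True by (auto simp: doubleton_eq_iff)
      have "desc w j" using pq' wp wq by (simp add: desc_def)
      moreover have "desc (inverse w) i" unfolding dl using pq' by simp
      ultimately show ?thesis by (simp add: lstep_def pstep_def)
    qed
  next
    case False
    then have F: "\<not> (p = j \<and> q = j + 1)" "\<not> (p = j + 1 \<and> q = j)" by auto
    have G: "\<not> (w \<langle>$\<rangle> j = i \<and> w \<langle>$\<rangle> (j + 1) = i + 1)" "\<not> (w \<langle>$\<rangle> j = i + 1 \<and> w \<langle>$\<rangle> (j + 1) = i)"
      using F p1 q1 by metis+
    have a: "desc (inverse (w * adj j)) i = desc (inverse w) i"
      unfolding dl dl' adj_apply using F pq by presburger
    have b: "desc (adj i * w) j = desc w j"
      unfolding dr' unfolding desc_def adj_apply using G neq by presburger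
    show ?thesis using a b by (simp add: lstep_def pstep_def mult.assoc)
  qed
qed

lemma foldl_lstep_commute: "foldl pstep (lstep i w) t = lstep i (foldl pstep w t)"
  by (induction t arbitrary: w) (simp_all flip: lstep_pstep_commute)

text \<open>Prefixes of a reduced word are reduced, so every step ascends and the Hecke product
  follows the ordinary one.\<close>

lemma hprod_reduced_word:
  "w = prod_list (map adj t) \<Longrightarrow> length t = perm_length w \<Longrightarrow> hprod t = w"
proof (induction t arbitrary: w rule: rev_induct)
  case (snoc i t)
  let ?v = "prod_list (map adj t)"
  have w: "w = ?v * adj i" using snoc(2) by simp
  have le: "perm_length ?v \<le> length t" by (simp add: perm_length_eq card_inversions_le_length)
  have nd: "\<not> desc ?v i"
    using snoc(3) le by (auto simp: w perm_length_mult_adj)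
  then have "length t = perm_length ?v"
    using snoc(3) by (simp add: w perm_length_mult_adj)
  with snoc(1) have "hprod t = ?v" by blast
  with nd w show ?case by (simp add: pstep_def)
qed simp

lemma hprod_surj: "\<exists>t. hprod t = w \<and> length t = perm_length w"
  using word_exists[of w] hprod_reduced_word[of w] by (auto simp: perm_length_eq)

text \<open>Left and right steps commute and every permutation is reached from \<open>1\<close> by left steps, so the
  effect of a word on the right depends only on its Hecke product.\<close>

lemma foldl_pstep_cong:
  assumes "hprod s = hprod t"
  shows "foldl pstep w s = foldl pstep w t"
proof -
  have "foldl pstep (inverse (hprod r)) s = foldl pstep (inverse (hprod r)) t" for r
  proof (induction r rule: rev_induct)
    case Nil
    then show ?case using assms by (simp add: hprod_def)
  next
    case (snoc i r)
    then show ?case by (simp add: foldl_lstep_commute flip: lstep_inverse)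
  qed
  moreover obtain r where "hprod r = inverse w" using hprod_surj by blast
  ultimately show ?thesis by (metis perm.inverse_inverse)
qed

text \<open>The word is an arbitrary choice, harmless by \<open>foldl_pstep_cong\<close>;
  associativity becomes concatenation of words.\<close>

definition dmul :: "int perm \<Rightarrow> int perm \<Rightarrow> int perm" where
  "dmul u v = foldl pstep u (SOME t. hprod t = v)"

lemma dmul_hprod: "dmul u (hprod t) = foldl pstep u t"
  unfolding dmul_def by (rule foldl_pstep_cong) (metis (mono_tags) someI)

lemma hprod_append: "hprod (s @ t) = dmul (hprod s) (hprod t)"
  by (simp add: dmul_hprod) (simp add: hprod_def)

lemma desc_1 [simp]: "\<not> desc 1 i"
  by (simp add: desc_def)

lemma hprod_single [simp]: "hprod [i] = adj i"
  by (simp add: hprod_def pstep_def)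

lemma dmul_adj: "dmul u (adj i) = pstep u i"
  using dmul_hprod[of u "[i]"] by simp

lemma is_demazure_product_dmul: "is_demazure_product dmul"
  unfolding is_demazure_product_def
proof (intro conjI allI impI)
  fix u v w
  obtain r s t where rst: "hprod r = u" "hprod s = v" "hprod t = w" using hprod_surj by metis
  show "dmul (dmul u v) w = dmul u (dmul v w)"
    unfolding rst[symmetric] by (simp flip: hprod_append)
next
  fix i show "dmul (adj i) (adj i) = adj i"
    by (simp add: dmul_adj pstep_def desc_def adj_apply)
next
  fix i show "dmul (dmul (adj i) (adj (i + 1))) (adj i) = dmul (dmul (adj (i + 1)) (adj i)) (adj (i + 1))"
    using adj_braid[of 1 i] by (simp add: dmul_adj pstep_def desc_def adj_apply apply_times)
next
  fix i j :: int assume "\<bar>i - j\<bar> > 1"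
  then show "dmul (adj i) (adj j) = dmul (adj j) (adj i)"
    using adj_commute[of i j 1] by (auto simp add: dmul_adj pstep_def desc_def adj_apply)
next
  fix w i assume "perm_length (w * adj i) > perm_length w"
  then show "dmul w (adj i) = w * adj i"
    by (simp add: dmul_adj pstep_def perm_length_mult_adj_gt)
qed

lemma is_demazure_product_unique:
  assumes "is_demazure_product m"
  shows "m = dmul"
proof -
  have assoc: "m (m u v) w = m u (m v w)" and idem: "m (adj i) (adj i) = adj i"
    and asc: "\<not> desc w i \<Longrightarrow> m w (adj i) = w * adj i" for u v w i
    using assms perm_length_mult_adj_gt unfolding is_demazure_product_def by blast+
  have step: "m w (adj i) = pstep w i" for w i
  proof (cases "desc w i")
    case True
    then have "m (w * adj i) (adj i) = w" using asc[of "w * adj i" i] by simp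
    then show ?thesis using True assoc idem by (metis pstep_def)
  qed (simp add: asc pstep_def)
  \<comment> \<open>The axioms do not state that 1 is a right identity. Take \<open>i\<close> so far
    out that neither \<open>u\<close> nor \<open>m u 1\<close> has a descent there: associativity
    gives \<open>m u 1 * adj i = u * adj i\<close>, and \<open>adj i\<close> cancels.\<close>
  have one: "m u 1 = u" for u
  proof -
    obtain N where N: "\<And>i. \<bar>i\<bar> > N \<Longrightarrow> u \<langle>$\<rangle> i = i" using perm_eventually_fixed by blast
    obtain M where M: "\<And>i. \<bar>i\<bar> > M \<Longrightarrow> m u 1 \<langle>$\<rangle> i = i" using perm_eventually_fixed by blast
    define i where "i = \<bar>N\<bar> + \<bar>M\<bar> + 1"
    have nd: "\<not> desc u i" "\<not> desc (m u 1) i"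
      using N[of i] N[of "i + 1"] M[of i] M[of "i + 1"] by (auto simp: desc_def i_def)
    have "m (m u 1) (adj i) = m u (adj i)"
      using assoc[of u 1 "adj i"] step[of 1 i] by (simp add: pstep_def)
    then have "m u 1 * adj i = u * adj i" using nd by (simp add: step pstep_def)
    then show ?thesis by (metis mult_adj_adj)
  qed
  have "m u (hprod t) = foldl pstep u t" for u t
  proof (induction t rule: rev_induct)
    case (snoc i t)
    have "m u (hprod (t @ [i])) = m u (m (hprod t) (adj i))" by (simp add: step)
    also have "\<dots> = m (m u (hprod t)) (adj i)" by (rule assoc[symmetric])
    also have "\<dots> = pstep (m u (hprod t)) i" by (rule step)
    finally show ?case by (simp add: snoc)
  qed (simp add: one)
  then show ?thesis
    by (intro ext) (metis dmul_hprod hprod_surj)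
qed

lemma demazure_eq: "demazure = dmul"
  unfolding demazure_def
  by (rule the_equality) (simp_all add: is_demazure_product_dmul is_demazure_product_unique)

lemma hecke_words_eq: "hecke_words w = {t. hprod t = w}"
proof -
  have "foldl demazure u (map adj t) = foldl pstep u t" for u t
    by (induction t arbitrary: u) (simp_all add: demazure_eq dmul_adj)
  then show ?thesis by (auto simp: hecke_words_def hprod_def)
qed

lemma perm_length_hprod_le: "perm_length (hprod t) \<le> length t"
  by (induction t rule: rev_induct) (auto simp: pstep_def perm_length_mult_adj)

lemma reduced_words_eq: "reduced_words w = {t. hprod t = w \<and> length t = perm_length w}"
proof -
  have "hprod t = prod_list (map adj t)" if "length t = perm_length (hprod t)" for t
    using that
  proof (induction t rule: rev_induct)
    case (snoc i t)
    have "\<not> desc (hprod t) i"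
      using snoc(2) perm_length_hprod_le[of t] by (auto simp: pstep_def)
    then show ?case using snoc by (simp add: pstep_def perm_length_mult_adj)
  qed simp
  then have "w = prod_list (map adj t) \<and> length t = perm_length w \<longleftrightarrow>
      hprod t = w \<and> length t = perm_length w" for t
    using hprod_reduced_word[of w t] by blast
  then show ?thesis by (simp add: reduced_words_def)
qed

section \<open>The 0-Hecke algebra and the Yang-Baxter equation\<close>

text \<open>The formal difference of the group law \<open>fadd\<close>: ordinary for
  \<open>\<beta> = 0\<close>, the K-theoretic one for \<open>\<beta> = 1\<close>.\<close>

definition om :: "'a::field \<Rightarrow> 'a \<Rightarrow> 'a \<Rightarrow> 'a" where
  "om \<beta> x y = (x - y) / (1 - \<beta> * y)"

definition fadd :: "'a::field \<Rightarrow> 'a \<Rightarrow> 'a \<Rightarrow> 'a" where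
  "fadd \<beta> x y = x + y - \<beta> * x * y"

lemma om_self [simp]: "om \<beta> x x = 0"
  by (simp add: om_def)

lemma fadd_om:
  "1 - \<beta> * y \<noteq> 0 \<Longrightarrow> 1 - \<beta> * z \<noteq> 0 \<Longrightarrow> fadd \<beta> (om \<beta> x y) (om \<beta> y z) = om \<beta> x z"
  unfolding fadd_def om_def by (simp add: divide_simps) algebra

lemma fadd_om_inverse:
  "1 - \<beta> * y \<noteq> 0 \<Longrightarrow> 1 - \<beta> * z \<noteq> 0 \<Longrightarrow> fadd \<beta> (om \<beta> z y) (om \<beta> y z) = 0"
  by (simp add: fadd_om)

text \<open>Right multiplication by \<open>1 + a u\<^sub>i\<close> in the 0-Hecke algebra with \<open>u\<^sub>i\<^sup>2 = - \<beta> u\<^sub>i\<close>, where a function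
  on permutations stands for the element with these coefficients.\<close>

definition tstep :: "'a::field \<Rightarrow> int \<times> 'a \<Rightarrow> (int perm \<Rightarrow> 'a) \<Rightarrow> int perm \<Rightarrow> 'a" where
  "tstep \<beta> c F w = (if desc w (fst c)
     then (1 - \<beta> * snd c) * F w + snd c * F (w * adj (fst c)) else F w)"

lemma tstep_zero [simp]: "tstep \<beta> (i, 0) F = F"
  by (auto simp: tstep_def)

text \<open>Because u_i squares to -\<beta> u_i, the product of 1 + a u_i and 1 + b u_i is 1 + (a +
  b - \<beta> a b) u_i. The algebra itself dictates the formal group law.\<close>

lemma tstep_add: "tstep \<beta> (i, b) (tstep \<beta> (i, a) F) = tstep \<beta> (i, fadd \<beta> a b) F"
  by (rule ext) (simp add: tstep_def fadd_def algebra_simps)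

lemma neq_mult_adj [simp]: "w \<noteq> w * adj i"
  using mult_adj_neq[of w i] by metis

lemma desc_mult_adj_far: "\<bar>i - j\<bar> > 1 \<Longrightarrow> desc (w * adj i) j \<longleftrightarrow> desc w j"
  by (auto simp: desc_def apply_times adj_apply)

lemma tstep_commute:
  assumes "\<bar>i - j\<bar> > 1"
  shows "tstep \<beta> (i, a) (tstep \<beta> (j, b) F) = tstep \<beta> (j, b) (tstep \<beta> (i, a) F)"
proof (rule ext)
  fix w
  have "\<bar>j - i\<bar> > 1" using assms by simp
  then show "tstep \<beta> (i, a) (tstep \<beta> (j, b) F) w = tstep \<beta> (j, b) (tstep \<beta> (i, a) F) w"
    using assms adj_commute[OF assms, of w]
    by (cases "desc w i"; cases "desc w j") (simp_all add: tstep_def desc_mult_adj_far algebra_simps)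
qed

text \<open>Yang-Baxter equation. Only the six rearrangements of the values at \<open>b\<close>,
  \<open>b + 1\<close>, \<open>b + 2\<close> are involved; the order of these values decides every
  descent, and each case is a polynomial identity.\<close>

lemma tstep_braid:
  "tstep \<beta> (b + 1, c) (tstep \<beta> (b, fadd \<beta> a c) (tstep \<beta> (b + 1, a) F)) =
   tstep \<beta> (b, a) (tstep \<beta> (b + 1, fadd \<beta> a c) (tstep \<beta> (b, c) F))"
proof (rule ext)
  fix w
  define p q r where "p = w \<langle>$\<rangle> b" and "q = w \<langle>$\<rangle> (b + 1)" and "r = w \<langle>$\<rangle> (2 + b)"
  have neq: "p \<noteq> q" "q \<noteq> r" "p \<noteq> r" by (simp_all add: p_def q_def r_def perm_apply_eq_iff)
  define u1 u2 where "u1 = w * adj b" and "u2 = w * adj (b + 1)"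
  define u12 u21 where "u12 = u1 * adj (b + 1)" and "u21 = u2 * adj b"
  define u121 where "u121 = u12 * adj b"
  have u: "w * adj b = u1" "w * adj (b + 1) = u2" "u1 * adj b = w" "u2 * adj (b + 1) = w"
    "u1 * adj (b + 1) = u12" "u2 * adj b = u21" "u12 * adj b = u121" "u21 * adj (b + 1) = u121"
    "u12 * adj (b + 1) = u1" "u21 * adj b = u2"
    using adj_braid[of w b] by (simp_all only: u1_def u2_def u12_def u21_def u121_def mult_adj_adj)
  have d: "desc w b \<longleftrightarrow> q < p" "desc w (b + 1) \<longleftrightarrow> r < q"
    "desc u1 (b + 1) \<longleftrightarrow> r < p" "desc u2 b \<longleftrightarrow> r < p" "desc u12 b \<longleftrightarrow> r < q"
    "desc u21 (b + 1) \<longleftrightarrow> q < p"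
    by (simp_all add: desc_def apply_times adj_apply p_def q_def r_def u1_def u2_def u12_def u21_def)
  have d': "desc u1 b \<longleftrightarrow> \<not> q < p" "desc u2 (b + 1) \<longleftrightarrow> \<not> r < q"
    by (simp_all only: u1_def u2_def desc_mult_adj d)
  show "tstep \<beta> (b + 1, c) (tstep \<beta> (b, fadd \<beta> a c) (tstep \<beta> (b + 1, a) F)) w =
    tstep \<beta> (b, a) (tstep \<beta> (b + 1, fadd \<beta> a c) (tstep \<beta> (b, c) F)) w"
    unfolding tstep_def fst_conv snd_conv u d d' using neq
    by (cases "q < p"; cases "r < q"; cases "r < p") (simp_all add: fadd_def algebra_simps)
qed

lemma fold_tstep_commute:
  assumes "\<forall>c\<in>set cs. \<bar>fst c - i\<bar> > 1"
  shows "fold (tstep \<beta>) cs (tstep \<beta> (i, a) F) = tstep \<beta> (i, a) (fold (tstep \<beta>) cs F)"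
  using assms
proof (induction cs arbitrary: F)
  case (Cons c cs)
  have "tstep \<beta> c (tstep \<beta> (i, a) F) = tstep \<beta> (i, a) (tstep \<beta> c F)"
    using Cons.prems tstep_commute[of "fst c" i \<beta> "snd c" a F] by simp
  then show ?case using Cons by simp
qed simp

section \<open>Staircase products: exchange of variables and the diagonal\<close>

definition row :: "'a::field \<Rightarrow> (int \<Rightarrow> 'a) \<Rightarrow> 'a \<Rightarrow> int \<Rightarrow> nat \<Rightarrow> (int \<times> 'a) list" where
  "row \<beta> y x l m = map (\<lambda>j. (l + int j, om \<beta> x (y (int j + 1)))) (rev [0..<m])"

text \<open>The Fomin-Kirillov factorization: for \<open>l = 1\<close>, the factor with letter t in
  row i carries x_i and y_(t-i+1). The first letter \<open>l\<close> is kept free so that removing a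
  row or a column leaves a staircase of the same kind.\<close>

fun stair :: "'a::field \<Rightarrow> (int \<Rightarrow> 'a) \<Rightarrow> (int \<Rightarrow> 'a) \<Rightarrow> int \<Rightarrow> nat \<Rightarrow> (int \<times> 'a) list" where
  "stair \<beta> x y l 0 = []"
| "stair \<beta> x y l (Suc m) = row \<beta> y (x 1) l (Suc m) @ stair \<beta> (\<lambda>i. x (i + 1)) y (l + 1) m"

lemma row_0 [simp]: "row \<beta> y x l 0 = []"
  by (simp add: row_def)

lemma row_Suc_top: "row \<beta> y x l (Suc m) = (l + int m, om \<beta> x (y (int m + 1))) # row \<beta> y x l m"
  by (simp add: row_def)

lemma row_Suc_bot:
  "row \<beta> y x l (Suc m) = row \<beta> (\<lambda>i. y (i + 1)) x (l + 1) m @ [(l, om \<beta> x (y 1))]"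
proof (induction m)
  case 0
  then show ?case by (simp add: row_def)
next
  case (Suc m)
  have "row \<beta> y x l (Suc (Suc m)) = (l + int (Suc m), om \<beta> x (y (int (Suc m) + 1))) # row \<beta> y x l (Suc m)"
    by (rule row_Suc_top)
  also have "\<dots> = row \<beta> (\<lambda>i. y (i + 1)) x (l + 1) (Suc m) @ [(l, om \<beta> x (y 1))]"
    by (simp only: Suc) (simp add: row_Suc_top algebra_simps)
  finally show ?case .
qed

lemma stair_unfold:
  "stair \<beta> x y l m = row \<beta> y (x 1) l m @ stair \<beta> (\<lambda>i. x (i + 1)) y (l + 1) (m - 1)"
  by (cases m) simp_all

lemma fst_row: "c \<in> set (row \<beta> y x l m) \<Longrightarrow> l \<le> fst c"
  by (auto simp: row_def)

lemma fst_stair: "c \<in> set (stair \<beta> x y l m) \<Longrightarrow> l \<le> fst c"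
proof (induction m arbitrary: x l)
  case (Suc m)
  then show ?case using fst_row[of c \<beta> y "x 1" l "Suc m"] by fastforce
qed simp

lemma stair_cong: "(\<And>i. i \<ge> 1 \<Longrightarrow> x i = x' i) \<Longrightarrow> stair \<beta> x y l m = stair \<beta> x' y l m"
proof (induction m arbitrary: x x' l)
  case (Suc m)
  have "stair \<beta> (\<lambda>i. x (i + 1)) y (l + 1) m = stair \<beta> (\<lambda>i. x' (i + 1)) y (l + 1) m"
    by (rule Suc.IH) (simp add: Suc.prems)
  then show ?case by (simp add: Suc.prems)
qed simp

text \<open>The induction splits off the lowest letter of each row. The factor
  \<open>om \<beta> x x'\<close> that the shorter rows leave at \<open>l + 1\<close> meets the two
  split-off factors in the shape of the Yang-Baxter equation, since the formal sum of
  \<open>om \<beta> x x'\<close> and \<open>om \<beta> x' (y 1)\<close> is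
  \<open>om \<beta> x (y 1)\<close>.\<close>

lemma fold_two_rows:
  assumes "\<And>i. 1 - \<beta> * y i \<noteq> 0" "1 - \<beta> * x' \<noteq> 0"
  shows "fold (tstep \<beta>) (row \<beta> y x l (Suc m) @ row \<beta> y x' (l + 1) m) F =
    tstep \<beta> (l, om \<beta> x x') (fold (tstep \<beta>) (row \<beta> y x' l (Suc m) @ row \<beta> y x (l + 1) m) F)"
  using assms(1)
proof (induction m arbitrary: l y F)
  case 0
  have "fadd \<beta> (om \<beta> x' (y 1)) (om \<beta> x x') = om \<beta> x (y 1)"
    using fadd_om[OF assms(2) 0, of x 1] by (simp add: fadd_def algebra_simps)
  then show ?case by (simp add: row_Suc_top tstep_add)
next
  case (Suc m)
  let ?y = "\<lambda>i. y (i + 1)"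
  let ?a = "om \<beta> x x'" and ?c = "om \<beta> x' (y 1)"
  have ac: "om \<beta> x (y 1) = fadd \<beta> ?a ?c"
    using fadd_om[OF assms(2) Suc.prems] by simp
  have comm: "fold (tstep \<beta>) (row \<beta> ?y z (l + 2) m) (tstep \<beta> (l, a) G) =
      tstep \<beta> (l, a) (fold (tstep \<beta>) (row \<beta> ?y z (l + 2) m) G)" for z a G
    by (rule fold_tstep_commute) (use fst_row in fastforce)
  have IH: "fold (tstep \<beta>) (row \<beta> ?y x' (l + 2) m) (fold (tstep \<beta>) (row \<beta> ?y x (l + 1) (Suc m)) F) =
    tstep \<beta> (l + 1, ?a) (fold (tstep \<beta>) (row \<beta> ?y x (l + 2) m)
      (fold (tstep \<beta>) (row \<beta> ?y x' (l + 1) (Suc m)) F))"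
    using Suc.IH[of ?y "l + 1" F] Suc.prems by (simp add: add.assoc)
  have rows: "row \<beta> y z l (Suc (Suc m)) = row \<beta> ?y z (l + 1) (Suc m) @ [(l, om \<beta> z (y 1))]"
    "row \<beta> y z (l + 1) (Suc m) = row \<beta> ?y z (l + 2) m @ [(l + 1, om \<beta> z (y 1))]" for z
    by (simp_all add: row_Suc_bot[of \<beta> y z l "Suc m"] row_Suc_bot[of \<beta> y z "l + 1" m] add.assoc)
  show ?case
    unfolding rows fold_append fold_simps comp_def comm IH
    unfolding ac by (rule tstep_braid)
qed

text \<open>Only the two rows with the exchanged variables are rewritten. The extra factor has
  letter \<open>l + r\<close>, whereas the rows after these two start at \<open>l + r + 2\<close>,
  so it commutes past them.\<close>

lemma fold_stair_swap:
  assumes "\<And>i. 1 - \<beta> * y i \<noteq> 0" "\<And>i. 1 - \<beta> * x i \<noteq> 0" "r < m"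
  shows "fold (tstep \<beta>) (stair \<beta> x y l m) F =
    tstep \<beta> (l + int r, om \<beta> (x (int r + 1)) (x (int r + 2)))
      (fold (tstep \<beta>) (stair \<beta> (\<lambda>i. x (adj (int r + 1) \<langle>$\<rangle> i)) y l m) F)"
  using assms(2,3)
proof (induction r arbitrary: x l m F)
  case 0
  then obtain n where m: "m = Suc n" by (cases m) auto
  let ?x = "\<lambda>i. x (adj (int 0 + 1) \<langle>$\<rangle> i)"
  have st: "stair \<beta> z y l m = row \<beta> y (z 1) l (Suc n) @ row \<beta> y (z 2) (l + 1) n @
      stair \<beta> (\<lambda>i. z (i + 2)) y (l + 2) (n - 1)" for z
    using stair_unfold[of \<beta> "\<lambda>i. z (i + 1)" y "l + 1" n] by (simp add: m add.assoc)
  have eq: "stair \<beta> (\<lambda>i. ?x (i + 2)) y (l + 2) (n - 1) = stair \<beta> (\<lambda>i. x (i + 2)) y (l + 2) (n - 1)"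
    by (rule stair_cong) (simp add: adj_apply)
  have x12: "?x 1 = x 2" "?x 2 = x 1" by (simp_all add: adj_apply)
  have comm: "fold (tstep \<beta>) (stair \<beta> (\<lambda>i. x (i + 2)) y (l + 2) (n - 1)) (tstep \<beta> (l, a) G) =
      tstep \<beta> (l, a) (fold (tstep \<beta>) (stair \<beta> (\<lambda>i. x (i + 2)) y (l + 2) (n - 1)) G)" for a G
    by (rule fold_tstep_commute) (use fst_stair in fastforce)
  have two: "fold (tstep \<beta>) (row \<beta> y (x 2) (l + 1) n) (fold (tstep \<beta>) (row \<beta> y (x 1) l (Suc n)) F) =
    tstep \<beta> (l, om \<beta> (x 1) (x 2))
     (fold (tstep \<beta>) (row \<beta> y (x 1) (l + 1) n) (fold (tstep \<beta>) (row \<beta> y (x 2) l (Suc n)) F))"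
    using fold_two_rows[where x = "x 1" and x' = "x 2" and l = l and m = n and F = F, OF assms(1) 0(1)]
    by simp
  show ?case
    unfolding st eq x12 by (simp only: fold_append comp_def two comm) simp
next
  case (Suc r)
  then obtain n where m: "m = Suc n" "r < n" by (cases m) auto
  have x1: "x (adj (int (Suc r) + 1) \<langle>$\<rangle> 1) = x 1" by (simp add: adj_apply)
  have xs: "(\<lambda>i. x (adj (int (Suc r) + 1) \<langle>$\<rangle> (i + 1))) = (\<lambda>i. x (adj (int r + 1) \<langle>$\<rangle> i + 1))"
    by (rule ext) (simp add: adj_apply)
  have idx: "l + 1 + int r = l + int (Suc r)" "int r + 1 + 1 = int (Suc r) + 1"
    "int r + 2 + 1 = int (Suc r) + 2" by simp_all
  show ?case
    using Suc.IH[of "\<lambda>i. x (i + 1)" n "l + 1" "fold (tstep \<beta>) (row \<beta> y (x 1) l (Suc n)) F"] Suc.prems(1) m(2)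
    unfolding m(1) stair.simps x1 xs fold_append comp_def idx by simp
qed

definition col :: "'a::field \<Rightarrow> (int \<Rightarrow> 'a) \<Rightarrow> 'a \<Rightarrow> int \<Rightarrow> nat \<Rightarrow> (int \<times> 'a) list" where
  "col \<beta> x z l m = map (\<lambda>j. (l + int j, om \<beta> (x (int j + 1)) z)) [0..<m]"

lemma col_0 [simp]: "col \<beta> x z l 0 = []"
  by (simp add: col_def)

lemma col_Suc: "col \<beta> x z l (Suc m) = col \<beta> x z l m @ [(l + int m, om \<beta> (x (int m + 1)) z)]"
  by (simp add: col_def)

lemma col_Suc': "col \<beta> x z l (Suc m) = (l, om \<beta> (x 1) z) # col \<beta> (\<lambda>i. x (i + 1)) z (l + 1) m"
proof (induction m)
  case (Suc m)
  show ?case unfolding col_Suc[of _ _ _ _ "Suc m"] Suc by (simp add: col_Suc algebra_simps)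
qed (simp add: col_def)

text \<open>The factors with \<open>y 1\<close> are the lowest letters of the rows. Later rows,
  deprived of their own lowest letters, start at least two letters higher, so each of these factors
  can move behind them.\<close>

lemma fold_stair_column:
  "fold (tstep \<beta>) (stair \<beta> x y l m) F =
   fold (tstep \<beta>) (stair \<beta> x (\<lambda>i. y (i + 1)) (l + 1) (m - 1) @ col \<beta> x (y 1) l m) F"
proof (induction m arbitrary: x l F)
  case (Suc m)
  let ?x = "\<lambda>i. x (i + 1)" and ?y = "\<lambda>i. y (i + 1)"
  have comm: "fold (tstep \<beta>) (stair \<beta> ?x ?y (l + 1 + 1) (m - 1)) (tstep \<beta> (l, a) G) =
      tstep \<beta> (l, a) (fold (tstep \<beta>) (stair \<beta> ?x ?y (l + 1 + 1) (m - 1)) G)" for a G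
    by (rule fold_tstep_commute) (use fst_stair in fastforce)
  have st: "stair \<beta> x ?y (l + 1) (Suc m - 1) =
      row \<beta> ?y (x 1) (l + 1) m @ stair \<beta> ?x ?y (l + 1 + 1) (m - 1)"
    using stair_unfold[of \<beta> x ?y "l + 1" m] by simp
  show ?case
    unfolding st stair.simps(2) row_Suc_bot col_Suc' fold_append comp_def Suc.IH fold_simps comm ..
qed simp

text \<open>The last factor of the row and the first of the column share a letter and have formally
  inverse parameters; the cancellation goes on outwards.\<close>

lemma fold_col_row:
  assumes "\<And>i. 1 - \<beta> * x i \<noteq> 0" "1 - \<beta> * z \<noteq> 0"
  shows "fold (tstep \<beta>) (col \<beta> x z l m) (fold (tstep \<beta>) (row \<beta> x z l m) F) = F"
proof (induction m arbitrary: F)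
  case (Suc m)
  show ?case
    by (simp add: row_Suc_top col_Suc Suc tstep_add fadd_om_inverse[OF assms])
qed simp

text \<open>At x = y the corner factor is trivial, and the rest of the first row is inverse to the
  column of \<open>y 1\<close> in the remaining rows. What stands between them is again a diagonal
  staircase, trivial by induction.\<close>

lemma fold_stair_diagonal:
  assumes "\<And>i. 1 - \<beta> * y i \<noteq> 0"
  shows "fold (tstep \<beta>) (stair \<beta> y y l m) F = F"
  using assms
proof (induction m arbitrary: y l F rule: less_induct)
  case (less m)
  show ?case
  proof (cases m)
    case (Suc n)
    let ?y = "\<lambda>i. y (i + 1)"
    have IH: "fold (tstep \<beta>) (stair \<beta> ?y ?y (l + 1 + 1) (n - 1)) G = G" for G
      by (rule less.IH) (use Suc less.prems in auto)
    have "fold (tstep \<beta>) (stair \<beta> y y l m) F =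
        fold (tstep \<beta>) (stair \<beta> ?y y (l + 1) n) (fold (tstep \<beta>) (row \<beta> y (y 1) l (Suc n)) F)"
      by (simp add: Suc)
    also have "\<dots> = fold (tstep \<beta>) (col \<beta> ?y (y 1) (l + 1) n)
        (fold (tstep \<beta>) (row \<beta> y (y 1) l (Suc n)) F)"
      by (subst fold_stair_column) (simp only: fold_append comp_def IH)
    also have "\<dots> = F"
      using fold_col_row[of \<beta> ?y "y 1" "l + 1" n F] less.prems by (simp add: row_Suc_bot)
    finally show ?thesis .
  qed simp
qed

section \<open>Pipe dream sums as coefficients\<close>

text \<open>The pipe dream sum for values in a field, so that one identity serves for generic
  variables, for the diagonal and for localizations.\<close>

definition gsum :: "'a::field \<Rightarrow> (int \<Rightarrow> 'a) \<Rightarrow> (int \<Rightarrow> 'a) \<Rightarrow> int perm \<Rightarrow> 'a" where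
  "gsum \<beta> x y w = (\<Sum>(t, b) | t \<in> hecke_words w \<and> compatible t b.
     (- \<beta>) ^ (length t - perm_length w) * (\<Prod>i<length t. om \<beta> (x (b ! i)) (y (t ! i - b ! i + 1))))"

text \<open>The order in which the staircase lists its factors: by rows, with decreasing letters in
  a row. The compatibility conditions on neighbours say exactly that the cells increase in this
  order, see \<open>compatible_iff\<close>.\<close>

definition cell_less :: "int \<times> int \<Rightarrow> int \<times> int \<Rightarrow> bool" where
  "cell_less c d \<longleftrightarrow> fst c < fst d \<or> fst c = fst d \<and> snd d < snd c"

lemma transp_cell_less: "transp cell_less"
  by (auto simp: transp_def cell_less_def)

fun cells :: "int \<Rightarrow> nat \<Rightarrow> (int \<times> int) list" where
  "cells b 0 = []"
| "cells b (Suc m) = map (\<lambda>j. (b, b + int j)) (rev [0..<Suc m]) @ cells (b + 1) m"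

lemma set_cells: "set (cells b m) = {(b', t). b \<le> b' \<and> b' \<le> t \<and> t < b + int m}"
proof (induction m arbitrary: b)
  case (Suc m)
  have "(\<lambda>j. (b, b + int j)) ` set [0..<Suc m] = {(b', t). b' = b \<and> b \<le> t \<and> t < b + int (Suc m)}"
  proof (intro equalityI subsetI)
    fix c assume "c \<in> {(b', t). b' = b \<and> b \<le> t \<and> t < b + int (Suc m)}"
    then show "c \<in> (\<lambda>j. (b, b + int j)) ` set [0..<Suc m]"
      by (intro image_eqI[of _ _ "nat (snd c - b)"]) auto
  qed auto
  then have "set (cells b (Suc m)) = {(b', t). b' = b \<and> b \<le> t \<and> t < b + int (Suc m)} \<union>
      {(b', t). b + 1 \<le> b' \<and> b' \<le> t \<and> t < b + 1 + int m}"
    by (simp only: cells.simps set_append set_map set_rev Suc)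
  also have "\<dots> = {(b', t). b \<le> b' \<and> b' \<le> t \<and> t < b + int (Suc m)}" by auto
  finally show ?case .
qed auto

lemma sorted_cells: "sorted_wrt cell_less (cells b m)"
proof (induction m arbitrary: b)
  case (Suc m)
  have "sorted_wrt cell_less (map (\<lambda>j. (b, b + int j)) (rev [0..<k]))" for k
    by (induction k) (auto simp: cell_less_def)
  moreover have "cell_less c d" if "c \<in> set (map (\<lambda>j. (b, b + int j)) (rev [0..<Suc m]))"
      "d \<in> set (cells (b + 1) m)" for c d
    using that by (auto simp: set_cells cell_less_def simp del: upt_Suc)
  ultimately show ?case
    using Suc unfolding cells.simps sorted_wrt_append by blast
qed simp

lemma stair_cells:
  "stair \<beta> (\<lambda>i. x (i + b - 1)) y b m = map (\<lambda>(b, t). (t, om \<beta> (x b) (y (t - b + 1)))) (cells b m)"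
proof (induction m arbitrary: b)
  case (Suc m)
  have "stair \<beta> (\<lambda>i. x (i + 1 + b - 1)) y (b + 1) m =
      map (\<lambda>(b, t). (t, om \<beta> (x b) (y (t - b + 1)))) (cells (b + 1) m)"
    using Suc.IH[of "b + 1"] by (simp add: algebra_simps)
  then show ?case by (simp add: row_def)
qed simp

text \<open>Subsets of the cells, each represented by its unique increasing list.\<close>

definition cell_lists :: "(int \<times> int) list \<Rightarrow> (int \<times> int) list set" where
  "cell_lists cl = {s. sorted_wrt cell_less s \<and> set s \<subseteq> set cl}"

lemma cell_less_irrefl [simp]: "\<not> cell_less c c"
  by (simp add: cell_less_def)

lemma cell_lists_snoc:
  assumes "sorted_wrt cell_less (cl @ [c])"
  shows "cell_lists (cl @ [c]) = cell_lists cl \<union> (\<lambda>s. s @ [c]) ` cell_lists cl"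
proof (intro equalityI subsetI)
  have lt: "\<And>d. d \<in> set cl \<Longrightarrow> cell_less d c" using assms by (auto simp: sorted_wrt_append)
  fix s assume s: "s \<in> cell_lists (cl @ [c])"
  show "s \<in> cell_lists cl \<union> (\<lambda>s. s @ [c]) ` cell_lists cl"
  proof (cases "c \<in> set s")
    case True
    then obtain r q where rq: "s = r @ c # q" by (meson split_list)
    have sw: "sorted_wrt cell_less (r @ c # q)" and sub: "set (r @ c # q) \<subseteq> insert c (set cl)"
      using s by (auto simp: cell_lists_def rq)
    have "q = []"
    proof (cases q)
      case (Cons d q')
      then have "cell_less c d" using sw by (auto simp: sorted_wrt_append)
      moreover have "d \<in> insert c (set cl)" using sub Cons by simp
      then have "d = c \<or> cell_less d c" using lt by blast
      ultimately show ?thesis by (auto simp: cell_less_def)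
    qed
    moreover have "c \<notin> set r" using sw by (auto simp: sorted_wrt_append)
    then have "r \<in> cell_lists cl"
      using sw sub by (auto simp: cell_lists_def sorted_wrt_append)
    ultimately show ?thesis using rq by auto
  next
    case False
    then show ?thesis using s by (auto simp: cell_lists_def)
  qed
next
  have lt: "\<And>d. d \<in> set cl \<Longrightarrow> cell_less d c" using assms by (auto simp: sorted_wrt_append)
  fix s assume "s \<in> cell_lists cl \<union> (\<lambda>s. s @ [c]) ` cell_lists cl"
  then show "s \<in> cell_lists (cl @ [c])"
    using lt by (auto simp: cell_lists_def sorted_wrt_append subset_iff)
qed

lemma desc_pstep [simp]: "desc (pstep w i) i"
  by (simp add: pstep_def)

lemma pstep_eq_iff: "pstep v i = w \<longleftrightarrow> desc w i \<and> (v = w \<or> v = w * adj i)"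
proof
  assume "pstep v i = w"
  then show "desc w i \<and> (v = w \<or> v = w * adj i)"
    using desc_pstep[of v i] by (auto simp: pstep_def split: if_splits)
qed (auto simp: pstep_def)

definition unit_fun :: "int perm \<Rightarrow> 'a::field" where
  "unit_fun w = (if w = 1 then 1 else 0)"

definition cell_weight :: "'a::field \<Rightarrow> (int \<times> int \<Rightarrow> 'a) \<Rightarrow> int perm \<Rightarrow> (int \<times> int) list \<Rightarrow> 'a" where
  "cell_weight \<beta> a w s = (if hprod (map snd s) = w
     then (- \<beta>) ^ (length s - perm_length w) * prod_list (map a s) else 0)"

lemma cell_weight_snoc:
  "cell_weight \<beta> a w (s @ [c]) = (if desc w (snd c)
     then - \<beta> * a c * cell_weight \<beta> a w s + a c * cell_weight \<beta> a (w * adj (snd c)) s else 0)"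
proof (cases "desc w (snd c)")
  case True
  let ?v = "hprod (map snd s)"
  have len: "perm_length ?v \<le> length s" using perm_length_hprod_le[of "map snd s"] by simp
  have hp: "hprod (map snd (s @ [c])) = pstep ?v (snd c)" by simp
  consider "?v = w" | "?v = w * adj (snd c)" | "?v \<noteq> w" "?v \<noteq> w * adj (snd c)" by blast
  then show ?thesis
  proof cases
    case 1
    then have "Suc (length s) - perm_length w = Suc (length s - perm_length w)"
      using len by (simp add: Suc_diff_le)
    moreover have "pstep w (snd c) = w" using True by (simp add: pstep_def)
    ultimately show ?thesis
      unfolding cell_weight_def hp using 1 True by (simp add: algebra_simps)
  next
    case 2
    moreover have "pstep (w * adj (snd c)) (snd c) = w" using True by (simp add: pstep_def)
    moreover have "perm_length w = Suc (perm_length (w * adj (snd c)))"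
      using True by (rule perm_length_desc)
    ultimately show ?thesis
      unfolding cell_weight_def hp using True by (simp add: algebra_simps)
  next
    case 3
    then show ?thesis unfolding cell_weight_def hp by (simp add: pstep_eq_iff)
  qed
next
  case False
  then show ?thesis by (simp add: cell_weight_def pstep_eq_iff)
qed

text \<open>Expanding the product: every cell contributes either 1 or its generator, and the last
  cell gives the recursion \<open>cell_weight_snoc\<close>.\<close>

lemma fold_cells:
  assumes "sorted_wrt cell_less cl"
  shows "finite (cell_lists cl) \<and>
    fold (tstep \<beta>) (map (\<lambda>c. (snd c, a c)) cl) unit_fun w = (\<Sum>s\<in>cell_lists cl. cell_weight \<beta> a w s)"
  using assms
proof (induction cl arbitrary: w rule: rev_induct)
  case Nil
  have "cell_lists [] = {[]}" by (auto simp: cell_lists_def)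
  then show ?case by (auto simp: unit_fun_def cell_weight_def)
next
  case (snoc c cl)
  have sor: "sorted_wrt cell_less cl" using snoc.prems by (simp add: sorted_wrt_append)
  note IH = snoc.IH[OF sor]
  have "c \<notin> set cl" using snoc.prems by (fastforce simp: sorted_wrt_append)
  then have dis: "cell_lists cl \<inter> (\<lambda>s. s @ [c]) ` cell_lists cl = {}"
    by (auto simp: cell_lists_def)
  have inj: "inj_on (\<lambda>s. s @ [c]) (cell_lists cl)" by (auto simp: inj_on_def)
  define S where "S v = (\<Sum>s\<in>cell_lists cl. cell_weight \<beta> a v s)" for v
  define G where "G = fold (tstep \<beta>) (map (\<lambda>c. (snd c, a c)) cl) unit_fun"
  have G: "G v = S v" for v using snoc.IH[OF sor, of v] by (simp add: G_def S_def)
  have "(\<Sum>s\<in>cell_lists (cl @ [c]). cell_weight \<beta> a w s) =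
      S w + (\<Sum>s\<in>cell_lists cl. cell_weight \<beta> a w (s @ [c]))"
    using IH by (simp add: cell_lists_snoc[OF snoc.prems] sum.union_disjoint dis sum.reindex inj S_def)
  also have "(\<Sum>s\<in>cell_lists cl. cell_weight \<beta> a w (s @ [c])) =
      (if desc w (snd c) then - \<beta> * a c * S w + a c * S (w * adj (snd c)) else 0)"
    by (simp add: cell_weight_snoc sum_subtractf sum_negf sum_distrib_left S_def)
  also have "S w + \<dots> = tstep \<beta> (snd c, a c) G w"
    by (simp add: tstep_def G algebra_simps)
  also have "\<dots> = fold (tstep \<beta>) (map (\<lambda>c. (snd c, a c)) (cl @ [c])) unit_fun w"
    by (simp add: G_def)
  finally show ?case using IH by (simp add: cell_lists_snoc[OF snoc.prems])
qed

lemma finite_cell_lists [simp]: "finite (cell_lists (cells b m))"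
  using fold_cells[OF sorted_cells, of b m "0 :: rat" "\<lambda>_. 0" 1] by simp

text \<open>No later step undoes a crossing of the gap after \<open>i\<close>, and a step with
  letter \<open>i\<close> creates one: otherwise the result would permute the integers up to
  \<open>i\<close>, while its descent at \<open>i\<close> sends \<open>i + 1\<close> among them.
  This bounds the letters of Hecke words and makes the defining sums finite.\<close>

lemma hprod_crossing: "i \<in> set t \<Longrightarrow> \<exists>j\<le>i. hprod t \<langle>$\<rangle> j > i"
proof (induction t rule: rev_induct)
  case (snoc b t)
  let ?v = "hprod t"
  have cross: "\<exists>j\<le>i. pstep ?v b \<langle>$\<rangle> j > i" if "\<exists>j\<le>i. ?v \<langle>$\<rangle> j > i"
  proof -
    from that obtain j where j: "j \<le> i" "?v \<langle>$\<rangle> j > i" by blast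
    show ?thesis
    proof (cases "desc ?v b")
      case True
      then show ?thesis using j by (auto simp: pstep_def)
    next
      case False
      have "(\<exists>k\<le>i. ?v \<langle>$\<rangle> (adj b \<langle>$\<rangle> k) > i)"
      proof (cases "j = b \<and> b = i")
        case True
        then show ?thesis
          using False j by (intro exI[of _ i]) (auto simp: adj_apply not_desc_iff)
      next
        case False
        then show ?thesis
          using j by (intro exI[of _ "adj b \<langle>$\<rangle> j"]) (auto simp: adj_apply)
      qed
      then show ?thesis using False by (simp add: pstep_def apply_times)
    qed
  qed
  show ?case
  proof (cases "i \<in> set t")
    case True
    then show ?thesis using snoc.IH cross by simp
  next
    case False
    then have b: "b = i" using snoc.prems by simp
    show ?thesis
    proof (rule ccontr)
      assume no: "\<not> ?thesis"
      let ?w = "pstep ?v i"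
      have le: "\<forall>j\<le>i. ?w \<langle>$\<rangle> j \<le> i" using no b by (auto simp: not_less)
      obtain N where N: "\<And>j. \<bar>j\<bar> > N \<Longrightarrow> ?w \<langle>$\<rangle> j = j" using perm_eventually_fixed by blast
      \<comment> \<open>Everything below \<open>M\<close> is fixed, so a permutation that keeps the
        integers up to \<open>i\<close> together permutes the finite interval
        \<open>{M..i}\<close>.\<close>
      define M where "M = - \<bar>N\<bar> - \<bar>i\<bar> - 1"
      have ge: "M \<le> ?w \<langle>$\<rangle> j" if "M \<le> j" for j
      proof (rule ccontr)
        assume lt: "\<not> M \<le> ?w \<langle>$\<rangle> j"
        then have "?w \<langle>$\<rangle> (?w \<langle>$\<rangle> j) = ?w \<langle>$\<rangle> j" by (intro N) (simp add: M_def)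
        then show False using that lt by (simp add: perm_apply_eq_iff)
      qed
      have "(\<lambda>j. ?w \<langle>$\<rangle> j) ` {M..i} \<subseteq> {M..i}" using le ge by auto
      moreover have "inj_on (\<lambda>j. ?w \<langle>$\<rangle> j) {M..i}" by (auto simp: inj_on_def perm_apply_eq_iff)
      ultimately have surj: "(\<lambda>j. ?w \<langle>$\<rangle> j) ` {M..i} = {M..i}"
        by (intro card_subset_eq) (simp_all add: card_image)
      have "?w \<langle>$\<rangle> (i + 1) < ?w \<langle>$\<rangle> i" using desc_pstep[of ?v i] by (simp add: desc_def)
      then have "?w \<langle>$\<rangle> (i + 1) \<le> i" using le by force
      moreover have "M \<le> ?w \<langle>$\<rangle> (i + 1)" by (rule ge) (simp add: M_def)
      ultimately have "?w \<langle>$\<rangle> (i + 1) \<in> (\<lambda>j. ?w \<langle>$\<rangle> j) ` {M..i}" unfolding surj by simp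
      then show False by (auto simp: perm_apply_eq_iff)
    qed
  qed
qed simp

lemma hecke_word_letter_le:
  assumes "\<And>i. i > n \<Longrightarrow> hprod t \<langle>$\<rangle> i = i" "i \<in> set t"
  shows "i < n"
proof (rule ccontr)
  assume "\<not> i < n"
  obtain j where j: "j \<le> i" "hprod t \<langle>$\<rangle> j > i" using hprod_crossing assms(2) by blast
  then have "hprod t \<langle>$\<rangle> (hprod t \<langle>$\<rangle> j) = hprod t \<langle>$\<rangle> j" by (intro assms(1)) (use \<open>\<not> i < n\<close> in simp)
  then show False using j by (simp add: perm_apply_eq_iff)
qed

lemma compatible_iff:
  "compatible t b \<longleftrightarrow> length b = length t \<and> (\<forall>c\<in>set (zip b t). 1 \<le> fst c \<and> fst c \<le> snd c) \<and>
     sorted_wrt cell_less (zip b t)"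
proof (cases "length b = length t")
  case True
  then have "sorted_wrt cell_less (zip b t) \<longleftrightarrow>
      (\<forall>i. Suc i < length t \<longrightarrow> cell_less (b ! i, t ! i) (b ! Suc i, t ! Suc i))"
    by (simp add: sorted_wrt_iff_nth_Suc_transp[OF transp_cell_less])
  moreover have "(\<forall>c\<in>set (zip b t). 1 \<le> fst c \<and> fst c \<le> snd c) \<longleftrightarrow>
      (\<forall>i<length t. 1 \<le> b ! i \<and> b ! i \<le> t ! i)"
    using True by (auto simp: set_zip)
  moreover have "cell_less (b ! i, t ! i) (b ! Suc i, t ! Suc i) \<longleftrightarrow>
      b ! i \<le> b ! Suc i \<and> (t ! i \<le> t ! Suc i \<longrightarrow> b ! i < b ! Suc i)" for i
    by (auto simp: cell_less_def)
  ultimately show ?thesis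
    using True unfolding compatible_def by (simp only:) blast
qed (simp add: compatible_def)

lemma pipe_dreams_cells:
  assumes "\<And>i. i > int m + 1 \<Longrightarrow> w \<langle>$\<rangle> i = i"
  shows "bij_betw (\<lambda>s. (map snd s, map fst s))
    {s \<in> cell_lists (cells 1 m). hprod (map snd s) = w} {(t, b). t \<in> hecke_words w \<and> compatible t b}"
proof (rule bij_betw_byWitness[where f' = "\<lambda>(t, b). zip b t"])
  show "(\<lambda>s. (map snd s, map fst s)) ` {s \<in> cell_lists (cells 1 m). hprod (map snd s) = w}
      \<subseteq> {(t, b). t \<in> hecke_words w \<and> compatible t b}"
    by (auto simp: hecke_words_eq compatible_iff cell_lists_def set_cells zip_map_fst_snd)
  show "(\<lambda>(t, b). zip b t) ` {(t, b). t \<in> hecke_words w \<and> compatible t b}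
      \<subseteq> {s \<in> cell_lists (cells 1 m). hprod (map snd s) = w}"
  proof (clarsimp, intro conjI)
    fix t b assume h: "t \<in> hecke_words w" and c: "compatible t b"
    have len: "length b = length t" using c by (simp add: compatible_def)
    then show "hprod (map snd (zip b t)) = w" using h by (simp add: hecke_words_eq)
    have "hprod t = w" using h by (simp add: hecke_words_eq)
    then have "\<And>i. i \<in> set t \<Longrightarrow> i < int m + 1"
      using assms hecke_word_letter_le[of "int m + 1" t] by simp
    then show "zip b t \<in> cell_lists (cells 1 m)"
      using c by (fastforce simp: cell_lists_def compatible_iff set_cells dest: set_zip_rightD)
  qed
qed (auto simp: compatible_iff zip_map_fst_snd)

lemma finite_pipe_dreams [simp]: "finite {(t, b). t \<in> hecke_words w \<and> compatible t b}"
proof -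
  obtain N where N: "\<And>i. \<bar>i\<bar> > N \<Longrightarrow> w \<langle>$\<rangle> i = i" using perm_eventually_fixed by blast
  have "w \<langle>$\<rangle> i = i" if "i > int (nat N) + 1" for i by (intro N) (use that in linarith)
  then show ?thesis
    using bij_betw_finite[OF pipe_dreams_cells[of "nat N" w]] by simp
qed

text \<open>Every staircase that is large enough gives the same coefficient; hence several
  permutations can be read off from a common one.\<close>

theorem gsum_eq_fold:
  assumes "\<And>i. i > int m + 1 \<Longrightarrow> w \<langle>$\<rangle> i = i"
  shows "gsum \<beta> x y w = fold (tstep \<beta>) (stair \<beta> x y 1 m) unit_fun w"
proof -
  let ?a = "\<lambda>(b, t). om \<beta> (x b) (y (t - b + 1))"
  have "stair \<beta> x y 1 m = map (\<lambda>c. (snd c, ?a c)) (cells 1 m)"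
    using stair_cells[of \<beta> x 1 y m] by (simp add: case_prod_beta)
  then have "fold (tstep \<beta>) (stair \<beta> x y 1 m) unit_fun w =
      (\<Sum>s\<in>cell_lists (cells 1 m). cell_weight \<beta> ?a w s)"
    using fold_cells[OF sorted_cells, of 1 m \<beta> ?a w] by simp
  also have "\<dots> = (\<Sum>s\<in>{s \<in> cell_lists (cells 1 m). hprod (map snd s) = w}. cell_weight \<beta> ?a w s)"
    by (intro sum.mono_neutral_right) (auto simp: cell_weight_def)
  also have "\<dots> = (\<Sum>s\<in>{s \<in> cell_lists (cells 1 m). hprod (map snd s) = w}.
      (\<lambda>(t, b). (- \<beta>) ^ (length t - perm_length w) *
        (\<Prod>i<length t. om \<beta> (x (b ! i)) (y (t ! i - b ! i + 1)))) (map snd s, map fst s))"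
    by (intro sum.cong)
      (auto simp: cell_weight_def case_prod_beta prod.list_conv_set_nth atLeast0LessThan)
  also have "\<dots> = gsum \<beta> x y w"
    unfolding gsum_def by (rule sum.reindex_bij_betw[OF pipe_dreams_cells[OF assms]])
  finally show ?thesis by simp
qed

section \<open>Substitution in polynomials\<close>

abbreviation lookup :: "('a \<Rightarrow>\<^sub>0 'b::zero) \<Rightarrow> 'a \<Rightarrow> 'b" where "lookup \<equiv> Poly_Mapping.lookup"
abbreviation keys :: "('a \<Rightarrow>\<^sub>0 'b::zero) \<Rightarrow> 'a set" where "keys \<equiv> Poly_Mapping.keys"
abbreviation single :: "'a \<Rightarrow> 'b \<Rightarrow> 'a \<Rightarrow>\<^sub>0 'b::zero" where "single \<equiv> Poly_Mapping.single"

lemma Const_0 [simp]: "Const 0 = 0" and Const_1 [simp]: "Const 1 = 1"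
  by (simp_all add: Const_def)

lemma Const_add: "Const (a + b) = Const a + Const b"
  and Const_uminus: "Const (- a) = - Const a"
  and Const_diff: "Const (a - b) = Const a - Const b"
  and Const_mult: "Const (a * b) = Const a * Const b"
  by (simp_all add: Const_def single_add single_uminus single_diff mult_single)

lemma Const_power: "Const (a ^ n) = Const a ^ n"
  by (induction n) (simp_all add: Const_mult)

lemma lookup_Const_mult [simp]: "lookup (Const c * p) m = c * lookup p m"
  by (simp add: Const_def map.rep_eq when_def flip: mult_map_scale_conv_mult)

lemma lookup_Const: "lookup (Const c) m = (c when m = 0)"
  by (auto simp: Const_def lookup_single when_def)

lemma Var_eq_iff: "Var i = (Var j :: 'k::comm_ring_1 mpoly) \<longleftrightarrow> i = j"
proof
  assume eq: "Var i = (Var j :: 'k mpoly)"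
  have "single i 1 = (single j 1 :: int \<Rightarrow>\<^sub>0 nat)"
  proof (rule ccontr)
    assume "single i 1 \<noteq> (single j 1 :: int \<Rightarrow>\<^sub>0 nat)"
    then have "lookup (Var j :: 'k mpoly) (single i 1) = 0"
      by (simp add: Var_def lookup_single)
    moreover have "lookup (Var i :: 'k mpoly) (single i 1) = 1" by (simp add: Var_def)
    ultimately show False unfolding eq by simp
  qed
  then have "lookup (single i 1) i = (lookup (single j 1) i :: nat)" by simp
  then show "i = j" by (auto simp: lookup_single when_def split: if_splits)
qed simp

lemma one_minus_Var_neq_0: "1 - Const c * Var i \<noteq> (0 :: 'k::comm_ring_1 mpoly)"
proof
  assume "1 - Const c * Var i = (0 :: 'k mpoly)"
  then have "lookup (1 - Const c * Var i :: 'k mpoly) 0 = 0" by simp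
  moreover have "single i (1 :: nat) \<noteq> 0" by (metis lookup_single_eq lookup_zero zero_neq_one)
  ultimately show False by (simp add: lookup_minus Var_def lookup_single)
qed

lemma sum_monomials: "(\<Sum>m\<in>keys p. single m (lookup p m)) = p"
proof (rule poly_mapping_eqI)
  fix k
  have "lookup (\<Sum>m\<in>keys p. single m (lookup p m)) k = (\<Sum>m\<in>keys p. lookup p m when m = k)"
    by (simp add: lookup_sum lookup_single)
  also have "\<dots> = (\<Sum>m\<in>keys p. if m = k then lookup p k else 0)"
    by (intro sum.cong) (auto simp: when_def)
  also have "\<dots> = lookup p k" by (simp add: in_keys_iff)
  finally show "lookup (\<Sum>m\<in>keys p. single m (lookup p m)) k = lookup p k" .
qed

lemma Var_power: "Var i ^ n = single (single i n) 1"
proof (induction n)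
  case (Suc n)
  then show ?case by (simp add: Var_def mult_single flip: single_add)
qed simp

lemma prod_Var_power:
  "finite A \<Longrightarrow> (\<Prod>i\<in>A. Var i ^ f i) = single (\<Sum>i\<in>A. single i (f i)) (1 :: 'k::comm_ring_1)"
  by (induction A rule: finite_induct) (simp_all add: Var_power mult_single)

lemma monomial_eq: "single m c = Const c * (\<Prod>i\<in>keys m. Var i ^ lookup m i)"
  by (simp add: prod_Var_power sum_monomials Const_def mult_single)

text \<open>The intended subring \<open>R\<close> consists of the rational functions with a
  denominator that survives a given substitution; substitution is a homomorphism there, though not
  on the whole field.\<close>

locale partial_hom =
  fixes R :: "'a::comm_ring_1 set" and h :: "'a \<Rightarrow> 'b::comm_ring_1"
  assumes one_mem: "1 \<in> R" and hom_one: "h 1 = 1"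
    and add_mem: "a \<in> R \<Longrightarrow> b \<in> R \<Longrightarrow> a + b \<in> R"
    and hom_add: "a \<in> R \<Longrightarrow> b \<in> R \<Longrightarrow> h (a + b) = h a + h b"
    and mult_mem: "a \<in> R \<Longrightarrow> b \<in> R \<Longrightarrow> a * b \<in> R"
    and hom_mult: "a \<in> R \<Longrightarrow> b \<in> R \<Longrightarrow> h (a * b) = h a * h b"
    and uminus_mem: "a \<in> R \<Longrightarrow> - a \<in> R"
begin

lemma zero_mem: "0 \<in> R"
  using add_mem[OF one_mem uminus_mem[OF one_mem]] by simp

lemma hom_zero: "h 0 = 0"
  using hom_add[OF zero_mem zero_mem] by simp

lemma hom_uminus: "a \<in> R \<Longrightarrow> h (- a) = - h a"
  using hom_add[of a "- a"] uminus_mem[of a] hom_zero by (simp add: eq_neg_iff_add_eq_0 add.commute)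

lemma diff_mem: "a \<in> R \<Longrightarrow> b \<in> R \<Longrightarrow> a - b \<in> R"
  using add_mem[of a "- b"] uminus_mem by simp

lemma hom_diff: "a \<in> R \<Longrightarrow> b \<in> R \<Longrightarrow> h (a - b) = h a - h b"
  using hom_add[of a "- b"] uminus_mem hom_uminus by simp

lemma sum_mem: "(\<And>x. x \<in> A \<Longrightarrow> f x \<in> R) \<Longrightarrow> (\<Sum>x\<in>A. f x) \<in> R"
  by (induction A rule: infinite_finite_induct) (auto simp: zero_mem add_mem)

lemma hom_sum: "(\<And>x. x \<in> A \<Longrightarrow> f x \<in> R) \<Longrightarrow> h (\<Sum>x\<in>A. f x) = (\<Sum>x\<in>A. h (f x))"
  by (induction A rule: infinite_finite_induct) (auto simp: hom_zero hom_add sum_mem)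

lemma prod_mem: "(\<And>x. x \<in> A \<Longrightarrow> f x \<in> R) \<Longrightarrow> (\<Prod>x\<in>A. f x) \<in> R"
  by (induction A rule: infinite_finite_induct) (auto simp: one_mem mult_mem)

lemma hom_prod: "(\<And>x. x \<in> A \<Longrightarrow> f x \<in> R) \<Longrightarrow> h (\<Prod>x\<in>A. f x) = (\<Prod>x\<in>A. h (f x))"
  by (induction A rule: infinite_finite_induct) (auto simp: hom_one hom_mult prod_mem)

lemma power_mem: "a \<in> R \<Longrightarrow> a ^ n \<in> R"
  by (induction n) (auto simp: one_mem mult_mem)

lemma hom_power: "a \<in> R \<Longrightarrow> h (a ^ n) = h a ^ n"
  by (induction n) (auto simp: hom_one hom_mult power_mem)

end

lemma partial_hom_id: "partial_hom UNIV (\<lambda>x. x)"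
  by unfold_locales auto

lemma partial_hom_comp:
  assumes "partial_hom R h" "partial_hom UNIV g"
  shows "partial_hom R (\<lambda>x. g (h x))"
proof -
  interpret h: partial_hom R h by fact
  interpret g: partial_hom UNIV g by fact
  show ?thesis
    by unfold_locales
      (auto simp: h.one_mem h.hom_one g.hom_one h.add_mem h.hom_add g.hom_add h.mult_mem h.hom_mult
        g.hom_mult h.uminus_mem)
qed

lemma partial_hom_Const: "partial_hom UNIV Const"
  by unfold_locales (auto simp: Const_add Const_mult)

definition msubst :: "('a::comm_ring_1 \<Rightarrow> 'b::comm_ring_1) \<Rightarrow> (int \<Rightarrow> 'b) \<Rightarrow> 'a mpoly \<Rightarrow> 'b" where
  "msubst h a p = (\<Sum>m\<in>keys p. h (lookup p m) * (\<Prod>i\<in>keys m. a i ^ lookup m i))"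

lemma poly_subst_eq: "poly_subst h a p = msubst h a p"
  by (simp add: poly_subst_def msubst_def)

definition polys_over :: "'a::zero set \<Rightarrow> 'a mpoly set" where
  "polys_over R = {p. \<forall>m. lookup p m \<in> R}"

lemma polys_over_UNIV [simp]: "polys_over UNIV = UNIV"
  by (simp add: polys_over_def)

lemma monomial_value_superset:
  assumes "finite S" "keys m \<subseteq> S"
  shows "(\<Prod>i\<in>keys m. a i ^ lookup m i) = (\<Prod>i\<in>S. a i ^ lookup m i)"
  by (rule prod.mono_neutral_left) (use assms in \<open>auto simp: in_keys_iff\<close>)

lemma monomial_value_add:
  fixes m n :: "int \<Rightarrow>\<^sub>0 nat" and a :: "int \<Rightarrow> 'a::comm_ring_1"
  shows "(\<Prod>i\<in>keys (m + n). a i ^ lookup (m + n) i) =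
    (\<Prod>i\<in>keys m. a i ^ lookup m i) * (\<Prod>i\<in>keys n. a i ^ lookup n i)"
proof -
  let ?S = "keys m \<union> keys n"
  have "keys (m + n) \<subseteq> ?S" by (rule keys_add)
  then have "(\<Prod>i\<in>keys (m + n). a i ^ lookup (m + n) i) = (\<Prod>i\<in>?S. a i ^ lookup m i * a i ^ lookup n i)"
    using monomial_value_superset[of ?S "m + n" a] by (simp add: lookup_add power_add)
  then show ?thesis
    using monomial_value_superset[of ?S m a] monomial_value_superset[of ?S n a]
    by (simp add: prod.distrib)
qed

lemma mult_monomials:
  "p * q = (\<Sum>m\<in>keys p. \<Sum>n\<in>keys q. single (m + n) (lookup p m * lookup q n))"
  for p q :: "'a::comm_ring_1 mpoly"
proof -
  have "p * q = (\<Sum>m\<in>keys p. single m (lookup p m)) * (\<Sum>n\<in>keys q. single n (lookup q n))"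
    by (simp only: sum_monomials)
  also have "\<dots> = (\<Sum>m\<in>keys p. \<Sum>n\<in>keys q. single (m + n) (lookup p m * lookup q n))"
    by (simp only: sum_product mult_single)
  finally show ?thesis .
qed

context partial_hom
begin

lemma msubst_superset:
  assumes "finite S" "keys p \<subseteq> S"
  shows "msubst h a p = (\<Sum>m\<in>S. h (lookup p m) * (\<Prod>i\<in>keys m. a i ^ lookup m i))"
  unfolding msubst_def
  by (rule sum.mono_neutral_left) (use assms in \<open>auto simp: in_keys_iff hom_zero\<close>)

lemma msubst_single: "msubst h a (single m c) = h c * (\<Prod>i\<in>keys m. a i ^ lookup m i)"
  by (subst msubst_superset[of "{m}"]) auto

lemma msubst_Const [simp]: "msubst h a (Const c) = h c"
  by (simp add: Const_def msubst_single)

lemma msubst_Var [simp]: "msubst h a (Var i) = a i"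
  by (simp add: Var_def msubst_single hom_one)

lemma polys_add: "p \<in> polys_over R \<Longrightarrow> q \<in> polys_over R \<Longrightarrow> p + q \<in> polys_over R"
  by (simp add: polys_over_def lookup_add add_mem)

lemma polys_single: "c \<in> R \<Longrightarrow> single m c \<in> polys_over R"
  by (auto simp: polys_over_def lookup_single when_def zero_mem)

lemma polys_sum: "(\<And>x. x \<in> A \<Longrightarrow> f x \<in> polys_over R) \<Longrightarrow> (\<Sum>x\<in>A. f x) \<in> polys_over R"
  by (auto simp: polys_over_def lookup_sum intro!: sum_mem)

lemma msubst_add:
  assumes "p \<in> polys_over R" "q \<in> polys_over R"
  shows "msubst h a (p + q) = msubst h a p + msubst h a q"
proof -
  let ?S = "keys p \<union> keys q"
  have "keys (p + q) \<subseteq> ?S" by (rule keys_add)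
  then show ?thesis
    using assms
    by (simp add: msubst_superset[of ?S] lookup_add hom_add polys_over_def distrib_right sum.distrib)
qed

lemma msubst_zero [simp]: "msubst h a 0 = 0"
  by (simp add: msubst_def)

lemma msubst_sum:
  "(\<And>x. x \<in> A \<Longrightarrow> f x \<in> polys_over R) \<Longrightarrow> msubst h a (\<Sum>x\<in>A. f x) = (\<Sum>x\<in>A. msubst h a (f x))"
  by (induction A rule: infinite_finite_induct) (auto simp: msubst_add polys_sum)

lemma polys_mult: "p \<in> polys_over R \<Longrightarrow> q \<in> polys_over R \<Longrightarrow> p * q \<in> polys_over R"
  unfolding mult_monomials[of p q]
  by (intro polys_sum polys_single mult_mem) (auto simp: polys_over_def)

lemma msubst_mult:
  assumes "p \<in> polys_over R" "q \<in> polys_over R"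
  shows "msubst h a (p * q) = msubst h a p * msubst h a q"
proof -
  have R: "lookup p m \<in> R" "lookup q m \<in> R" for m using assms by (auto simp: polys_over_def)
  let ?M = "\<lambda>m. \<Prod>i\<in>keys m. a i ^ lookup m i"
  have "msubst h a (p * q) = (\<Sum>m\<in>keys p. \<Sum>n\<in>keys q. msubst h a (single (m + n) (lookup p m * lookup q n)))"
    unfolding mult_monomials[of p q]
    by (simp add: msubst_sum polys_sum polys_single mult_mem R)
  also have "\<dots> = (\<Sum>m\<in>keys p. \<Sum>n\<in>keys q. (h (lookup p m) * ?M m) * (h (lookup q n) * ?M n))"
    by (simp add: msubst_single hom_mult R monomial_value_add mult_ac)
  also have "\<dots> = msubst h a p * msubst h a q"
    by (simp add: msubst_def sum_product)
  finally show ?thesis .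
qed

lemma partial_hom_msubst: "partial_hom (polys_over R) (msubst h a)"
proof
  show "1 \<in> polys_over R" using polys_single[OF one_mem, of 0] by simp
  show "msubst h a 1 = 1" using msubst_Const[of a 1] by (simp add: hom_one)
  fix p q assume pq: "p \<in> polys_over R" "q \<in> polys_over R"
  show "p + q \<in> polys_over R" "p * q \<in> polys_over R" using pq by (auto intro: polys_add polys_mult)
  show "msubst h a (p + q) = msubst h a p + msubst h a q"
    "msubst h a (p * q) = msubst h a p * msubst h a q" using pq by (auto intro: msubst_add msubst_mult)
  show "- p \<in> polys_over R" using pq by (auto simp: polys_over_def uminus_mem)
qed

lemma polys_Const: "c \<in> R \<Longrightarrow> Const c \<in> polys_over R"
  by (simp add: Const_def polys_single)

lemma polys_Var: "Var i \<in> polys_over R"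
  by (simp add: Var_def polys_single one_mem)

lemma polys_induct [consumes 1, case_names Const Var add mult]:
  assumes p: "p \<in> polys_over R"
    and Const: "\<And>c. c \<in> R \<Longrightarrow> P (Const c)" and Var: "\<And>i. P (Var i)"
    and add: "\<And>p q. p \<in> polys_over R \<Longrightarrow> q \<in> polys_over R \<Longrightarrow> P p \<Longrightarrow> P q \<Longrightarrow> P (p + q)"
    and mult: "\<And>p q. p \<in> polys_over R \<Longrightarrow> q \<in> polys_over R \<Longrightarrow> P p \<Longrightarrow> P q \<Longrightarrow> P (p * q)"
  shows "P p"
proof -
  interpret m: partial_hom "polys_over R" "msubst h (\<lambda>_. 0)" by (rule partial_hom_msubst)
  let ?P = "\<lambda>p. p \<in> polys_over R \<and> P p"
  have "?P (\<Prod>i\<in>A. f i)" if "\<And>i. i \<in> A \<Longrightarrow> ?P (f i)" for A and f :: "int \<Rightarrow> 'a mpoly"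
    using that
  proof (induction A rule: infinite_finite_induct)
    case (insert x A)
    then show ?case by (auto intro!: mult polys_mult)
  qed (use Const[OF one_mem] m.one_mem in auto)
  note prod = this
  have pow: "?P (Var i ^ n)" for i n
  proof (induction n)
    case (Suc n)
    then show ?case using polys_Var[of i] Var[of i] by (auto intro!: mult polys_mult)
  qed (use Const[OF one_mem] m.one_mem in auto)
  have single: "?P (single m c)" if "c \<in> R" for m c
    unfolding monomial_eq
    using prod[of "keys m" "\<lambda>i. Var i ^ lookup m i"] pow Const[OF that] polys_Const[OF that]
    by (auto intro!: mult polys_mult)
  have "?P (\<Sum>x\<in>A. f x)" if "\<And>x. x \<in> A \<Longrightarrow> ?P (f x)" for A and f :: "(int \<Rightarrow>\<^sub>0 nat) \<Rightarrow> 'a mpoly"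
    using that
  proof (induction A rule: infinite_finite_induct)
    case (insert x A)
    then show ?case by (auto intro!: add polys_add)
  qed (use Const[OF zero_mem] m.zero_mem in auto)
  note sum = this
  have "lookup p m \<in> R" for m using p by (simp add: polys_over_def)
  then have "?P (\<Sum>m\<in>keys p. single m (lookup p m))"
    by (intro sum single)
  then show ?thesis unfolding sum_monomials by blast
qed

lemma msubst_mem: "p \<in> polys_over R \<Longrightarrow> (\<And>i. a i \<in> R) \<Longrightarrow> msubst (\<lambda>x. x) a p \<in> R"
proof (induction rule: polys_induct)
  case (add p q)
  then show ?case using partial_hom.msubst_add[OF partial_hom_id, of p q a] by (simp add: add_mem)
next
  case (mult p q)
  then show ?case using partial_hom.msubst_mult[OF partial_hom_id, of p q a] by (simp add: mult_mem)
qed (simp_all add: partial_hom.msubst_Const[OF partial_hom_id] partial_hom.msubst_Var[OF partial_hom_id])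

end

section \<open>The polynomials in a uniform parameter\<close>

text \<open>\<open>\<beta> = 0\<close> gives the Schubert and \<open>\<beta> = 1\<close> the Grothendieck polynomials.\<close>

definition Gp :: "'k::field \<Rightarrow> (int \<Rightarrow> 'k) \<Rightarrow> int perm \<Rightarrow> 'k mpoly" where
  "Gp \<beta> y w = (\<Sum>(t, b) | t \<in> hecke_words w \<and> compatible t b.
     (- Const \<beta>) ^ (length t - perm_length w) *
     (\<Prod>i<length t. (Var (b ! i) - Const (y (t ! i - b ! i + 1))) *
        Const (inverse (1 - \<beta> * y (t ! i - b ! i + 1)))))"

lemma double_grothendieck_eq: "double_grothendieck y = Gp 1 y"
  by (rule ext) (simp add: double_grothendieck_def Gp_def kminus_def)

text \<open>At \<open>\<beta> = 0\<close> the power of \<open>- \<beta>\<close> is 1 for words of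
  minimal length and 0 for all longer Hecke words.\<close>

lemma double_schubert_eq: "double_schubert y = Gp 0 y"
proof (rule ext)
  fix w
  let ?f = "\<lambda>(t, b). (- Const 0) ^ (length t - perm_length w) *
     (\<Prod>i<length t. (Var (b ! i) - Const (y (t ! i - b ! i + 1))) *
        Const (inverse (1 - 0 * y (t ! i - b ! i + 1))))"
  have "Gp 0 y w = (\<Sum>(t, b) | t \<in> reduced_words w \<and> compatible t b. ?f (t, b))"
    unfolding Gp_def
  proof (rule sum.mono_neutral_cong_right)
    have len: "perm_length w \<le> length t" if "t \<in> hecke_words w" for t
      using that perm_length_hprod_le[of t] by (auto simp: hecke_words_eq)
    show "\<forall>i\<in>{(t, b). t \<in> hecke_words w \<and> compatible t b} -
        {(t, b). t \<in> reduced_words w \<and> compatible t b}. ?f i = 0"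
      using len by (fastforce simp: hecke_words_eq reduced_words_eq)
  qed (use finite_pipe_dreams[of w] in \<open>auto simp: hecke_words_eq reduced_words_eq\<close>)
  also have "\<dots> = double_schubert y w"
    unfolding double_schubert_def by (intro sum.cong) (auto simp: reduced_words_eq)
  finally show "double_schubert y w = Gp 0 y w" by simp
qed

definition admissible :: "'k::field \<Rightarrow> (int \<Rightarrow> 'k) \<Rightarrow> bool" where
  "admissible \<beta> y \<longleftrightarrow> (\<forall>i. 1 - \<beta> * y i \<noteq> 0)"

lemma polys_Gp:
  fixes \<beta> :: "'k::field" and h :: "'k \<Rightarrow> 'c::comm_ring_1"
  assumes "partial_hom R h" "\<beta> \<in> R" "\<And>i. y i \<in> R" "\<And>i. inverse (1 - \<beta> * y i) \<in> R"
  shows "Gp \<beta> y w \<in> polys_over R"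
proof -
  interpret h: partial_hom R h by fact
  interpret m: partial_hom "polys_over R" "msubst h (\<lambda>_. 0)" by (rule h.partial_hom_msubst)
  show ?thesis
    unfolding Gp_def case_prod_beta
    by (intro m.sum_mem m.mult_mem m.power_mem m.prod_mem m.uminus_mem m.diff_mem h.polys_Const
        h.polys_Var assms)
qed

lemma hom_inverse:
  fixes u :: "'k::field" and h :: "'k \<Rightarrow> 'c::comm_ring_1"
  assumes "partial_hom R h" "u \<in> R" "inverse u \<in> R" "u \<noteq> 0"
  shows "h u * h (inverse u) = 1"
proof -
  interpret partial_hom R h by fact
  show ?thesis using hom_mult[of u "inverse u"] assms by (simp add: hom_one)
qed

lemma hom_inverse_field:
  fixes u :: "'k::field" and h :: "'k \<Rightarrow> 'c::field"
  assumes "partial_hom R h" "u \<in> R" "inverse u \<in> R" "u \<noteq> 0"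
  shows "h (inverse u) = inverse (h u)" "h u \<noteq> 0"
proof -
  show "h u \<noteq> 0" using hom_inverse[OF assms] by auto
  then show "h (inverse u) = inverse (h u)" using hom_inverse[OF assms] by (simp add: field_simps)
qed

lemma admissible_hom:
  fixes h :: "'k::field \<Rightarrow> 'c::field"
  assumes "partial_hom R h" "\<beta> \<in> R" "\<And>i. y i \<in> R" "\<And>i. inverse (1 - \<beta> * y i) \<in> R" "admissible \<beta> y"
  shows "admissible (h \<beta>) (\<lambda>i. h (y i))"
  unfolding admissible_def
proof
  fix i
  interpret partial_hom R h by fact
  have u: "1 - \<beta> * y i \<in> R" using assms by (intro diff_mem one_mem mult_mem)
  then have "h (1 - \<beta> * y i) \<noteq> 0" using assms hom_inverse_field[of R h "1 - \<beta> * y i"] by (simp add: admissible_def)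
  then show "1 - h \<beta> * h (y i) \<noteq> 0" using assms by (simp add: hom_diff hom_mult one_mem mult_mem hom_one)
qed

lemma msubst_Gp:
  fixes h :: "'k::field \<Rightarrow> 'c::field"
  assumes h: "partial_hom R h" and R: "\<beta> \<in> R" "\<And>i. y i \<in> R" "\<And>i. inverse (1 - \<beta> * y i) \<in> R"
    and adm: "admissible \<beta> y"
  shows "msubst h a (Gp \<beta> y w) = gsum (h \<beta>) a (\<lambda>i. h (y i)) w"
proof -
  interpret h: partial_hom R h by fact
  interpret m: partial_hom "polys_over R" "msubst h a" by (rule h.partial_hom_msubst)
  note mems = m.mult_mem m.power_mem m.prod_mem m.uminus_mem m.diff_mem h.polys_Const h.polys_Var R
  have u: "1 - \<beta> * y i \<in> R" for i using R by (intro h.diff_mem h.one_mem h.mult_mem)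
  have inv: "h (inverse (1 - \<beta> * y i)) = inverse (1 - h \<beta> * h (y i))" for i
    using hom_inverse_field(1)[OF h u R(3), of i] adm R
    by (simp add: admissible_def h.hom_diff h.hom_mult h.one_mem h.mult_mem h.hom_one)
  have lin: "msubst h a ((Var j - Const (y i)) * Const (inverse (1 - \<beta> * y i))) = om (h \<beta>) (a j) (h (y i))" for i j
  proof -
    have "msubst h a ((Var j - Const (y i)) * Const (inverse (1 - \<beta> * y i))) =
        (a j - h (y i)) * h (inverse (1 - \<beta> * y i))"
      by (simp add: m.hom_mult m.hom_diff mems)
    then show ?thesis by (simp only: inv om_def divide_inverse)
  qed
  show ?thesis
    unfolding Gp_def gsum_def
    by (subst m.hom_sum; (intro sum.cong refl)?)
      (auto simp: m.hom_mult m.hom_power m.hom_uminus m.hom_prod lin mems)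
qed

lemma msubst_Gp_poly:
  fixes h :: "'k::field \<Rightarrow> 'c::field"
  assumes h: "partial_hom R h" and R: "\<beta> \<in> R" "\<And>i. y i \<in> R" "\<And>i. inverse (1 - \<beta> * y i) \<in> R"
    and adm: "admissible \<beta> y"
  shows "msubst (\<lambda>c. Const (h c)) Var (Gp \<beta> y w) = Gp (h \<beta>) (\<lambda>i. h (y i)) w"
proof -
  interpret h: partial_hom R h by fact
  interpret c: partial_hom R "\<lambda>c. Const (h c)" by (rule partial_hom_comp[OF h partial_hom_Const])
  interpret m: partial_hom "polys_over R" "msubst (\<lambda>c. Const (h c)) Var" by (rule c.partial_hom_msubst)
  note mems = m.mult_mem m.power_mem m.prod_mem m.uminus_mem m.diff_mem h.polys_Const h.polys_Var R
  have u: "1 - \<beta> * y i \<in> R" for i using R by (intro h.diff_mem h.one_mem h.mult_mem)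
  have inv: "h (inverse (1 - \<beta> * y i)) = inverse (1 - h \<beta> * h (y i))" for i
    using hom_inverse_field(1)[OF h u R(3), of i] adm R
    by (simp add: admissible_def h.hom_diff h.hom_mult h.one_mem h.mult_mem h.hom_one)
  have lin: "msubst (\<lambda>c. Const (h c)) Var ((Var j - Const (y i)) * Const (inverse (1 - \<beta> * y i))) =
      (Var j - Const (h (y i))) * Const (inverse (1 - h \<beta> * h (y i)))" for i j
  proof -
    have "msubst (\<lambda>c. Const (h c)) Var ((Var j - Const (y i)) * Const (inverse (1 - \<beta> * y i))) =
        (Var j - Const (h (y i))) * Const (h (inverse (1 - \<beta> * y i)))"
      by (simp add: m.hom_mult m.hom_diff mems)
    then show ?thesis by (simp only: inv)
  qed
  show ?thesis
    unfolding Gp_def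
    by (subst m.hom_sum; (intro sum.cong refl)?)
      (auto simp: m.hom_mult m.hom_power m.hom_uminus m.hom_prod lin mems)
qed

lemma gsum_diagonal: "admissible \<beta> y \<Longrightarrow> gsum \<beta> y y w = unit_fun w"
proof -
  assume adm: "admissible \<beta> y"
  obtain N where N: "\<And>i. \<bar>i\<bar> > N \<Longrightarrow> w \<langle>$\<rangle> i = i" using perm_eventually_fixed by blast
  have w: "w \<langle>$\<rangle> i = i" if "i > int (nat N) + 1" for i by (intro N) (use that in linarith)
  have "gsum \<beta> y y w = fold (tstep \<beta>) (stair \<beta> y y 1 (nat N)) unit_fun w"
    by (rule gsum_eq_fold) (rule w)
  then show ?thesis using adm fold_stair_diagonal[of \<beta> y 1 "nat N" unit_fun] by (simp add: admissible_def)
qed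

lemma gsum_swap:
  assumes y: "admissible \<beta> y" and x: "admissible \<beta> x" and b: "b \<ge> 1"
  shows "gsum \<beta> x y w =
    tstep \<beta> (b, om \<beta> (x b) (x (b + 1))) (gsum \<beta> (\<lambda>i. x (adj b \<langle>$\<rangle> i)) y) w"
proof -
  obtain N where N: "\<And>i. \<bar>i\<bar> > N \<Longrightarrow> w \<langle>$\<rangle> i = i" using perm_eventually_fixed by blast
  \<comment> \<open>Large enough for \<open>w\<close>, for \<open>w * adj b\<close> and for the rows
    \<open>b\<close> and \<open>b + 1\<close>, so that one staircase yields all coefficients
    involved.\<close>
  define m where "m = nat (\<bar>N\<bar> + \<bar>b\<bar> + 1)"
  have m: "int m = \<bar>N\<bar> + \<bar>b\<bar> + 1" by (simp add: m_def)
  have w: "w \<langle>$\<rangle> i = i" if "i > int m + 1" for i by (intro N) (use that m in linarith)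
  have wb: "(w * adj b) \<langle>$\<rangle> i = i" if "i > int m + 1" for i
  proof -
    have "i \<noteq> b" "i \<noteq> b + 1" using that m by linarith+
    then show ?thesis using w[OF that] by (simp add: apply_times adj_apply)
  qed
  define r where "r = nat (b - 1)"
  have br: "b = int r + 1" using b by (simp add: r_def)
  have "fold (tstep \<beta>) (stair \<beta> x y 1 m) unit_fun =
      tstep \<beta> (1 + int r, om \<beta> (x (int r + 1)) (x (int r + 2)))
        (fold (tstep \<beta>) (stair \<beta> (\<lambda>i. x (adj (int r + 1) \<langle>$\<rangle> i)) y 1 m) unit_fun)"
    by (rule fold_stair_swap) (use x y m br in \<open>auto simp: admissible_def\<close>)
  then have "fold (tstep \<beta>) (stair \<beta> x y 1 m) unit_fun w = tstep \<beta> (b, om \<beta> (x b) (x (b + 1)))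
      (fold (tstep \<beta>) (stair \<beta> (\<lambda>i. x (adj b \<langle>$\<rangle> i)) y 1 m) unit_fun) w"
    by (simp add: br add_ac)
  moreover have "gsum \<beta> z y w = fold (tstep \<beta>) (stair \<beta> z y 1 m) unit_fun w"
    "gsum \<beta> z y (w * adj b) = fold (tstep \<beta>) (stair \<beta> z y 1 m) unit_fun (w * adj b)" for z
    using w wb by (intro gsum_eq_fold; blast)+
  ultimately show ?thesis by (simp add: tstep_def)
qed

section \<open>Divided differences\<close>

lemma msubst_comp:
  assumes "partial_hom UNIV g"
  shows "g (msubst h a p) = msubst (\<lambda>c. g (h c)) (\<lambda>i. g (a i)) p"
proof -
  interpret partial_hom UNIV g by fact
  show ?thesis by (simp add: msubst_def hom_sum hom_mult hom_prod hom_power)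
qed

lemma msubst_Const_Var [simp]: "msubst Const Var p = p"
  by (simp add: msubst_def sum_monomials flip: monomial_eq)

definition to_frac :: "'k::field mpoly \<Rightarrow> 'k mpoly fract" where
  "to_frac p = Fract p 1"

lemma partial_hom_to_frac: "partial_hom UNIV to_frac"
  by unfold_locales (simp_all add: to_frac_def One_fract_def)

lemma to_frac_eq_iff [simp]: "to_frac p = to_frac q \<longleftrightarrow> p = q"
  by (simp add: to_frac_def eq_fract)

definition swapx :: "int \<Rightarrow> 'k::comm_ring_1 mpoly \<Rightarrow> 'k mpoly" where
  "swapx b = msubst Const (\<lambda>i. Var (adj b \<langle>$\<rangle> i))"

lemma partial_hom_swapx: "partial_hom UNIV (swapx b)"
  using partial_hom.partial_hom_msubst[OF partial_hom_Const] by (simp add: swapx_def)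

lemma swapx_Const [simp]: "swapx b (Const c) = Const c"
  and swapx_Var: "swapx b (Var i) = Var (adj b \<langle>$\<rangle> i)"
  by (simp_all add: swapx_def partial_hom.msubst_Const[OF partial_hom_Const]
      partial_hom.msubst_Var[OF partial_hom_Const])

lemma swapx_add: "swapx b (p + q) = swapx b p + swapx b q"
  and swapx_mult: "swapx b (p * q) = swapx b p * swapx b q"
  and swapx_sum: "swapx b (\<Sum>x\<in>A. f x) = (\<Sum>x\<in>A. swapx b (f x))"
  using partial_hom.hom_add[OF partial_hom_swapx] partial_hom.hom_mult[OF partial_hom_swapx]
    partial_hom.hom_sum[OF partial_hom_swapx] by auto

lemma om_step:
  fixes x x' :: "'k::field"
  assumes "1 - \<beta> * x' \<noteq> 0"
  shows "(1 - \<beta> * x') * ((1 - \<beta> * om \<beta> x x') * A + om \<beta> x x' * B) = (1 - \<beta> * x) * A + (x - x') * B"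
proof -
  have e: "(1 - \<beta> * x') * om \<beta> x x' = x - x'" using assms by (simp add: om_def)
  have "(1 - \<beta> * x') * ((1 - \<beta> * om \<beta> x x') * A + om \<beta> x x' * B) =
      (1 - \<beta> * x' - \<beta> * ((1 - \<beta> * x') * om \<beta> x x')) * A + ((1 - \<beta> * x') * om \<beta> x x') * B"
    by (simp add: algebra_simps)
  also have "\<dots> = (1 - \<beta> * x) * A + (x - x') * B"
    unfolding e by (simp add: algebra_simps)
  finally show ?thesis .
qed

text \<open>This is \<open>gsum_swap\<close> at the variables themselves. The field of fractions
  provides the required inverses, and the denominator is cleared before returning to
  polynomials.\<close>

lemma Gp_swap:
  assumes "admissible \<beta> y" "b \<ge> 1"
  shows "desc w b \<Longrightarrow> (1 - Const \<beta> * Var (b + 1)) * Gp \<beta> y w =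
      (1 - Const \<beta> * Var b) * swapx b (Gp \<beta> y w) + (Var b - Var (b + 1)) * swapx b (Gp \<beta> y (w * adj b))"
    and "\<not> desc w b \<Longrightarrow> swapx b (Gp \<beta> y w) = Gp \<beta> y w"
proof -
  interpret t: partial_hom UNIV to_frac by (rule partial_hom_to_frac)
  let ?h = "\<lambda>c. to_frac (Const c)" and ?X = "\<lambda>i. to_frac (Var i)"
  have h: "partial_hom UNIV ?h" by (rule partial_hom_comp[OF partial_hom_Const partial_hom_to_frac])
  have eval: "msubst ?h a (Gp \<beta> y v) = gsum (?h \<beta>) a (\<lambda>i. ?h (y i)) v" for a v
    by (rule msubst_Gp[OF h]) (use assms in auto)
  have G: "to_frac (Gp \<beta> y v) = gsum (?h \<beta>) ?X (\<lambda>i. ?h (y i)) v" for v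
    using msubst_comp[OF partial_hom_to_frac, of Const Var "Gp \<beta> y v"] by (simp add: eval)
  have sG: "to_frac (swapx b (Gp \<beta> y v)) = gsum (?h \<beta>) (\<lambda>i. ?X (adj b \<langle>$\<rangle> i)) (\<lambda>i. ?h (y i)) v" for v
    unfolding swapx_def msubst_comp[OF partial_hom_to_frac] by (rule eval)
  have ay: "admissible (?h \<beta>) (\<lambda>i. ?h (y i))"
    by (rule admissible_hom[OF h]) (use assms in auto)
  have lin: "1 - ?h \<beta> * ?X i = to_frac (1 - Const \<beta> * Var i)" for i
    by (simp add: t.hom_diff t.hom_mult t.hom_one)
  have ne: "1 - ?h \<beta> * ?X i \<noteq> 0" for i
    unfolding lin using one_minus_Var_neq_0[of \<beta> i] t.hom_zero by (metis to_frac_eq_iff)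
  then have ax: "admissible (?h \<beta>) ?X" by (simp only: admissible_def) blast
  note sw = gsum_swap[OF ay ax assms(2), of w]
  show "swapx b (Gp \<beta> y w) = Gp \<beta> y w" if "\<not> desc w b"
    using sw that unfolding tstep_def G[symmetric] sG[symmetric] by simp
  show "(1 - Const \<beta> * Var (b + 1)) * Gp \<beta> y w =
      (1 - Const \<beta> * Var b) * swapx b (Gp \<beta> y w) + (Var b - Var (b + 1)) * swapx b (Gp \<beta> y (w * adj b))"
    if "desc w b"
  proof -
    have "(1 - ?h \<beta> * ?X (b + 1)) * to_frac (Gp \<beta> y w) = (1 - ?h \<beta> * ?X b) * to_frac (swapx b (Gp \<beta> y w)) +
        (?X b - ?X (b + 1)) * to_frac (swapx b (Gp \<beta> y (w * adj b)))"
      using sw that om_step[OF ne, of "b + 1" "?X b"]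
      unfolding tstep_def G[symmetric] sG[symmetric] by simp
    then have "to_frac ((1 - Const \<beta> * Var (b + 1)) * Gp \<beta> y w) = to_frac ((1 - Const \<beta> * Var b) *
        swapx b (Gp \<beta> y w) + (Var b - Var (b + 1)) * swapx b (Gp \<beta> y (w * adj b)))"
      unfolding lin by (simp only: t.hom_mult t.hom_add t.hom_diff UNIV_I)
    then show ?thesis by simp
  qed
qed

text \<open>If \<open>w\<close> has a descent at \<open>b\<close>, then \<open>w * adj b\<close> has
  none and its polynomial is symmetric in the two variables, which turns the exchange rule into a
  divided difference. The factor 1 - \<beta> x_b keeps everything polynomial.\<close>

lemma Gp_divided_difference:
  assumes "admissible \<beta> y" "b \<ge> 1"
  shows "(1 - Const \<beta> * Var b) * (Gp \<beta> y w - swapx b (Gp \<beta> y w)) =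
    (Var b - Var (b + 1)) * (if desc w b then Gp \<beta> y (w * adj b) - Const \<beta> * Gp \<beta> y w else 0)"
proof (cases "desc w b")
  case True
  have "swapx b (Gp \<beta> y (w * adj b)) = Gp \<beta> y (w * adj b)"
    by (rule Gp_swap(2)[OF assms]) (use True in simp)
  with Gp_swap(1)[OF assms True] True show ?thesis by (simp add: algebra_simps)
qed (simp add: Gp_swap(2)[OF assms])

lemma swapx_mem:
  assumes "partial_hom R (\<lambda>x. x)" "p \<in> polys_over R"
  shows "swapx b p \<in> polys_over R"
proof -
  interpret partial_hom R "\<lambda>x. x" by fact
  show ?thesis
    using assms(2)
    by (induction rule: polys_induct)
      (simp_all add: swapx_add swapx_mult swapx_Var polys_Const polys_Var polys_add polys_mult)
qed

text \<open>Twisted Leibniz rule: p q - s(p q) = p (q - s q) + (p - s p) (s q), where s exchanges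
  the two variables. No coefficient is ever divided, so the quotient stays over the subring
  \<open>R\<close>.\<close>

lemma difference_quotient:
  assumes "partial_hom R (\<lambda>x. x)" "f \<in> polys_over R"
  shows "\<exists>g\<in>polys_over R. (Var b - Var (b + 1)) * g = f - swapx b f"
proof -
  interpret partial_hom R "\<lambda>x. x" by fact
  interpret m: partial_hom "polys_over R" "msubst (\<lambda>x. x) (\<lambda>_. 0)" by (rule partial_hom_msubst)
  show ?thesis
    using assms(2)
  proof (induction rule: polys_induct)
    case (Const c)
    then show ?case by (intro bexI[of _ 0]) (simp_all add: m.zero_mem)
  next
    case (Var i)
    consider "i = b" | "i = b + 1" | "i \<noteq> b" "i \<noteq> b + 1" by blast
    then show ?case
    proof cases
      case 1
      then show ?thesis by (intro bexI[of _ 1]) (simp_all add: m.one_mem swapx_Var adj_apply)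
    next
      case 2
      then show ?thesis
        by (intro bexI[of _ "- 1"]) (simp_all add: m.one_mem m.uminus_mem swapx_Var adj_apply)
    next
      case 3
      then show ?thesis by (intro bexI[of _ 0]) (simp_all add: m.zero_mem swapx_Var adj_apply)
    qed
  next
    case (add p q)
    then obtain g h where "g \<in> polys_over R" "h \<in> polys_over R"
      "(Var b - Var (b + 1)) * g = p - swapx b p" "(Var b - Var (b + 1)) * h = q - swapx b q" by blast
    then show ?case
      by (intro bexI[of _ "g + h"]) (simp_all add: polys_add swapx_add distrib_left)
  next
    case (mult p q)
    then obtain g h where gh: "g \<in> polys_over R" "h \<in> polys_over R"
      "(Var b - Var (b + 1)) * g = p - swapx b p" "(Var b - Var (b + 1)) * h = q - swapx b q" by blast
    have "(Var b - Var (b + 1)) * (p * h + g * swapx b q) =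
        p * ((Var b - Var (b + 1)) * h) + ((Var b - Var (b + 1)) * g) * swapx b q"
      by (simp add: algebra_simps)
    also have "\<dots> = p * q - swapx b (p * q)"
      unfolding gh(3,4) by (simp add: swapx_mult algebra_simps)
    finally show ?case
      using gh mult by (intro bexI[of _ "p * h + g * swapx b q"])
        (simp_all add: polys_add polys_mult swapx_mem[OF assms(1)])
  qed
qed

section \<open>Uniqueness and regularity of expansions\<close>

lemma S_pos_mult_adj: "w \<in> S_pos \<Longrightarrow> b \<ge> 1 \<Longrightarrow> w * adj b \<in> S_pos"
  by (auto simp: S_pos_def apply_times adj_apply)

lemma desc_S_pos:
  assumes "w \<in> S_pos" "desc w b" shows "b \<ge> 1"
proof (rule ccontr)
  assume "\<not> b \<ge> 1"
  then have b: "w \<langle>$\<rangle> b = b" using assms by (simp add: S_pos_def)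
  show False
  proof (cases "b + 1 \<le> 0")
    case True
    then show ?thesis using assms b by (simp add: S_pos_def desc_def)
  next
    case False
    then have "b = 0" using \<open>\<not> b \<ge> 1\<close> by simp
    then have "w \<langle>$\<rangle> 1 < 0" "w \<langle>$\<rangle> (w \<langle>$\<rangle> 1) = w \<langle>$\<rangle> 1"
      using assms b by (auto simp: desc_def S_pos_def)
    then show ?thesis by (simp add: perm_apply_eq_iff)
  qed
qed

text \<open>Divided differences along the descents of \<open>w\<close> carry its coefficient to the
  index 1, where evaluation at x = y isolates it. With \<open>P = Q = {0}\<close> this gives
  independence; with the polynomials over a subring it gives regularity of the coefficients.\<close>

lemma coefficient_extraction:
  fixes \<beta> :: "'k::field"
  assumes adm: "admissible \<beta> y"
    and P: "\<And>f b. f \<in> P \<Longrightarrow> b \<ge> 1 \<Longrightarrow>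
      \<exists>g\<in>P. (Var b - Var (b + 1)) * g = (1 - Const \<beta> * Var b) * (f - swapx b f)"
    and Q: "\<And>f. f \<in> P \<Longrightarrow> msubst (\<lambda>x. x) y f \<in> Q"
    and W: "finite W" "W \<subseteq> S_pos" "(\<Sum>v\<in>W. Const (c v) * Gp \<beta> y v) \<in> P" "w \<in> W"
  shows "c w \<in> Q"
  using W
proof (induction "perm_length w" arbitrary: w W c)
  case 0
  then have "w = 1" by simp
  interpret m: partial_hom UNIV "msubst (\<lambda>x. x) y"
    using partial_hom.partial_hom_msubst[OF partial_hom_id] by simp
  have "msubst (\<lambda>x. x) y (\<Sum>v\<in>W. Const (c v) * Gp \<beta> y v) = (\<Sum>v\<in>W. c v * unit_fun v)"
    using adm
    by (simp add: m.hom_sum m.hom_mult msubst_Gp[OF partial_hom_id] gsum_diagonal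
        partial_hom.msubst_Const[OF partial_hom_id])
  also have "\<dots> = (\<Sum>v\<in>W. if v = 1 then c 1 else 0)"
    by (intro sum.cong) (auto simp: unit_fun_def)
  also have "\<dots> = c w" using 0 \<open>w = 1\<close> by simp
  finally show ?case using Q[OF 0(4)] by simp
next
  case (Suc n)
  then have "w \<noteq> 1" by auto
  then obtain b where b: "desc w b" using exists_desc by blast
  have b1: "b \<ge> 1" using desc_S_pos Suc.prems b by blast
  let ?f = "\<Sum>v\<in>W. Const (c v) * Gp \<beta> y v"
  obtain g where g: "g \<in> P" "(Var b - Var (b + 1)) * g = (1 - Const \<beta> * Var b) * (?f - swapx b ?f)"
    using P[OF Suc.prems(3) b1] by blast
  let ?s = "\<lambda>v. v * adj b"
  define W' where "W' = W \<union> ?s ` W"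
  define c0 where "c0 v = (if v \<in> W then c v else 0)" for v
  define c' where "c' v = (if desc v b then - \<beta> * c0 v else c0 (?s v))" for v
  let ?E = "\<lambda>v. if desc v b then Gp \<beta> y (?s v) - Const \<beta> * Gp \<beta> y v else 0"
  have fin: "finite W'" and pos: "W' \<subseteq> S_pos" using Suc.prems b1 by (auto simp: W'_def S_pos_mult_adj)
  have closed: "?s v \<in> W'" if "v \<in> W'" for v using that by (auto simp: W'_def)
  have nz: "Var b - Var (b + 1) \<noteq> (0 :: 'k mpoly)" by (simp add: Var_eq_iff)
  have "(Var b - Var (b + 1)) * g = (\<Sum>v\<in>W. Const (c v) *
      ((1 - Const \<beta> * Var b) * (Gp \<beta> y v - swapx b (Gp \<beta> y v))))"
    unfolding g(2) by (simp add: swapx_sum swapx_mult sum_distrib_left algebra_simps flip: sum_subtractf)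
  also have "\<dots> = (Var b - Var (b + 1)) * (\<Sum>v\<in>W. Const (c v) * ?E v)"
    unfolding Gp_divided_difference[OF adm b1] by (simp add: sum_distrib_left mult_ac)
  finally have "g = (\<Sum>v\<in>W. Const (c v) * ?E v)" using nz by simp
  also have "\<dots> = (\<Sum>v\<in>W'. Const (c0 v) * ?E v)"
    using fin by (intro sum.mono_neutral_cong_left) (auto simp: c0_def W'_def)
  also have "\<dots> = (\<Sum>v\<in>W'. (if desc v b then Const (c0 v) * Gp \<beta> y (?s v) else 0) +
      (if desc v b then Const (- \<beta> * c0 v) * Gp \<beta> y v else 0))"
    by (intro sum.cong) (auto simp: Const_mult Const_uminus algebra_simps)
  also have "\<dots> = (\<Sum>v\<in>W'. (if desc v b then Const (c0 v) * Gp \<beta> y (?s v) else 0)) +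
      (\<Sum>v\<in>W'. (if desc v b then Const (- \<beta> * c0 v) * Gp \<beta> y v else 0))"
    by (rule sum.distrib)
  also have "(\<Sum>v\<in>W'. (if desc v b then Const (c0 v) * Gp \<beta> y (?s v) else 0)) =
      (\<Sum>v\<in>W'. (if desc v b then 0 else Const (c0 (?s v)) * Gp \<beta> y v))"
    by (rule sum.reindex_bij_witness[where i = ?s and j = ?s]) (auto simp: closed)
  finally have "g = (\<Sum>v\<in>W'. Const (c' v) * Gp \<beta> y v)"
    by (simp add: c'_def flip: sum.distrib) (auto intro!: sum.cong)
  then have "(\<Sum>v\<in>W'. Const (c' v) * Gp \<beta> y v) \<in> P" using g by simp
  moreover have "n = perm_length (?s w)" using Suc(2) perm_length_desc[OF b] by simp
  moreover have "?s w \<in> W'" using Suc.prems by (simp add: W'_def)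
  ultimately have "c' (?s w) \<in> Q" using Suc.hyps(1) fin pos by blast
  \<comment> \<open>The shorter \<open>w * adj b\<close> has no descent at \<open>b\<close>, so it
    receives the coefficient of \<open>w\<close> unchanged.\<close>
  moreover have "c' (?s w) = c w" using b Suc.prems by (simp add: c'_def c0_def)
  ultimately show ?case by simp
qed

lemma Gp_independent:
  assumes adm: "admissible \<beta> y" and W: "finite W" "W \<subseteq> S_pos"
    and zero: "(\<Sum>v\<in>W. Const (c v) * Gp \<beta> y v) = 0" and w: "w \<in> W"
  shows "c w = 0"
proof -
  interpret m: partial_hom UNIV "msubst (\<lambda>x. x) y"
    using partial_hom.partial_hom_msubst[OF partial_hom_id] by simp
  have "c w \<in> {0}"
    by (rule coefficient_extraction[OF adm, of "{0}"])
      (use W zero w m.hom_zero partial_hom.hom_zero[OF partial_hom_swapx] in auto)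
  then show ?thesis by simp
qed

definition expands :: "'k::field \<Rightarrow> (int \<Rightarrow> 'k) \<Rightarrow> 'k mpoly \<Rightarrow> (int perm \<Rightarrow>\<^sub>0 'k) \<Rightarrow> bool" where
  "expands \<beta> y f c \<longleftrightarrow> keys c \<subseteq> S_pos \<and> f = (\<Sum>w\<in>keys c. Const (lookup c w) * Gp \<beta> y w)"

lemma sum_lookup_superset:
  assumes "finite W" "keys c \<subseteq> W"
  shows "(\<Sum>w\<in>keys c. Const (lookup c w) * F w) = (\<Sum>w\<in>W. Const (lookup c w) * F w)"
  by (rule sum.mono_neutral_left) (use assms in \<open>auto simp: in_keys_iff\<close>)

lemma expands_unique:
  assumes adm: "admissible \<beta> y" and c: "expands \<beta> y f c" and d: "expands \<beta> y f d"
  shows "c = d"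
proof (rule poly_mapping_eqI)
  fix w
  let ?W = "keys c \<union> keys d"
  have "(\<Sum>w\<in>?W. Const (lookup c w - lookup d w) * Gp \<beta> y w) = f - f"
    using c d unfolding expands_def
    by (simp add: sum_lookup_superset[of ?W c] sum_lookup_superset[of ?W d] Const_diff
        left_diff_distrib sum_subtractf)
  then have z: "(\<Sum>w\<in>?W. Const (lookup c w - lookup d w) * Gp \<beta> y w) = 0" by simp
  have "lookup c w - lookup d w = 0" if "w \<in> ?W"
    by (rule Gp_independent[OF adm _ _ z that]) (use c d in \<open>auto simp: expands_def\<close>)
  then show "lookup c w = lookup d w" by (cases "w \<in> ?W") (auto simp: in_keys_iff)
qed

lemma structure_const_eq:
  assumes "admissible \<beta> y" "expands \<beta> y (Gp \<beta> y u * Gp \<beta> y v) c"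
  shows "structure_const (Gp \<beta> y) u v w = lookup c w"
proof -
  have "(THE c. expands \<beta> y (Gp \<beta> y u * Gp \<beta> y v) c) = c"
    using assms expands_unique by (intro the_equality) blast+
  then show ?thesis by (simp add: structure_const_def expands_def)
qed

text \<open>Since the coefficients lie in \<open>R\<close> by \<open>coefficient_extraction\<close>,
  \<open>h\<close> can be applied to the whole expansion. The image expands the product of the
  images, and expansions are unique.\<close>

lemma structure_const_hom:
  fixes h :: "'k::field \<Rightarrow> 'c::field"
  assumes h: "partial_hom R h" and R: "\<beta> \<in> R" "\<And>i. y i \<in> R" "\<And>i. inverse (1 - \<beta> * y i) \<in> R"
    and adm: "admissible \<beta> y" and exp: "expands \<beta> y (Gp \<beta> y u * Gp \<beta> y v) c"
  shows "structure_const (Gp \<beta> y) u v w \<in> R"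
    and "structure_const (Gp (h \<beta>) (\<lambda>i. h (y i))) u v w = h (structure_const (Gp \<beta> y) u v w)"
proof -
  interpret h: partial_hom R h by fact
  interpret i: partial_hom R "\<lambda>x. x" using h.one_mem h.add_mem h.mult_mem h.uminus_mem by unfold_locales auto
  interpret c: partial_hom R "\<lambda>c. Const (h c)" by (rule partial_hom_comp[OF h partial_hom_Const])
  interpret m: partial_hom "polys_over R" "msubst (\<lambda>c. Const (h c)) Var" by (rule c.partial_hom_msubst)
  have G: "Gp \<beta> y w \<in> polys_over R" for w by (rule polys_Gp[OF h R])
  let ?f = "Gp \<beta> y u * Gp \<beta> y v"
  have f: "?f = (\<Sum>w\<in>keys c. Const (lookup c w) * Gp \<beta> y w)" and pos: "keys c \<subseteq> S_pos"
    using exp by (auto simp: expands_def)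
  have fR: "?f \<in> polys_over R" by (intro m.mult_mem G)
  have cR: "lookup c w \<in> R" for w
  proof (cases "w \<in> keys c")
    case True
    show ?thesis
    proof (rule coefficient_extraction[OF adm _ _ _ pos, of "polys_over R" R "lookup c" w])
      fix f b assume "f \<in> polys_over R"
      then obtain g where g: "g \<in> polys_over R" "(Var b - Var (b + 1)) * g = f - swapx b f"
        using difference_quotient[OF i.partial_hom_axioms] by blast
      have "(Var b - Var (b + 1)) * ((1 - Const \<beta> * Var b) * g) = (1 - Const \<beta> * Var b) * (f - swapx b f)"
        unfolding g(2)[symmetric] by (rule mult.left_commute)
      then show "\<exists>g\<in>polys_over R. (Var b - Var (b + 1)) * g = (1 - Const \<beta> * Var b) * (f - swapx b f)"
        by (intro bexI[of _ "(1 - Const \<beta> * Var b) * g"])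
          (use g in \<open>auto intro!: m.mult_mem m.diff_mem m.one_mem h.polys_Const h.polys_Var R\<close>)
    qed (use fR f True i.msubst_mem R in auto)
  qed (simp add: in_keys_iff h.zero_mem)
  have sc: "structure_const (Gp \<beta> y) u v w = lookup c w" for w by (rule structure_const_eq[OF adm exp])
  show "structure_const (Gp \<beta> y) u v w \<in> R" by (simp add: sc cR)
  let ?y = "\<lambda>i. h (y i)"
  let ?d = "Poly_Mapping.map h c"
  have d: "lookup ?d w = h (lookup c w)" for w by (simp add: map.rep_eq when_def h.hom_zero)
  have kd: "keys ?d \<subseteq> keys c" by (auto simp: in_keys_iff d h.hom_zero)
  have "Gp (h \<beta>) ?y u * Gp (h \<beta>) ?y v = msubst (\<lambda>c. Const (h c)) Var ?f"
    by (simp add: m.hom_mult G msubst_Gp_poly[OF h R adm])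
  also have "\<dots> = (\<Sum>w\<in>keys c. Const (lookup ?d w) * Gp (h \<beta>) ?y w)"
    unfolding f using cR
    by (simp add: m.hom_sum m.hom_mult m.mult_mem G msubst_Gp_poly[OF h R adm] d h.polys_Const)
  also have "\<dots> = (\<Sum>w\<in>keys ?d. Const (lookup ?d w) * Gp (h \<beta>) ?y w)"
    by (rule sum_lookup_superset[symmetric]) (use kd in auto)
  finally have "expands (h \<beta>) ?y (Gp (h \<beta>) ?y u * Gp (h \<beta>) ?y v) ?d"
    using kd pos by (auto simp: expands_def)
  from structure_const_eq[OF admissible_hom[OF h R adm] this]
  show "structure_const (Gp (h \<beta>) ?y) u v w = h (structure_const (Gp \<beta> y) u v w)"
    by (simp add: sc d)
qed

section \<open>Degrees in a single variable\<close>

text \<open>The positions beyond \<open>i\<close> with a positive dual code entry, equivalently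
  those that are not left-to-right maxima. Their number is \<open>Lambda_sum (i + 1) w\<close>, see
  \<open>Lambda_sum_eq\<close>.\<close>

definition crossed :: "int perm \<Rightarrow> int \<Rightarrow> int set" where
  "crossed w i = {q. i < q \<and> (\<exists>k<q. w \<langle>$\<rangle> q < w \<langle>$\<rangle> k)}"

lemma crossed_mem: "q \<in> crossed w i \<longleftrightarrow> i < q \<and> (\<exists>k<q. w \<langle>$\<rangle> q < w \<langle>$\<rangle> k)"
  by (simp add: crossed_def)

lemma finite_crossed [simp]: "finite (crossed w i)"
proof (rule finite_subset)
  show "crossed w i \<subseteq> snd ` inversions w"
    by (force simp: crossed_def inversions_def image_iff)
qed simp

lemma card_crossed_antimono: "i \<le> j \<Longrightarrow> card (crossed w j) \<le> card (crossed w i)"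
  by (rule card_mono[OF finite_crossed]) (auto simp: crossed_def)

text \<open>An ascending exchange moves the larger value forward, so each value with a larger one
  before it keeps such a value. Its position changes by \<open>adj t\<close> and stays beyond
  \<open>i\<close> because \<open>i < t\<close>.\<close>

lemma card_crossed_pstep:
  assumes "i < t" shows "card (crossed w i) \<le> card (crossed (pstep w t) i)"
proof (cases "desc w t")
  case False
  then have lt: "w \<langle>$\<rangle> t < w \<langle>$\<rangle> (t + 1)" by (simp add: not_desc_iff)
  have "adj t \<langle>$\<rangle> q \<in> crossed (w * adj t) i" if qc: "q \<in> crossed w i" for q
  proof -
    obtain k where k: "i < q" "k < q" "w \<langle>$\<rangle> q < w \<langle>$\<rangle> k" using qc by (auto simp: crossed_def)
    have "i < adj t \<langle>$\<rangle> q" using k assms by (simp add: adj_apply)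
    moreover have "\<exists>k'<adj t \<langle>$\<rangle> q. w \<langle>$\<rangle> q < (w * adj t) \<langle>$\<rangle> k'"
    proof (cases "q = t + 1")
      case True
      then have "k \<noteq> t" using k lt by auto
      then show ?thesis using k True by (intro exI[of _ k]) (simp add: apply_times adj_apply)
    next
      case q: False
      show ?thesis
      proof (cases "k = t \<and> q > t + 1")
        case True
        then show ?thesis using k q by (intro exI[of _ "t + 1"]) (simp add: apply_times adj_apply)
      next
        case False
        show ?thesis
        proof (cases "k = t + 1")
          case True
          then show ?thesis using k q by (intro exI[of _ t]) (simp add: apply_times adj_apply)
        next
          case kt: False
          then show ?thesis using k q False
            by (intro exI[of _ k]) (auto simp add: apply_times adj_apply)
        qed
      qed
    qed
    moreover have "(w * adj t) \<langle>$\<rangle> (adj t \<langle>$\<rangle> q) = w \<langle>$\<rangle> q" by (simp add: apply_times adj_apply)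
    ultimately show ?thesis by (simp only: crossed_mem simp_thms)
  qed
  then have "(\<lambda>q. adj t \<langle>$\<rangle> q) ` crossed w i \<subseteq> crossed (pstep w t) i"
    using False by (auto simp: pstep_def)
  moreover have "inj_on (\<lambda>q. adj t \<langle>$\<rangle> q) (crossed w i)" by (auto simp: inj_on_def perm_apply_eq_iff)
  ultimately show ?thesis by (metis card_mono card_image finite_crossed)
qed (simp add: pstep_def)

text \<open>The step leaves a descent at \<open>t\<close>, so \<open>t + 1\<close> counts beyond
  \<open>t\<close>. Whatever counted beyond \<open>t + 1\<close> still does, because only earlier
  positions are rearranged.\<close>

lemma card_crossed_pstep_Suc: "Suc (card (crossed w (t + 1))) \<le> card (crossed (pstep w t) t)"
proof -
  have "t + 1 \<in> crossed (pstep w t) t"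
    using desc_pstep[of w t] by (auto simp: crossed_def desc_def)
  moreover have "crossed w (t + 1) \<subseteq> crossed (pstep w t) t"
  proof (cases "desc w t")
    case False
    show ?thesis
    proof
      fix q assume "q \<in> crossed w (t + 1)"
      then obtain k where k: "t + 1 < q" "k < q" "w \<langle>$\<rangle> q < w \<langle>$\<rangle> k" by (auto simp: crossed_def)
      have "adj t \<langle>$\<rangle> k < q" using k by (simp add: adj_apply)
      moreover have "(w * adj t) \<langle>$\<rangle> (adj t \<langle>$\<rangle> k) = w \<langle>$\<rangle> k" "(w * adj t) \<langle>$\<rangle> q = w \<langle>$\<rangle> q"
        using k by (auto simp: apply_times adj_apply)
      ultimately have "q \<in> crossed (w * adj t) t" using k by (simp add: crossed_def) metis
      then show "q \<in> crossed (pstep w t) t" using False by (simp add: pstep_def)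
    qed
  qed (auto simp: pstep_def crossed_def)
  moreover have "t + 1 \<notin> crossed w (t + 1)" by (simp add: crossed_def)
  ultimately show ?thesis
    by (metis card_insert_disjoint card_mono finite_crossed insert_subset)
qed

definition row_count :: "int \<Rightarrow> (int \<times> int) list \<Rightarrow> nat" where
  "row_count i s = length (filter (\<lambda>c. fst c = i) s)"

lemma row_count_simps [simp]: "row_count i [] = 0"
  "row_count i (s @ [c]) = row_count i s + (if fst c = i then 1 else 0)"
  by (simp_all add: row_count_def)

text \<open>Letters decrease along a row, so each letter t of row \<open>i\<close> makes the count
  beyond t exceed the earlier count beyond t + 1. The bound \<open>j\<close> on the letters of the
  row carries this through the induction.\<close>

lemma row_count_le_last_row:
  assumes "sorted_wrt cell_less s" "\<forall>c\<in>set s. fst c \<le> i" "\<forall>c\<in>set s. fst c = i \<longrightarrow> j \<le> snd c"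
  shows "row_count i s \<le> card (crossed (hprod (map snd s)) j)"
  using assms
proof (induction s arbitrary: j rule: rev_induct)
  case (snoc c s)
  have sor: "sorted_wrt cell_less s" and lt: "\<forall>d\<in>set s. cell_less d c"
    using snoc.prems by (auto simp: sorted_wrt_append)
  show ?case
  proof (cases "fst c = i")
    case True
    have "\<forall>d\<in>set s. fst d = i \<longrightarrow> snd c + 1 \<le> snd d" using lt True by (auto simp: cell_less_def)
    then have "row_count i s \<le> card (crossed (hprod (map snd s)) (snd c + 1))"
      using snoc sor by simp
    then have "row_count i (s @ [c]) \<le> card (crossed (hprod (map snd (s @ [c]))) (snd c))"
      using card_crossed_pstep_Suc[of "hprod (map snd s)" "snd c"] True by simp
    also have "\<dots> \<le> card (crossed (hprod (map snd (s @ [c]))) j)"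
      by (rule card_crossed_antimono) (use snoc.prems True in simp)
    finally show ?thesis .
  next
    case False
    then have "fst c < i" using snoc.prems by simp
    then have "\<forall>d\<in>set s. fst d \<noteq> i" using lt by (auto simp: cell_less_def)
    then have "row_count i s = 0" by (auto simp: row_count_def filter_empty_conv)
    then show ?thesis using False by simp
  qed
qed simp

text \<open>Cells in rows beyond \<open>i\<close> have letters greater than \<open>i\<close>, and by
  \<open>card_crossed_pstep\<close> such steps never lower the count; what precedes them falls under
  \<open>row_count_le_last_row\<close>.\<close>

lemma row_count_le:
  assumes "sorted_wrt cell_less s" "\<forall>c\<in>set s. fst c \<le> snd c"
  shows "row_count i s \<le> card (crossed (hprod (map snd s)) i)"
  using assms
proof (induction s rule: rev_induct)
  case (snoc c s)
  have sor: "sorted_wrt cell_less s" and lt: "\<forall>d\<in>set s. cell_less d c"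
    using snoc.prems by (auto simp: sorted_wrt_append)
  show ?case
  proof (cases "fst c \<le> i")
    case True
    then have "\<forall>d\<in>set (s @ [c]). fst d \<le> i" using lt by (fastforce simp: cell_less_def)
    then show ?thesis by (intro row_count_le_last_row) (use snoc.prems in auto)
  next
    case False
    have "fst c \<le> snd c" using snoc.prems by simp
    then have "i < snd c" using False by linarith
    then have "card (crossed (hprod (map snd s)) i) \<le> card (crossed (hprod (map snd (s @ [c]))) i)"
      using card_crossed_pstep by simp
    then show ?thesis using snoc sor False by simp
  qed
qed simp

section \<open>Degree bounds in one variable\<close>

definition deg_le :: "int \<Rightarrow> nat \<Rightarrow> 'k::comm_ring_1 mpoly \<Rightarrow> bool" where
  "deg_le i d p \<longleftrightarrow> (\<forall>m\<in>keys p. lookup m i \<le> d)"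

lemma deg_le_mono: "deg_le i d p \<Longrightarrow> d \<le> e \<Longrightarrow> deg_le i e p"
  by (force simp: deg_le_def)

lemma deg_le_sum: "(\<And>x. x \<in> A \<Longrightarrow> deg_le i d (f x)) \<Longrightarrow> deg_le i d (\<Sum>x\<in>A. f x)"
proof (induction A rule: infinite_finite_induct)
  case (insert x A)
  then show ?case using keys_add[of "f x" "sum f A"] by (auto simp: deg_le_def)
qed (auto simp: deg_le_def)

lemma deg_le_mult: "deg_le i d p \<Longrightarrow> deg_le i e q \<Longrightarrow> deg_le i (d + e) (p * q)"
  using keys_mult[of p q] by (fastforce simp: deg_le_def lookup_add intro: add_mono)

lemma deg_le_Const: "deg_le i 0 (Const c)"
  by (simp add: deg_le_def Const_def)

lemma deg_le_minus_Const_power: "deg_le i 0 ((- Const c) ^ n)"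
  by (metis Const_power Const_uminus deg_le_Const)

lemma deg_le_linear: "deg_le i (if j = i then 1 else 0) (Var j - Const c)"
proof -
  have eq: "Var j - Const c = Var j + Const (- c)" by (simp add: Const_uminus)
  have "keys (Var j + Const (- c)) \<subseteq> {single j 1, 0}"
    using keys_add[of "Var j" "Const (- c)"] by (auto simp: Var_def Const_def split: if_splits)
  then show ?thesis unfolding eq deg_le_def by (auto simp: lookup_single)
qed

lemma deg_le_prod: "(\<And>x. x \<in> A \<Longrightarrow> deg_le i (d x) (f x)) \<Longrightarrow> deg_le i (\<Sum>x\<in>A. d x) (\<Prod>x\<in>A. f x)"
proof (induction A rule: infinite_finite_induct)
  case (insert x A)
  then show ?case using deg_le_mult[of i "d x" "f x"] by simp
qed (use deg_le_Const[of i 1] in simp_all)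

lemma row_count_zip:
  assumes "length b = length t"
  shows "row_count i (zip b t) = (\<Sum>j<length t. if b ! j = i then 1 else 0)"
proof -
  have "row_count i (zip b t) = card {j. j < length t \<and> b ! j = i}"
    using assms by (auto simp: row_count_def length_filter_conv_card intro!: arg_cong[where f = card])
  also have "\<dots> = (\<Sum>j<length t. if b ! j = i then 1 else 0)"
    by (simp add: sum.If_cases Int_def lessThan_def conj_commute)
  finally show ?thesis .
qed

lemma deg_le_Gp: "deg_le i (if 1 \<le> i then card (crossed w i) else 0) (Gp \<beta> y w)"
  unfolding Gp_def
proof (rule deg_le_sum, clarify)
  fix t b assume h: "t \<in> hecke_words w" and c: "compatible t b"
  let ?f = "\<lambda>j. (Var (b ! j) - Const (y (t ! j - b ! j + 1))) * Const (inverse (1 - \<beta> * y (t ! j - b ! j + 1)))"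
  have len: "length b = length t" using c by (simp add: compatible_def)
  have "deg_le i (if b ! j = i then 1 else 0) (?f j)" for j
    using deg_le_mult[OF deg_le_linear deg_le_Const] by (simp only: add_0_right)
  then have "deg_le i (\<Sum>j<length t. if b ! j = i then 1 else 0) (\<Prod>j<length t. ?f j)"
    by (rule deg_le_prod)
  then have "deg_le i (0 + row_count i (zip b t)) ((- Const \<beta>) ^ (length t - perm_length w) * (\<Prod>j<length t. ?f j))"
    unfolding row_count_zip[OF len] by (intro deg_le_mult deg_le_minus_Const_power)
  moreover have "row_count i (zip b t) \<le> (if 1 \<le> i then card (crossed w i) else 0)"
  proof (cases "1 \<le> i")
    case True
    have "row_count i (zip b t) \<le> card (crossed (hprod (map snd (zip b t))) i)"
      by (rule row_count_le) (use c in \<open>auto simp: compatible_iff\<close>)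
    then show ?thesis using True h len by (simp add: hecke_words_eq)
  next
    case False
    have "\<forall>d\<in>set (zip b t). fst d \<noteq> i" using c False by (auto simp: compatible_iff)
    then show ?thesis using False by (auto simp: row_count_def filter_empty_conv)
  qed
  ultimately show "deg_le i (if 1 \<le> i then card (crossed w i) else 0)
      ((- Const \<beta>) ^ (length t - perm_length w) * (\<Prod>j<length t. ?f j))"
    by (auto intro: deg_le_mono)
qed

section \<open>Spaces of polynomials with bounded exponents\<close>

definition Sn :: "nat \<Rightarrow> int perm set" where
  "Sn n = {w. \<forall>i. i < 1 \<or> i > int n \<longrightarrow> w \<langle>$\<rangle> i = i}"

definition stair_exp :: "nat \<Rightarrow> int \<Rightarrow> nat" where
  "stair_exp n i = (if 1 \<le> i then nat (int n - i) else 0)"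

definition Vn :: "nat \<Rightarrow> 'k::comm_ring_1 mpoly set" where
  "Vn n = {p. \<forall>i. deg_le i (stair_exp n i) p}"

lemma Sn_S_pos: "w \<in> Sn n \<Longrightarrow> w \<in> S_pos"
  by (simp add: Sn_def S_pos_def)

lemma Sn_mono: "m \<le> n \<Longrightarrow> Sn m \<subseteq> Sn n"
  by (auto simp: Sn_def)

lemma S_pos_Sn:
  assumes "w \<in> S_pos" shows "\<exists>n. w \<in> Sn n"
proof -
  obtain N where N: "\<And>i. \<bar>i\<bar> > N \<Longrightarrow> w \<langle>$\<rangle> i = i" using perm_eventually_fixed by blast
  have "w \<in> Sn (nat N)"
    unfolding Sn_def
  proof (clarify, elim disjE)
    fix i :: int assume "int (nat N) < i"
    then show "w \<langle>$\<rangle> i = i" by (intro N) linarith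
  qed (use assms in \<open>auto simp: S_pos_def\<close>)
  then show ?thesis by blast
qed

lemma Sn_apply_le:
  assumes "w \<in> Sn n" "i \<le> int n" shows "w \<langle>$\<rangle> i \<le> int n"
proof (rule ccontr)
  assume gt: "\<not> w \<langle>$\<rangle> i \<le> int n"
  then have "w \<langle>$\<rangle> (w \<langle>$\<rangle> i) = w \<langle>$\<rangle> i" using assms by (simp add: Sn_def)
  then show False using gt assms by (simp add: perm_apply_eq_iff)
qed

lemma crossed_Sn:
  assumes "w \<in> Sn n" shows "crossed w i \<subseteq> {i<..int n}"
proof
  fix q assume "q \<in> crossed w i"
  then obtain k where k: "i < q" "k < q" "w \<langle>$\<rangle> q < w \<langle>$\<rangle> k" by (auto simp: crossed_def)
  have "q \<le> int n"
  proof (rule ccontr)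
    assume q: "\<not> q \<le> int n"
    then have "w \<langle>$\<rangle> q = q" using assms by (simp add: Sn_def)
    moreover have "w \<langle>$\<rangle> k < q"
      using Sn_apply_le[OF assms, of k] assms k q by (cases "k \<le> int n") (auto simp: Sn_def)
    ultimately show False using k by simp
  qed
  then show "q \<in> {i<..int n}" using k by simp
qed

lemma card_crossed_Sn: "w \<in> Sn n \<Longrightarrow> card (crossed w i) \<le> nat (int n - i)"
  using card_mono[OF _ crossed_Sn[of w n i]] by simp

lemma Gp_Vn:
  assumes "w \<in> Sn n" shows "Gp \<beta> y w \<in> Vn n"
  unfolding Vn_def
proof safe
  fix i show "deg_le i (stair_exp n i) (Gp \<beta> y w)"
    by (rule deg_le_mono[OF deg_le_Gp]) (use card_crossed_Sn[OF assms] in \<open>auto simp: stair_exp_def\<close>)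
qed

lemma bij_betw_Sn: "bij_betw (\<lambda>w. apply w) (Sn n) {p. p permutes {1..int n}}"
proof (rule bij_betw_imageI)
  show "inj_on (\<lambda>w. apply w) (Sn n)" by (auto simp: inj_on_def intro: perm_eqI)
  show "(\<lambda>w. apply w) ` Sn n = {p. p permutes {1..int n}}"
  proof (intro equalityI subsetI)
    fix p assume "p \<in> (\<lambda>w. apply w) ` Sn n"
    then show "p \<in> {p. p permutes {1..int n}}"
    proof clarify
      fix w assume w: "w \<in> Sn n"
      have "\<exists>!x. w \<langle>$\<rangle> x = y" for y
        by (rule ex1I[of _ "inverse w \<langle>$\<rangle> y"]) auto
      then show "apply w permutes {1..int n}"
        using w by (auto simp: Sn_def permutes_def)
    qed
  next
    fix p assume "p \<in> {p. p permutes {1..int n}}"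
    then have p: "p permutes {1..int n}" by simp
    have "{a. p a \<noteq> a} \<subseteq> {1..int n}" using p by (auto simp: permutes_def)
    then have "finite {a. p a \<noteq> a}" by (rule finite_subset) simp
    then have ap: "apply (Perm p) = p" using permutes_bij[OF p] by (intro Perm_inverse) simp
    have "Perm p \<in> Sn n" using p by (auto simp: Sn_def ap permutes_def)
    then show "p \<in> (\<lambda>w. apply w) ` Sn n" using ap by (metis image_eqI)
  qed
qed

lemma card_Sn: "card (Sn n) = fact n"
  using bij_betw_same_card[OF bij_betw_Sn[of n]] card_permutations[of "{1..int n}" n] by simp

lemma finite_Sn [simp]: "finite (Sn n)"
  using card_Sn[of n] by (metis card.infinite fact_nonzero)

definition exps :: "nat \<Rightarrow> (int \<Rightarrow>\<^sub>0 nat) set" where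
  "exps n = {m. \<forall>i. lookup m i \<le> stair_exp n i}"

text \<open>An exponent vector below the staircase is determined by its entries at 1, ..., n, with n
  - i + 1 choices at i.\<close>

lemma finite_card_exps: "finite (exps n) \<and> card (exps n) \<le> fact n"
proof -
  let ?F = "PiE {1..int n} (\<lambda>i. {..nat (int n - i)})"
  let ?r = "\<lambda>m :: int \<Rightarrow>\<^sub>0 nat. restrict (lookup m) {1..int n}"
  have inj: "inj_on ?r (exps n)"
  proof (rule inj_onI, rule poly_mapping_eqI)
    fix m m' i assume mm: "m \<in> exps n" "m' \<in> exps n" "?r m = ?r m'"
    show "lookup m i = lookup m' i"
    proof (cases "i \<in> {1..int n}")
      case True
      then show ?thesis using fun_cong[OF mm(3), of i] by simp
    next
      case False
      then have "stair_exp n i = 0" by (auto simp: stair_exp_def)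
      then show ?thesis using mm by (auto simp: exps_def) (metis le_zero_eq)
    qed
  qed
  have sub: "?r ` exps n \<subseteq> ?F" 
  proof (rule image_subsetI, rule PiE_I)
    fix m i assume "m \<in> exps n" "i \<in> {1..int n}"
    then have "lookup m i \<le> stair_exp n i" by (simp add: exps_def)
    moreover have "stair_exp n i = nat (int n - i)"
      using \<open>i \<in> _\<close> by (simp add: stair_exp_def)
    ultimately show "?r m i \<in> {..nat (int n - i)}" using \<open>i \<in> _\<close> by simp
  qed auto
  have fin: "finite ?F" by (intro finite_PiE) auto
  have "card ?F = (\<Prod>i\<in>{1..int n}. Suc (nat (int n - i)))" by (simp add: card_PiE)
  also have "\<dots> = (\<Prod>k\<in>{1..n}. k)"
    by (rule prod.reindex_bij_witness[where i = "\<lambda>k. int n + 1 - int k" and j = "\<lambda>i. nat (int n + 1 - i)"])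
      (auto simp: nat_diff_distrib)
  also have "\<dots> = fact n" by (simp add: fact_prod)
  finally have "card ?F = fact n" .
  then show ?thesis
    using card_inj_on_le[OF inj sub fin] inj_on_finite[OF inj sub fin] by simp
qed

section \<open>Expansions of polynomials below the staircase\<close>

global_interpretation mpoly_space: vector_space "\<lambda>(c::'k::field) (p::'k mpoly). Const c * p"
  by unfold_locales (simp_all add: Const_add Const_mult algebra_simps)

lemma inj_on_Gp:
  assumes "admissible \<beta> y" shows "inj_on (Gp \<beta> y) S_pos"
proof (rule inj_onI, rule ccontr)
  fix u v assume uv: "u \<in> S_pos" "v \<in> S_pos" "Gp \<beta> y u = Gp \<beta> y v" "u \<noteq> v"
  have "(\<Sum>w\<in>{u, v}. Const (if w = u then 1 else - 1) * Gp \<beta> y w) = 0"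
    using uv by (simp add: Const_uminus)
  from Gp_independent[OF assms _ _ this, of u] uv show False by simp
qed

text \<open>A polynomial outside the span would give \<open>fact n + 1\<close> independent elements
  in a space spanned by at most \<open>fact n\<close> monomials. Spanning thus follows from
  independence, with no explicit expansion.\<close>

lemma Vn_subset_span:
  fixes \<beta> :: "'k::field"
  assumes "admissible \<beta> y"
  shows "Vn n \<subseteq> mpoly_space.span (Gp \<beta> y ` Sn n)"
proof (rule subsetI, rule ccontr)
  fix f :: "'k mpoly" assume f: "f \<in> Vn n" and nf: "f \<notin> mpoly_space.span (Gp \<beta> y ` Sn n)"
  let ?B = "Gp \<beta> y ` Sn n" and ?M = "(\<lambda>m. single m (1 :: 'k)) ` exps n"
  have inj: "inj_on (Gp \<beta> y) (Sn n)"
    by (rule inj_on_subset[OF inj_on_Gp[OF assms]]) (auto intro: Sn_S_pos)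
  have "mpoly_space.independent ?B"
  proof
    assume "mpoly_space.dependent ?B"
    then obtain c where c: "\<exists>p\<in>?B. c p \<noteq> 0" "(\<Sum>p\<in>?B. Const (c p) * p) = 0"
      by (auto simp: mpoly_space.dependent_finite)
    have "(\<Sum>w\<in>Sn n. Const (c (Gp \<beta> y w)) * Gp \<beta> y w) = 0"
      using c(2) by (simp add: sum.reindex[OF inj])
    then have "c (Gp \<beta> y w) = 0" if "w \<in> Sn n" for w
      using Gp_independent[OF assms _ _ _ that, of "\<lambda>w. c (Gp \<beta> y w)"] Sn_S_pos by auto
    then show False using c(1) by auto
  qed
  then have ind: "mpoly_space.independent (insert f ?B)"
    using nf by (simp add: mpoly_space.independent_insert)
  have span: "Vn n \<subseteq> mpoly_space.span ?M"
  proof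
    fix p :: "'k mpoly" assume p: "p \<in> Vn n"
    have eq: "p = (\<Sum>m\<in>keys p. Const (lookup p m) * single m 1)"
      using sum_monomials[of p] by (simp add: Const_def mult_single)
    have "keys p \<subseteq> exps n" using p by (auto simp: Vn_def deg_le_def exps_def)
    then have "(\<Sum>m\<in>keys p. Const (lookup p m) * single m 1) \<in> mpoly_space.span ?M"
      by (intro mpoly_space.span_sum mpoly_space.span_scale mpoly_space.span_base) auto
    then show "p \<in> mpoly_space.span ?M" by (subst eq)
  qed
  have "insert f ?B \<subseteq> mpoly_space.span ?M" using f span Gp_Vn by blast
  then have "card (insert f ?B) \<le> card ?M"
    using mpoly_space.independent_span_bound[OF _ ind] finite_card_exps[of n] by blast
  also have "\<dots> \<le> fact n" using finite_card_exps[of n] card_image_le[of "exps n"] le_trans by blast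
  also have "fact n = card ?B" by (simp add: card_image[OF inj] card_Sn)
  finally have "card (insert f ?B) \<le> card ?B" .
  moreover have "f \<notin> ?B" using nf mpoly_space.span_base by blast
  ultimately show False by simp
qed

lemma Vn_expands:
  fixes \<beta> :: "'k::field"
  assumes adm: "admissible \<beta> y" and f: "f \<in> Vn n"
  obtains c where "expands \<beta> y f c" "keys c \<subseteq> Sn n"
proof -
  have inj: "inj_on (Gp \<beta> y) (Sn n)"
    by (rule inj_on_subset[OF inj_on_Gp[OF adm]]) (auto intro: Sn_S_pos)
  have "f \<in> mpoly_space.span (Gp \<beta> y ` Sn n)" using Vn_subset_span[OF adm] f by blast
  then obtain a where "f = (\<Sum>p\<in>Gp \<beta> y ` Sn n. Const (a p) * p)"
    by (auto simp: mpoly_space.span_finite)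
  then have fa: "f = (\<Sum>w\<in>Sn n. Const (a (Gp \<beta> y w)) * Gp \<beta> y w)"
    by (simp add: sum.reindex[OF inj])
  define c where "c = Abs_poly_mapping (\<lambda>w. if w \<in> Sn n then a (Gp \<beta> y w) else 0)"
  have c: "lookup c w = (if w \<in> Sn n then a (Gp \<beta> y w) else 0)" for w
    unfolding c_def
    by (subst lookup_Abs_poly_mapping) (auto intro: finite_subset[OF _ finite_Sn[of n]])
  have kc: "keys c \<subseteq> Sn n" by (auto simp: in_keys_iff c split: if_splits)
  have "f = (\<Sum>w\<in>Sn n. Const (lookup c w) * Gp \<beta> y w)" unfolding fa by (simp add: c)
  then have "expands \<beta> y f c"
    using sum_lookup_superset[OF finite_Sn kc] kc Sn_S_pos by (auto simp: expands_def)
  then show thesis using that kc by blast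
qed

lemma Gp_mult_Vn:
  assumes "\<And>i. 1 \<le> i \<Longrightarrow> card (crossed u i) + card (crossed v i) \<le> nat (int n - i)"
  shows "Gp \<beta> y u * Gp \<beta> y v \<in> Vn n"
  unfolding Vn_def
proof safe
  fix i
  have "deg_le i ((if 1 \<le> i then card (crossed u i) else 0) + (if 1 \<le> i then card (crossed v i) else 0))
      (Gp \<beta> y u * Gp \<beta> y v)"
    by (intro deg_le_mult deg_le_Gp)
  then show "deg_le i (stair_exp n i) (Gp \<beta> y u * Gp \<beta> y v)"
    by (rule deg_le_mono) (use assms in \<open>auto simp: stair_exp_def\<close>)
qed

lemma product_expands:
  assumes "admissible \<beta> y" "u \<in> S_pos" "v \<in> S_pos"
  obtains c where "expands \<beta> y (Gp \<beta> y u * Gp \<beta> y v) c"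
proof -
  obtain k l where kl: "u \<in> Sn k" "v \<in> Sn l" using S_pos_Sn assms by blast
  have "Gp \<beta> y u * Gp \<beta> y v \<in> Vn (k + l)"
  proof (rule Gp_mult_Vn)
    fix i :: int assume "1 \<le> i"
    then show "card (crossed u i) + card (crossed v i) \<le> nat (int (k + l) - i)"
      using card_crossed_Sn[OF kl(1), of i] card_crossed_Sn[OF kl(2), of i] by simp
  qed
  then show thesis using Vn_expands[OF assms(1)] that by blast
qed

lemma structure_const_expands:
  assumes "admissible \<beta> y" "u \<in> S_pos" "v \<in> S_pos"
  obtains c where "expands \<beta> y (Gp \<beta> y u * Gp \<beta> y v) c" "lookup c = structure_const (Gp \<beta> y) u v"
proof -
  obtain c where c: "expands \<beta> y (Gp \<beta> y u * Gp \<beta> y v) c" by (rule product_expands[OF assms])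
  then have "lookup c = structure_const (Gp \<beta> y) u v"
    using structure_const_eq[OF assms(1)] by (intro ext) simp
  with c that show thesis by blast
qed

text \<open>The product lies below the staircase for \<open>n\<close>, so it has an expansion
  supported in \<open>Sn n\<close>, and by uniqueness this is the one that defines the
  constants.\<close>

lemma structure_const_support:
  assumes "admissible \<beta> y"
    and "\<And>i. 1 \<le> i \<Longrightarrow> card (crossed u i) + card (crossed v i) \<le> nat (int n - i)"
    and "structure_const (Gp \<beta> y) u v w \<noteq> 0"
  shows "w \<in> Sn n"
proof -
  obtain c where c: "expands \<beta> y (Gp \<beta> y u * Gp \<beta> y v) c" "keys c \<subseteq> Sn n"
    using Vn_expands[OF assms(1) Gp_mult_Vn[OF assms(2)]] by blast
  then show ?thesis using structure_const_eq[OF assms(1) c(1)] assms(3) by (auto simp: in_keys_iff)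
qed

section \<open>Pipe dreams with a row of maximal length\<close>

definition S_from :: "int \<Rightarrow> int perm set" where
  "S_from r = {w. \<forall>i<r. w \<langle>$\<rangle> i = i}"

lemma S_pos_eq_S_from: "S_pos = S_from 1"
  by (auto simp: S_pos_def S_from_def)

lemma S_from_ge:
  assumes "w \<in> S_from r" "r \<le> i" shows "r \<le> w \<langle>$\<rangle> i"
proof (rule ccontr)
  assume lt: "\<not> r \<le> w \<langle>$\<rangle> i"
  then have "w \<langle>$\<rangle> (w \<langle>$\<rangle> i) = w \<langle>$\<rangle> i" using assms by (simp add: S_from_def)
  then show False using lt assms by (simp add: perm_apply_eq_iff)
qed

lemma perm_length_adj_mult:
  assumes "desc (inverse w) t"
  shows "perm_length w = Suc (perm_length (adj t * w))"
proof -
  have "perm_length (adj t * w) = perm_length (inverse w * adj t)"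
    using perm_length_inverse[of "adj t * w"] by simp
  then show ?thesis using perm_length_desc[OF assms] by (simp add: perm_length_inverse)
qed

definition word_perm :: "int list \<Rightarrow> int perm" where
  "word_perm t = prod_list (map adj t)"

lemma word_perm_simps [simp]: "word_perm [] = 1" "word_perm (i # t) = adj i * word_perm t"
  "word_perm (s @ t) = word_perm s * word_perm t"
  by (simp_all add: word_perm_def)

text \<open>Left multiplication by \<open>adj t\<close> exchanges the values t and t + 1. The
  letters from \<open>w(r) - 1\<close> down to \<open>r\<close> lower the value at position
  \<open>r\<close> to \<open>r\<close> and raise the values passed by one, so the other positions
  keep their relative order.\<close>

lemma strip_row:
  assumes "w \<in> S_from r"
  shows "\<exists>D v. v \<in> S_from (r + 1) \<and> w = word_perm D * v \<and> perm_length w = length D + perm_length v \<and>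
    sorted_wrt (>) D \<and> (\<forall>t\<in>set D. r \<le> t \<and> t < w \<langle>$\<rangle> r) \<and>
    (\<forall>p q. r < p \<longrightarrow> r < q \<longrightarrow> v \<langle>$\<rangle> p < v \<langle>$\<rangle> q \<longleftrightarrow> w \<langle>$\<rangle> p < w \<langle>$\<rangle> q)"
  using assms
proof (induction "nat (w \<langle>$\<rangle> r - r)" arbitrary: w)
  case 0
  then have "w \<langle>$\<rangle> r = r" using S_from_ge[of w r r] by simp
  then have "w \<in> S_from (r + 1)" using 0(2) by (auto simp: S_from_def order_le_less)
  then show ?case by (intro exI[of _ "[]"] exI[of _ w]) simp
next
  case (Suc n)
  define t where "t = w \<langle>$\<rangle> r - 1"
  have t: "r \<le> t" "w \<langle>$\<rangle> r = t + 1" using Suc by (simp_all add: t_def)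
  define p where "p = inverse w \<langle>$\<rangle> t"
  have wp: "w \<langle>$\<rangle> p = t" by (simp add: p_def)
  have "p \<noteq> r" using wp t by auto
  moreover have "\<not> p < r" using wp t Suc.prems by (auto simp: S_from_def)
  ultimately have "r < p" by simp
  moreover have "inverse w \<langle>$\<rangle> (t + 1) = r" by (metis apply_inverse_cancel(2) t(2))
  ultimately have d: "desc (inverse w) t" by (simp add: desc_def flip: p_def)
  let ?v = "adj t * w"
  have vr: "?v \<langle>$\<rangle> r = t" by (simp add: apply_times adj_apply t)
  have vS: "?v \<in> S_from r" using Suc.prems t by (auto simp: S_from_def apply_times adj_apply)
  have "n = nat (?v \<langle>$\<rangle> r - r)" using Suc(2) t by (simp add: vr)
  from Suc.hyps(1)[OF this vS] obtain D v where D: "v \<in> S_from (r + 1)" "?v = word_perm D * v"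
    "perm_length ?v = length D + perm_length v" "sorted_wrt (>) D" "\<forall>x\<in>set D. r \<le> x \<and> x < t"
    "\<forall>p q. r < p \<longrightarrow> r < q \<longrightarrow> v \<langle>$\<rangle> p < v \<langle>$\<rangle> q \<longleftrightarrow> ?v \<langle>$\<rangle> p < ?v \<langle>$\<rangle> q"
    unfolding vr by blast
  have ord: "?v \<langle>$\<rangle> p < ?v \<langle>$\<rangle> q \<longleftrightarrow> w \<langle>$\<rangle> p < w \<langle>$\<rangle> q" if "r < p" "r < q" for p q
  proof -
    have "w \<langle>$\<rangle> p \<noteq> t + 1" "w \<langle>$\<rangle> q \<noteq> t + 1"
      using that perm_apply_eq_iff[of w _ r] t(2) by (metis less_irrefl)+
    then show ?thesis by (simp add: apply_times adj_apply) linarith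
  qed
  have "w = adj t * ?v" by simp
  then have "w = word_perm (t # D) * v" using D(2) by (simp add: mult.assoc)
  moreover have "perm_length w = length (t # D) + perm_length v"
    using perm_length_adj_mult[OF d] D(3) by simp
  ultimately show ?case
    using D t ord by (intro exI[of _ "t # D"] exI[of _ v]) auto
qed

definition reduced_cells :: "int \<Rightarrow> int perm \<Rightarrow> (int \<times> int) list \<Rightarrow> bool" where
  "reduced_cells r w s \<longleftrightarrow> sorted_wrt cell_less s \<and> (\<forall>c\<in>set s. r \<le> fst c \<and> fst c \<le> snd c) \<and>
     word_perm (map snd s) = w \<and> length s = perm_length w"

lemma reduced_cells_row:
  assumes "reduced_cells (r + 1) v s" "sorted_wrt (>) D" "\<forall>t\<in>set D. r \<le> t"
    "w = word_perm D * v" "perm_length w = length D + perm_length v"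
  shows "reduced_cells r w (map (\<lambda>t. (r, t)) D @ s)"
proof -
  have "sorted_wrt cell_less (map (\<lambda>t. (r, t)) D)"
    using assms(2) by (simp add: sorted_wrt_map cell_less_def)
  moreover have "cell_less (r, t) c" if "c \<in> set s" for t c
    using that assms(1) by (auto simp: reduced_cells_def cell_less_def)
  moreover have "map (snd \<circ> (\<lambda>t. (r, t))) D = D" by (simp add: comp_def)
  ultimately show ?thesis
    using assms by (fastforce simp: reduced_cells_def sorted_wrt_append)
qed

lemma reduced_cells_mono: "reduced_cells r' w s \<Longrightarrow> r \<le> r' \<Longrightarrow> reduced_cells r w s"
  by (force simp: reduced_cells_def)

lemma reduced_cells_exist: "w \<in> S_from r \<Longrightarrow> \<exists>s. reduced_cells r w s"
proof (induction "perm_length w" arbitrary: w r rule: less_induct)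
  case less
  show ?case
  proof (cases "w = 1")
    case True
    then show ?thesis by (intro exI[of _ "[]"]) (simp add: reduced_cells_def)
  next
    case False
    have fin: "finite (affected w)" by simp
    have ne: "affected w \<noteq> {}" using False by simp
    \<comment> \<open>At the least moved position the row is nonempty, which makes the length
      drop.\<close>
    define m where "m = Min (affected w)"
    have m: "m \<in> affected w" "\<And>i. i \<in> affected w \<Longrightarrow> m \<le> i"
      using fin ne by (simp_all add: m_def)
    have rm: "r \<le> m" using m(1) less.prems by (auto simp: in_affected S_from_def not_less[symmetric])
    have wm: "w \<in> S_from m" using m(2) by (force simp: S_from_def in_affected)
    from strip_row[OF wm] obtain D v where D: "v \<in> S_from (m + 1)" "w = word_perm D * v"
      "perm_length w = length D + perm_length v" "sorted_wrt (>) D" "\<forall>t\<in>set D. m \<le> t" by blast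
    have "D \<noteq> []"
    proof
      assume "D = []"
      then show False using D(1,2) m(1) by (simp add: in_affected S_from_def)
    qed
    then have "perm_length v < perm_length w" using D(3) by (cases D) auto
    from less.hyps[OF this D(1)] obtain s where "reduced_cells (m + 1) v s" by blast
    from reduced_cells_row[OF this D(4,5,2,3)] show ?thesis using reduced_cells_mono rm by blast
  qed
qed

lemma strip_maximal_row:
  assumes w: "w \<in> S_from r"
  shows "\<exists>D v. v \<in> S_from (r + 1) \<and> w = word_perm D * v \<and> perm_length w = length D + perm_length v \<and>
    sorted_wrt (>) D \<and> (\<forall>t\<in>set D. r \<le> t) \<and> length D = card (crossed w r)"
proof -
  obtain N where N: "\<And>i. \<bar>i\<bar> > N \<Longrightarrow> w \<langle>$\<rangle> i = i" using perm_eventually_fixed by blast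
  define n where "n = \<bar>N\<bar> + \<bar>r\<bar> + 1"
  have fixd: "w \<langle>$\<rangle> i = i" if "n \<le> i" for i by (rule N) (use that n_def in linarith)
  have small: "w \<langle>$\<rangle> i < n" if "i < n" for i
  proof (rule ccontr)
    assume "\<not> w \<langle>$\<rangle> i < n"
    then have "w \<langle>$\<rangle> (w \<langle>$\<rangle> i) = w \<langle>$\<rangle> i" by (intro fixd) simp
    then show False using that \<open>\<not> w \<langle>$\<rangle> i < n\<close> by (simp add: perm_apply_eq_iff)
  qed
  txt \<open>The letters of the row are the values \<open>t \<ge> r\<close> that are not left-to-right maxima, in decreasing
    order.  Once those above \<open>t\<close> are removed, value \<open>t\<close> sits at the first position whose original
    value is at least \<open>t\<close>.\<close>
  let ?C = "\<lambda>t. {q \<in> crossed w r. t \<le> w \<langle>$\<rangle> q}"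
  \<comment> \<open>The invariant as \<open>t\<close> descends from \<open>n\<close> to
    \<open>r\<close>; its last clause records that values below \<open>t\<close> have not been moved
    yet.\<close>
  let ?P = "\<lambda>t D v. w = word_perm D * v \<and> perm_length w = length D + perm_length v \<and>
    sorted_wrt (>) D \<and> (\<forall>x\<in>set D. t \<le> x) \<and> length D = card (?C t) \<and>
    t \<le> w \<langle>$\<rangle> (inverse v \<langle>$\<rangle> t) \<and> (\<forall>k<inverse v \<langle>$\<rangle> t. w \<langle>$\<rangle> k < t) \<and>
    (\<forall>j<t. inverse v \<langle>$\<rangle> j = inverse w \<langle>$\<rangle> j)"
  have "r \<le> t \<longrightarrow> (\<exists>D v. ?P t D v)" if "t \<le> n" for t
    using that
  proof (induction t rule: int_le_induct)
    case base
    have "?C n = {}"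
    proof (rule ccontr)
      assume "?C n \<noteq> {}"
      then obtain q k where q: "n \<le> w \<langle>$\<rangle> q" "k < q" "w \<langle>$\<rangle> q < w \<langle>$\<rangle> k" by (auto simp: crossed_def)
      then have "n \<le> q" using small[of q] by linarith
      then have "w \<langle>$\<rangle> k < q" using small[of k] fixd[of k] q by (cases "k < n") auto
      then show False using q fixd[OF \<open>n \<le> q\<close>] by simp
    qed
    moreover have "inverse w \<langle>$\<rangle> n = n" by (metis apply_inverse_cancel(2) fixd order_refl)
    ultimately show ?case
      using fixd[of n] small by (intro impI exI[of _ "[]"] exI[of _ w]) simp
  next
    case (step t')
    define t where "t = t' - 1"
    have t': "t' = t + 1" by (simp add: t_def)
    show ?case
      unfolding t_def[symmetric]
    proof
      assume rt: "r \<le> t"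
      then obtain D v where Dv: "?P (t + 1) D v" using step t' by auto
      have lenD: "perm_length w = length D + perm_length v" and cardD: "length D = card (?C (t + 1))"
        using Dv by blast+
      define p p0 where "p = inverse w \<langle>$\<rangle> t" and "p0 = inverse v \<langle>$\<rangle> (t + 1)"
      have wp: "w \<langle>$\<rangle> p = t" by (simp add: p_def)
      have p0: "t + 1 \<le> w \<langle>$\<rangle> p0" "\<forall>k<p0. w \<langle>$\<rangle> k < t + 1" using Dv by (auto simp: p0_def)
      have vt: "inverse v \<langle>$\<rangle> t = p" using Dv by (simp add: p_def)
      have below: "w \<langle>$\<rangle> k < t" if "k < p0" "k \<noteq> p" for k
        using p0(2) that perm_apply_eq_iff[of w k p] wp by fastforce
      have pp0: "p \<noteq> p0" using p0 wp by auto
      have split: "?C t = ?C (t + 1) \<union> {q \<in> crossed w r. q = p}"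
        using wp perm_apply_eq_iff[of w _ p] by fastforce
      show "\<exists>D v. ?P t D v"
      \<comment> \<open>\<open>p0\<close> is the first position with a value above \<open>t\<close>.
        If \<open>t\<close> stands before it, \<open>t\<close> is a left-to-right maximum and
        contributes no letter; otherwise \<open>t\<close> becomes a letter, and exchanging
        \<open>t\<close> with \<open>t + 1\<close> puts the value \<open>t\<close> at
        \<open>p0\<close>.\<close>
      proof (cases "p < p0")
        case True
        have "p \<notin> crossed w r"
        proof
          assume "p \<in> crossed w r"
          then obtain k where "k < p" "w \<langle>$\<rangle> p < w \<langle>$\<rangle> k" by (auto simp: crossed_def)
          moreover from this have "w \<langle>$\<rangle> k < t + 1" using p0(2) True by simp
          ultimately show False using wp by simp
        qed
        then have "?C t = ?C (t + 1)" using split by auto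
        moreover have "\<forall>k<p. w \<langle>$\<rangle> k < t" using below True by auto
        ultimately show ?thesis
          using Dv vt wp by (intro exI[of _ D] exI[of _ v]) auto
      next
        case False
        then have lt: "p0 < p" using pp0 by simp
        have "r \<le> p0"
        proof (rule ccontr)
          assume "\<not> r \<le> p0"
          then have "w \<langle>$\<rangle> p0 = p0" using w by (simp add: S_from_def)
          then show False using p0(1) rt \<open>\<not> r \<le> p0\<close> by simp
        qed
        then have "p \<in> crossed w r" using lt p0(1) wp by (auto simp: crossed_def intro!: exI[of _ p0])
        then have "?C t = insert p (?C (t + 1))" "p \<notin> ?C (t + 1)" using split wp by auto
        then have card: "card (?C t) = Suc (card (?C (t + 1)))" by simp
        have d: "desc (inverse v) t" using lt by (simp add: desc_def vt flip: p0_def)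
        let ?v = "adj t * v"
        have inv: "inverse ?v \<langle>$\<rangle> j = inverse v \<langle>$\<rangle> (adj t \<langle>$\<rangle> j)" for j
          by (simp add: perm.inverse_distrib_swap apply_times)
        have "inverse ?v \<langle>$\<rangle> t = p0" unfolding inv by (simp add: adj_apply p0_def)
        moreover have "\<forall>k<p0. w \<langle>$\<rangle> k < t" using below lt by auto
        moreover have "\<forall>j<t. inverse ?v \<langle>$\<rangle> j = inverse w \<langle>$\<rangle> j" using Dv unfolding inv by (simp add: adj_apply)
        moreover have "w = word_perm (D @ [t]) * ?v" using Dv by (simp add: mult.assoc)
        moreover have "perm_length w = length (D @ [t]) + perm_length ?v"
          using lenD perm_length_adj_mult[OF d] by simp
        moreover have "sorted_wrt (>) (D @ [t])" "\<forall>x\<in>set (D @ [t]). t \<le> x"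
          using Dv by (auto simp: sorted_wrt_append)
        moreover have "length (D @ [t]) = card (?C t)" unfolding card using cardD by simp
        moreover have "t \<le> w \<langle>$\<rangle> p0" using p0(1) by simp
        ultimately show ?thesis
          by (intro exI[of _ "D @ [t]"] exI[of _ ?v] conjI) (simp_all only:)
      qed
    qed
  qed
  note all = this
  have "r \<le> n" by (simp add: n_def)
  then obtain D v where Dv: "?P r D v" using all[of r] by blast
  \<comment> \<open>At \<open>t = r\<close> the invariant places the value \<open>r\<close> at the
    first position with original value at least \<open>r\<close>. That position is \<open>r\<close>
    itself, so \<open>v\<close> fixes \<open>r\<close>.\<close>
  define p where "p = inverse v \<langle>$\<rangle> r"
  have p: "r \<le> w \<langle>$\<rangle> p" "\<forall>k<p. w \<langle>$\<rangle> k < r" using Dv by (auto simp: p_def)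
  have "\<not> p < r" using p(1) w by (auto simp: S_from_def)
  moreover have "\<not> r < p" using p(2) S_from_ge[OF w, of r] by force
  ultimately have pr: "p = r" by simp
  have "v \<in> S_from (r + 1)"
    unfolding S_from_def
  proof (clarify)
    fix i assume "i < r + 1"
    then consider "i = r" | "i < r" by linarith
    then have "inverse v \<langle>$\<rangle> i = i"
    proof cases
      case 1
      then show ?thesis using pr by (simp add: p_def)
    next
      case 2
      then have "inverse v \<langle>$\<rangle> i = inverse w \<langle>$\<rangle> i" using Dv by blast
      also have "\<dots> = i" using 2 w by (simp add: S_from_def) (metis apply_inverse_cancel(2))
      finally show ?thesis .
    qed
    then show "v \<langle>$\<rangle> i = i" by (metis apply_inverse_cancel(1))
  qed
  moreover have "?C r = crossed w r" using S_from_ge[OF w] by (auto simp: crossed_def)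
  moreover have "w = word_perm D * v" "perm_length w = length D + perm_length v" "sorted_wrt (>) D"
    "\<forall>x\<in>set D. r \<le> x" "length D = card (?C r)" using Dv by blast+
  ultimately show ?thesis by metis
qed

lemma row_count_append [simp]: "row_count i (s @ s') = row_count i s + row_count i s'"
  by (simp add: row_count_def)

lemma row_count_0: "\<forall>c\<in>set s. fst c \<noteq> i \<Longrightarrow> row_count i s = 0"
  by (auto simp: row_count_def filter_empty_conv)

lemma row_count_row: "row_count i (map (\<lambda>t. (i, t)) D) = length D"
  by (induction D) (auto simp: row_count_def)

text \<open>Rows before \<open>i\<close> are stripped by \<open>strip_row\<close>, which preserves
  the order of the later positions, then row \<open>i\<close> is taken of maximal length, and any
  reduced filling completes it.\<close>

lemma maximal_row_cells:
  assumes "w \<in> S_from r" "r \<le> i" "\<And>k. k < i \<Longrightarrow> w \<langle>$\<rangle> k < w \<langle>$\<rangle> i"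
  shows "\<exists>s. reduced_cells r w s \<and> row_count i s = card (crossed w i)"
  using assms
proof (induction "nat (i - r)" arbitrary: r w)
  case 0
  then have ri: "r = i" by simp
  from strip_maximal_row[OF 0(2)] obtain D v where D: "v \<in> S_from (r + 1)" "w = word_perm D * v"
    "perm_length w = length D + perm_length v" "sorted_wrt (>) D" "\<forall>t\<in>set D. r \<le> t"
    "length D = card (crossed w r)" by blast
  obtain s where s: "reduced_cells (r + 1) v s" using reduced_cells_exist[OF D(1)] by blast
  have "row_count i s = 0" using s ri by (intro row_count_0) (auto simp: reduced_cells_def)
  then have "row_count i (map (\<lambda>t. (r, t)) D @ s) = card (crossed w i)"
    using row_count_row[of i D] D(6) ri by simp
  then show ?case using reduced_cells_row[OF s D(4,5,2,3)] by blast
next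
  case (Suc n)
  then have ri: "r < i" by simp
  from strip_row[OF Suc(3)] obtain D v where D: "v \<in> S_from (r + 1)" "w = word_perm D * v"
    "perm_length w = length D + perm_length v" "sorted_wrt (>) D" "\<forall>t\<in>set D. r \<le> t"
    and ord: "\<And>p q. r < p \<Longrightarrow> r < q \<Longrightarrow> v \<langle>$\<rangle> p < v \<langle>$\<rangle> q \<longleftrightarrow> w \<langle>$\<rangle> p < w \<langle>$\<rangle> q" by blast
  have vi: "v \<langle>$\<rangle> k < v \<langle>$\<rangle> i" if "k < i" for k
  proof (cases "r < k")
    case True
    then show ?thesis using ord ri Suc.prems(3)[OF that] by simp
  next
    case False
    then have "v \<langle>$\<rangle> k = k" using D(1) by (simp add: S_from_def)
    moreover have "r + 1 \<le> v \<langle>$\<rangle> i" by (rule S_from_ge[OF D(1)]) (use ri in simp)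
    ultimately show ?thesis using False by simp
  qed
  \<comment> \<open>As position \<open>i\<close> exceeds all earlier ones, the larger value before
    \<open>q\<close> can be found at a position from \<open>i\<close> on; hence
    \<open>crossed\<close> depends only on an order that \<open>strip_row\<close> preserves.\<close>
  have cr: "q \<in> crossed x i \<longleftrightarrow> i < q \<and> (\<exists>k<q. i \<le> k \<and> x \<langle>$\<rangle> q < x \<langle>$\<rangle> k)"
    if x: "\<And>k. k < i \<Longrightarrow> x \<langle>$\<rangle> k < x \<langle>$\<rangle> i" for x q
  proof
    assume "q \<in> crossed x i"
    then obtain k where k: "i < q" "k < q" "x \<langle>$\<rangle> q < x \<langle>$\<rangle> k" by (auto simp: crossed_def)
    show "i < q \<and> (\<exists>k<q. i \<le> k \<and> x \<langle>$\<rangle> q < x \<langle>$\<rangle> k)"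
    proof (cases "i \<le> k")
      case False
      then have "x \<langle>$\<rangle> q < x \<langle>$\<rangle> i" using x[of k] k by simp
      then show ?thesis using k by auto
    qed (use k in auto)
  qed (auto simp: crossed_def)
  have crv: "q \<in> crossed v i \<longleftrightarrow> i < q \<and> (\<exists>k<q. i \<le> k \<and> v \<langle>$\<rangle> q < v \<langle>$\<rangle> k)" for q
    by (rule cr) (rule vi)
  have crw: "q \<in> crossed w i \<longleftrightarrow> i < q \<and> (\<exists>k<q. i \<le> k \<and> w \<langle>$\<rangle> q < w \<langle>$\<rangle> k)" for q
    by (rule cr) (rule Suc.prems(3))
  have "crossed v i = crossed w i"
  proof (rule set_eqI)
    fix q show "q \<in> crossed v i \<longleftrightarrow> q \<in> crossed w i"
      unfolding crv crw using ord ri by auto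
  qed
  moreover have "n = nat (i - (r + 1))" using Suc(2) by simp
  ultimately obtain s where s: "reduced_cells (r + 1) v s" "row_count i s = card (crossed w i)"
    using Suc(1)[of "r + 1" v] D(1) ri vi by auto
  have "row_count i (map (\<lambda>t. (r, t)) D) = 0" using ri by (intro row_count_0) auto
  then have "row_count i (map (\<lambda>t. (r, t)) D @ s) = card (crossed w i)" using s by simp
  then show ?case using reduced_cells_row[OF s(1) D(4,5,2,3)] by blast
qed

section \<open>Homogeneous parts\<close>

definition tdeg :: "(int \<Rightarrow>\<^sub>0 nat) \<Rightarrow> nat" where
  "tdeg m = (\<Sum>i\<in>keys m. lookup m i)"

lemma tdeg_0 [simp]: "tdeg 0 = 0"
  by (simp add: tdeg_def)

lemma tdeg_add [simp]: "tdeg (m + n) = tdeg m + tdeg n"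
  unfolding tdeg_def by (rule setsum_keys_plus_distrib) auto

lemma tdeg_single [simp]: "tdeg (single i k) = k"
  by (simp add: tdeg_def)

definition row_monomial :: "int list \<Rightarrow> (int \<Rightarrow>\<^sub>0 nat)" where
  "row_monomial b = (\<Sum>j<length b. single (b ! j) 1)"

lemma tdeg_sum: "tdeg (\<Sum>x\<in>A. f x) = (\<Sum>x\<in>A. tdeg (f x))"
  by (induction A rule: infinite_finite_induct) auto

lemma tdeg_row_monomial [simp]: "tdeg (row_monomial b) = length b"
  by (simp add: row_monomial_def tdeg_sum)

lemma lookup_row_monomial: "lookup (row_monomial b) i = (\<Sum>j<length b. if b ! j = i then 1 else 0)"
  unfolding row_monomial_def lookup_sum by (intro sum.cong) (auto simp: lookup_single when_def)

lemma prod_Var: fixes n :: nat shows "(\<Prod>j<n. Var (f j)) = single (\<Sum>j<n. single (f j) 1) (1 :: 'k::comm_ring_1)"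
  by (induction n) (simp_all add: Var_def mult_single add.commute)

lemma minus_Const_power: "(- Const \<beta>) ^ k = Const ((- \<beta>) ^ k)"
  by (simp add: Const_power Const_uminus)

lemma Gp_single:
  "Gp \<beta> (\<lambda>_. 0) w = (\<Sum>(t, b) | t \<in> hecke_words w \<and> compatible t b.
     single (row_monomial b) ((- \<beta>) ^ (length t - perm_length w)))"
  unfolding Gp_def
proof (intro sum.cong refl, clarify)
  fix t b assume "compatible t b"
  then have "length b = length t" by (simp add: compatible_def)
  then show "(- Const \<beta>) ^ (length t - perm_length w) * (\<Prod>i<length t. (Var (b ! i) - Const 0) *
      Const (inverse (1 - \<beta> * 0))) = single (row_monomial b) ((- \<beta>) ^ (length t - perm_length w))"
    by (simp add: prod_Var minus_Const_power row_monomial_def) (simp add: Const_def mult_single)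
qed

lemma lookup_Gp_single:
  "lookup (Gp \<beta> (\<lambda>_. 0) w) m = (\<Sum>(t, b) | t \<in> hecke_words w \<and> compatible t b.
     if row_monomial b = m then (- \<beta>) ^ (length t - perm_length w) else 0)"
  unfolding Gp_single lookup_sum case_prod_beta
  by (intro sum.cong) (auto simp: lookup_single when_def)

definition hom_part :: "nat \<Rightarrow> 'k::comm_ring_1 mpoly \<Rightarrow> 'k mpoly" where
  "hom_part d p = (\<Sum>m\<in>keys p. if tdeg m = d then single m (lookup p m) else 0)"

lemma lookup_hom_part: "lookup (hom_part d p) m = (if tdeg m = d then lookup p m else 0)"
proof -
  have "lookup (hom_part d p) m = (\<Sum>n\<in>keys p. if n = m then (if tdeg m = d then lookup p m else 0) else 0)"
    unfolding hom_part_def lookup_sum by (intro sum.cong) (auto simp: lookup_single when_def)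
  then show ?thesis by (simp add: in_keys_iff)
qed

lemma hom_part_add: "hom_part d (p + q) = hom_part d p + hom_part d q"
  by (rule poly_mapping_eqI) (simp add: lookup_hom_part lookup_add)

lemma hom_part_Const_mult: "hom_part d (Const c * p) = Const c * hom_part d p"
  by (rule poly_mapping_eqI) (simp add: lookup_hom_part)

lemma hom_part_sum: "hom_part d (\<Sum>x\<in>A. f x) = (\<Sum>x\<in>A. hom_part d (f x))"
  by (rule poly_mapping_eqI) (simp add: lookup_hom_part lookup_sum)

definition order_ge :: "nat \<Rightarrow> 'k::comm_ring_1 mpoly \<Rightarrow> bool" where
  "order_ge d p \<longleftrightarrow> (\<forall>m\<in>keys p. d \<le> tdeg m)"

lemma order_ge_mult: "order_ge d p \<Longrightarrow> order_ge e q \<Longrightarrow> order_ge (d + e) (p * q)"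
  using keys_mult[of p q] by (fastforce simp: order_ge_def intro: add_mono)

lemma hom_part_low: "order_ge e p \<Longrightarrow> d < e \<Longrightarrow> hom_part d p = 0"
  by (rule poly_mapping_eqI) (force simp: lookup_hom_part order_ge_def in_keys_iff)

lemma order_ge_hom_part: "order_ge d (hom_part d p)"
  by (auto simp: order_ge_def in_keys_iff lookup_hom_part split: if_splits)

lemma order_ge_rest: "order_ge d p \<Longrightarrow> order_ge (Suc d) (p - hom_part d p)"
  by (force simp: order_ge_def in_keys_iff lookup_minus lookup_hom_part Suc_le_eq split: if_splits)

text \<open>All that remains besides the two lowest parts has higher order and cannot reach degree
  \<open>d + e\<close>.\<close>

lemma hom_part_mult:
  assumes "order_ge d p" "order_ge e q"
  shows "hom_part (d + e) (p * q) = hom_part d p * hom_part e q"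
proof -
  let ?p = "hom_part d p" and ?q = "hom_part e q"
  have "p * q = ?p * ?q + (?p * (q - ?q) + (p - ?p) * q)" by (simp add: algebra_simps)
  then have "hom_part (d + e) (p * q) = hom_part (d + e) (?p * ?q) +
      (hom_part (d + e) (?p * (q - ?q)) + hom_part (d + e) ((p - ?p) * q))"
    by (metis hom_part_add)
  moreover have "hom_part (d + e) (?p * (q - ?q)) = 0"
    using order_ge_mult[OF order_ge_hom_part order_ge_rest[OF assms(2)]]
    by (rule hom_part_low) simp
  moreover have "hom_part (d + e) ((p - ?p) * q) = 0"
    using order_ge_mult[OF order_ge_rest[OF assms(1)] assms(2)] by (rule hom_part_low) simp
  moreover have "hom_part (d + e) (?p * ?q) = ?p * ?q"
  proof (rule poly_mapping_eqI)
    fix m show "lookup (hom_part (d + e) (?p * ?q)) m = lookup (?p * ?q) m"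
    proof (cases "m \<in> keys (?p * ?q)")
      case True
      then obtain a b where "m = a + b" "a \<in> keys ?p" "b \<in> keys ?q"
        using keys_mult[of ?p ?q] by blast
      then show ?thesis by (auto simp: lookup_hom_part in_keys_iff split: if_splits)
    qed (simp add: lookup_hom_part in_keys_iff)
  qed
  ultimately show ?thesis by simp
qed

lemma hecke_word_length: "t \<in> hecke_words w \<Longrightarrow> perm_length w \<le> length t"
  using perm_length_hprod_le[of t] by (simp add: hecke_words_eq)

lemma order_ge_Gp: "order_ge (perm_length w) (Gp \<beta> (\<lambda>_. 0) w)"
  unfolding order_ge_def
proof
  fix m assume "m \<in> keys (Gp \<beta> (\<lambda>_. 0) w)"
  then have "(\<Sum>(t, b) | t \<in> hecke_words w \<and> compatible t b.
     if row_monomial b = m then (- \<beta>) ^ (length t - perm_length w) else 0) \<noteq> 0"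
    by (simp add: in_keys_iff lookup_Gp_single)
  then obtain t b where "t \<in> hecke_words w" "compatible t b" "row_monomial b = m"
    by (auto elim!: sum.not_neutral_contains_not_neutral split: if_splits)
  then show "perm_length w \<le> tdeg m"
    using hecke_word_length[of t w] by (auto simp: compatible_def)
qed

text \<open>At \<open>y = 0\<close> a word contributes in the degree given by its length, and Hecke
  words of minimal length are the reduced words, where no power of \<open>\<beta>\<close> is
  left.\<close>

lemma hom_part_Gp:
  fixes \<beta> :: "'k::field"
  shows "hom_part (perm_length w) (Gp \<beta> (\<lambda>_. 0) w) = Gp 0 (\<lambda>_. 0) w"
proof (rule poly_mapping_eqI)
  fix m
  show "lookup (hom_part (perm_length w) (Gp \<beta> (\<lambda>_. 0) w)) m = lookup (Gp 0 (\<lambda>_. 0) w) m"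
  proof (cases "tdeg m = perm_length w")
    case True
    then show ?thesis
      unfolding lookup_hom_part lookup_Gp_single
      by (auto simp: compatible_def intro!: sum.cong)
  next
    case False
    have "lookup (Gp 0 (\<lambda>_. 0 :: 'k) w) m = 0"
      unfolding lookup_Gp_single
    proof (intro sum.neutral, clarify)
      fix t b assume t: "t \<in> hecke_words w" "compatible t b"
      show "(if row_monomial b = m then (- 0 :: 'k) ^ (length t - perm_length w) else 0) = 0"
      proof (cases "row_monomial b = m")
        case True
        then have "tdeg m = length t" using t by (auto simp: compatible_def)
        then have "length t - perm_length w \<noteq> 0" using False hecke_word_length[OF t(1)] by simp
        then show ?thesis by simp
      qed simp
    qed
    then show ?thesis using False by (simp add: lookup_hom_part)
  qed
qed

lemma hom_part_Gp_low: "d < perm_length w \<Longrightarrow> hom_part d (Gp \<beta> (\<lambda>_. 0) w) = 0"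
  by (rule hom_part_low[OF order_ge_Gp])

lemma admissible_0 [simp]: "admissible \<beta> (\<lambda>_. 0)" "admissible 0 y"
  by (simp_all add: admissible_def)

text \<open>For \<open>\<beta> = 1\<close> compare the parts of lowest degree on both sides of the expansion.\<close>

lemma schubert_const_eq:
  fixes \<beta> :: "'k::field"
  assumes "u \<in> S_pos" "v \<in> S_pos"
  shows "structure_const (Gp 0 (\<lambda>_. 0)) u v w = (if perm_length w = perm_length u + perm_length v
    then structure_const (Gp \<beta> (\<lambda>_. 0)) u v w else 0)"
proof -
  let ?G = "Gp \<beta> (\<lambda>_. 0 :: 'k)" and ?S = "Gp 0 (\<lambda>_. 0 :: 'k)"
  let ?d = "perm_length u + perm_length v"
  obtain c where c: "expands \<beta> (\<lambda>_. 0) (?G u * ?G v) c" "lookup c = structure_const ?G u v"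
    using structure_const_expands[OF admissible_0(1) assms] by metis
  have f: "?G u * ?G v = (\<Sum>w\<in>keys c. Const (lookup c w) * ?G w)" and pos: "keys c \<subseteq> S_pos"
    using c(1) by (auto simp: expands_def)
  have part: "hom_part e (?G u * ?G v) = (\<Sum>w\<in>{w \<in> keys c. perm_length w = e}. Const (lookup c w) * ?S w)"
    if "\<And>w. w \<in> keys c \<Longrightarrow> e \<le> perm_length w" for e
  proof -
    have "hom_part e (?G u * ?G v) = (\<Sum>w\<in>keys c. Const (lookup c w) * hom_part e (?G w))"
      unfolding f by (simp add: hom_part_sum hom_part_Const_mult)
    also have "\<dots> = (\<Sum>w\<in>keys c. if perm_length w = e then Const (lookup c w) * ?S w else 0)"
    proof (intro sum.cong refl)
      fix w assume w: "w \<in> keys c"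
      show "Const (lookup c w) * hom_part e (?G w) = (if perm_length w = e then Const (lookup c w) * ?S w else 0)"
        using hom_part_Gp[of w \<beta>] hom_part_Gp_low[of e w \<beta>] that[OF w] by (cases "perm_length w = e") auto
    qed
    also have "\<dots> = (\<Sum>w\<in>{w \<in> keys c. perm_length w = e}. Const (lookup c w) * ?S w)"
      by (rule sum.inter_filter[symmetric]) simp
    finally show ?thesis .
  qed
  have low: "?d \<le> perm_length w" if w: "w \<in> keys c" for w
  proof (rule ccontr)
    assume nle: "\<not> ?d \<le> perm_length w"
    \<comment> \<open>Were the least length in the support too small, the part of that degree would
      be a vanishing combination of Schubert polynomials, contradicting independence.\<close>
    define e where "e = Min (perm_length ` keys c)"
    have e: "e \<in> perm_length ` keys c" unfolding e_def by (rule Min_in) (use w in auto)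
    have emin: "e \<le> perm_length x" if "x \<in> keys c" for x using that by (simp add: e_def)
    have "e < ?d" using emin[OF w] nle by simp
    then have "hom_part e (?G u * ?G v) = 0"
      by (rule hom_part_low[OF order_ge_mult[OF order_ge_Gp order_ge_Gp]])
    then have z: "(\<Sum>w\<in>{w \<in> keys c. perm_length w = e}. Const (lookup c w) * ?S w) = 0"
      using part[OF emin] by simp
    obtain x where x: "x \<in> keys c" "perm_length x = e" using e by auto
    have "lookup c x = 0"
      by (rule Gp_independent[OF admissible_0(1) _ _ z]) (use pos x in auto)
    then show False using x by (simp add: in_keys_iff)
  qed
  define c' where "c' = Abs_poly_mapping (\<lambda>w. if perm_length w = ?d then lookup c w else 0)"
  have c': "lookup c' w = (if perm_length w = ?d then lookup c w else 0)" for w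
    unfolding c'_def
    by (subst lookup_Abs_poly_mapping)
      (auto intro: finite_subset[OF _ finite_keys[of c]] simp: in_keys_iff split: if_splits)
  have k': "keys c' = {w \<in> keys c. perm_length w = ?d}" by (auto simp: in_keys_iff c' split: if_splits)
  have "?S u * ?S v = hom_part ?d (?G u * ?G v)"
    by (simp add: hom_part_mult[OF order_ge_Gp order_ge_Gp] hom_part_Gp)
  also have "\<dots> = (\<Sum>w\<in>{w \<in> keys c. perm_length w = ?d}. Const (lookup c w) * ?S w)"
    by (rule part) (rule low)
  also have "\<dots> = (\<Sum>w\<in>keys c'. Const (lookup c' w) * ?S w)"
    unfolding k' by (intro sum.cong) (auto simp: c')
  finally have "expands 0 (\<lambda>_. 0) (?S u * ?S v) c'" using pos k' by (auto simp: expands_def)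
  from structure_const_eq[OF admissible_0(1) this] show ?thesis by (simp add: c' c(2))
qed

section \<open>Products of Schubert polynomials leaving a space of bounded exponents\<close>

text \<open>Only reduced words survive, each with coefficient 1, so the coefficients count pipe
  dreams. Hence nothing cancels in products.\<close>

lemma lookup_Gp_nonneg: "lookup (Gp 0 (\<lambda>_. 0 :: rat) w) m \<ge> 0"
  unfolding lookup_Gp_single by (intro sum_nonneg) (auto simp: zero_power_eq when_def)

lemma maximal_row_monomial:
  assumes "w \<in> S_pos" "1 \<le> i" "\<And>k. k < i \<Longrightarrow> w \<langle>$\<rangle> k < w \<langle>$\<rangle> i"
  obtains m where "lookup (Gp 0 (\<lambda>_. 0 :: rat) w) m > 0" "lookup m i = card (crossed w i)"
proof -
  obtain s where s: "reduced_cells 1 w s" "row_count i s = card (crossed w i)"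
    using maximal_row_cells[of w 1 i] assms by (auto simp: S_pos_eq_S_from)
  define t b where "t = map snd s" and "b = map fst s"
  have zip: "zip b t = s" by (simp add: t_def b_def zip_map_fst_snd)
  have comp: "compatible t b" using s(1) by (auto simp: compatible_iff zip reduced_cells_def) (simp add: t_def b_def)
  have hp: "hprod t = w"
    by (rule hprod_reduced_word) (use s(1) in \<open>auto simp: reduced_cells_def word_perm_def t_def\<close>)
  have len: "length t = perm_length w" "length b = length t" using s(1) by (auto simp: reduced_cells_def t_def b_def)
  have "0 < (\<Sum>(t', b') | t' \<in> hecke_words w \<and> compatible t' b'.
     if row_monomial b' = row_monomial b then (- 0 :: rat) ^ (length t' - perm_length w) else 0)"
    by (rule sum_pos2[of _ "(t, b)"]) (use comp hp len finite_pipe_dreams[of w] in \<open>auto simp: hecke_words_eq zero_power_eq when_def\<close>)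
  moreover have "lookup (row_monomial b) i = card (crossed w i)"
    using row_count_zip[OF len(2), of i] s(2) len by (simp add: lookup_row_monomial zip)
  ultimately show thesis using that[of "row_monomial b"] by (simp add: lookup_Gp_single)
qed

lemma lookup_mult_pos:
  fixes p q :: "rat mpoly"
  assumes "\<And>m. lookup p m \<ge> 0" "\<And>m. lookup q m \<ge> 0" "lookup p a > 0" "lookup q b > 0"
  shows "lookup (p * q) (a + b) > 0"
proof -
  have eq: "lookup (p * q) (a + b) = (\<Sum>m\<in>keys p. \<Sum>n\<in>keys q.
      (lookup p m * lookup q n when m + n = a + b))"
    unfolding mult_monomials[of p q] by (simp add: lookup_sum lookup_single)
  have ab: "a \<in> keys p" "b \<in> keys q" using assms by (auto simp: in_keys_iff)
  have "0 < (\<Sum>n\<in>keys q. (lookup p a * lookup q n when a + n = a + b))"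
    by (rule sum_pos2[of _ b]) (use ab assms in \<open>auto simp: when_def\<close>)
  then have "0 < (\<Sum>m\<in>keys p. \<Sum>n\<in>keys q. (lookup p m * lookup q n when m + n = a + b))"
    by (rule sum_pos2[of _ a, rotated 2]) (use ab assms in \<open>auto simp: when_def intro!: sum_nonneg\<close>)
  then show ?thesis by (simp add: eq)
qed

lemma Vn_sum: "(\<And>x. x \<in> A \<Longrightarrow> f x \<in> Vn n) \<Longrightarrow> (\<Sum>x\<in>A. f x) \<in> Vn n"
  by (auto simp: Vn_def intro: deg_le_sum)

lemma Vn_Const_mult: "p \<in> Vn n \<Longrightarrow> Const c * p \<in> Vn n"
  using deg_le_mult[OF deg_le_Const] by (fastforce simp: Vn_def)

text \<open>By positivity the product of two monomials of extremal degree in x_i survives and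
  exceeds the staircase for \<open>n\<close>. A combination of polynomials indexed by
  \<open>Sn n\<close> could not contain it.\<close>

lemma schubert_const_outside:
  assumes "u \<in> S_pos" "v \<in> S_pos" "1 \<le> i"
    and "\<And>k. k < i \<Longrightarrow> u \<langle>$\<rangle> k < u \<langle>$\<rangle> i" "\<And>k. k < i \<Longrightarrow> v \<langle>$\<rangle> k < v \<langle>$\<rangle> i"
    and "nat (int n - i) < card (crossed u i) + card (crossed v i)"
  obtains w where "w \<in> S_pos" "w \<notin> Sn n" "structure_const (Gp 0 (\<lambda>_. 0 :: rat)) u v w \<noteq> 0"
proof -
  let ?S = "Gp 0 (\<lambda>_. 0 :: rat)"
  obtain a b where a: "lookup (?S u) a > 0" "lookup a i = card (crossed u i)"
    and b: "lookup (?S v) b > 0" "lookup b i = card (crossed v i)"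
    using maximal_row_monomial assms by metis
  have "lookup (?S u * ?S v) (a + b) > 0"
    using lookup_mult_pos lookup_Gp_nonneg a b by blast
  then have "a + b \<in> keys (?S u * ?S v)" by (simp add: in_keys_iff)
  moreover have "\<not> lookup (a + b) i \<le> stair_exp n i"
    using assms(3,6) a b by (simp add: lookup_add stair_exp_def)
  ultimately have out: "?S u * ?S v \<notin> Vn n" by (auto simp: Vn_def deg_le_def)
  obtain c where c: "expands 0 (\<lambda>_. 0) (?S u * ?S v) c" "lookup c = structure_const ?S u v"
    using structure_const_expands[OF admissible_0(1) assms(1,2)] by metis
  have "\<not> keys c \<subseteq> Sn n"
  proof
    assume "keys c \<subseteq> Sn n"
    then have "(\<Sum>w\<in>keys c. Const (lookup c w) * ?S w) \<in> Vn n"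
      by (intro Vn_sum Vn_Const_mult Gp_Vn) auto
    then show False using out c by (simp add: expands_def)
  qed
  then obtain w where "w \<in> keys c" "w \<notin> Sn n" by blast
  then show thesis using that[of w] c by (auto simp: expands_def in_keys_iff)
qed

section \<open>Localization\<close>

definition psi :: "'k::field \<Rightarrow> (int \<Rightarrow> 'k) \<Rightarrow> int perm \<Rightarrow> int perm \<Rightarrow> 'k" where
  "psi \<beta> y z w = gsum \<beta> (\<lambda>i. y (z \<langle>$\<rangle> i)) y w"

lemma psi_1: "admissible \<beta> y \<Longrightarrow> psi \<beta> y 1 w = unit_fun w"
  by (simp add: psi_def gsum_diagonal)

text \<open>With \<open>psi_1\<close> this determines all localizations by recursion on the length
  of \<open>z\<close>, in terms of descents and right multiplication; that is why symmetries of the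
  Coxeter group transport them.\<close>

lemma psi_step:
  assumes "admissible \<beta> y" "b \<ge> 1"
  shows "psi \<beta> y (z * adj b) w =
    tstep \<beta> (b, om \<beta> (y (z \<langle>$\<rangle> (b + 1))) (y (z \<langle>$\<rangle> b))) (psi \<beta> y z) w"
proof -
  have "gsum \<beta> (\<lambda>i. y ((z * adj b) \<langle>$\<rangle> i)) y w =
    tstep \<beta> (b, om \<beta> (y ((z * adj b) \<langle>$\<rangle> b)) (y ((z * adj b) \<langle>$\<rangle> (b + 1))))
      (gsum \<beta> (\<lambda>i. y ((z * adj b) \<langle>$\<rangle> (adj b \<langle>$\<rangle> i))) y) w"
    by (rule gsum_swap) (use assms in \<open>auto simp: admissible_def\<close>)
  moreover have "(z * adj b) \<langle>$\<rangle> (adj b \<langle>$\<rangle> i) = z \<langle>$\<rangle> i" for i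
    by (simp add: apply_times adj_apply)
  moreover have "(z * adj b) \<langle>$\<rangle> b = z \<langle>$\<rangle> (b + 1)" "(z * adj b) \<langle>$\<rangle> (b + 1) = z \<langle>$\<rangle> b"
    by (simp_all add: apply_times adj_apply)
  ultimately show ?thesis by (simp add: psi_def[abs_def])
qed

lemma psi_expansion:
  assumes adm: "admissible \<beta> y" and c: "expands \<beta> y (Gp \<beta> y u * Gp \<beta> y v) c"
  shows "psi \<beta> y z u * psi \<beta> y z v = (\<Sum>w\<in>keys c. lookup c w * psi \<beta> y z w)"
proof -
  interpret m: partial_hom UNIV "msubst (\<lambda>x. x) (\<lambda>i. y (z \<langle>$\<rangle> i))"
    using partial_hom.partial_hom_msubst[OF partial_hom_id] by simp
  have G: "msubst (\<lambda>x. x) (\<lambda>i. y (z \<langle>$\<rangle> i)) (Gp \<beta> y w) = psi \<beta> y z w" for w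
    using msubst_Gp[OF partial_hom_id, of \<beta> y "\<lambda>i. y (z \<langle>$\<rangle> i)" w] adm by (simp add: psi_def)
  have "msubst (\<lambda>x. x) (\<lambda>i. y (z \<langle>$\<rangle> i)) (Gp \<beta> y u * Gp \<beta> y v) =
      msubst (\<lambda>x. x) (\<lambda>i. y (z \<langle>$\<rangle> i)) (\<Sum>w\<in>keys c. Const (lookup c w) * Gp \<beta> y w)"
    using c by (simp add: expands_def)
  then show ?thesis
    by (simp add: m.hom_mult m.hom_sum G partial_hom.msubst_Const[OF partial_hom_id])
qed

text \<open>A standard parabolic subgroup, described through the generators that occur as descents
  of its elements, as these are the ones used by the recursion.\<close>

definition parabolic :: "int perm set \<Rightarrow> bool" where
  "parabolic A \<longleftrightarrow> A \<subseteq> S_pos \<and> 1 \<in> A \<and> (\<forall>z\<in>A. \<forall>b. desc z b \<longrightarrow> (\<forall>w\<in>A. w * adj b \<in> A))"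

lemma parabolic_closed:
  "parabolic A \<Longrightarrow> z \<in> A \<Longrightarrow> desc z b \<Longrightarrow> w \<in> A \<Longrightarrow> w * adj b \<in> A"
  unfolding parabolic_def by blast

lemma parabolic_desc_pos: "parabolic A \<Longrightarrow> z \<in> A \<Longrightarrow> desc z b \<Longrightarrow> b \<ge> 1"
  unfolding parabolic_def using desc_S_pos by blast

lemma psi_support:
  assumes adm: "admissible \<beta> y" and A: "parabolic A" and z: "z \<in> A" and nz: "psi \<beta> y z w \<noteq> 0"
  shows "w \<in> A"
  using z nz
proof (induction "perm_length z" arbitrary: z w)
  case 0
  then show ?case using A by (simp add: psi_1[OF adm] unit_fun_def parabolic_def split: if_splits)
next
  case (Suc n)
  then have "z \<noteq> 1" by auto
  then obtain b where b: "desc z b" using exists_desc by blast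
  have b1: "b \<ge> 1" by (rule parabolic_desc_pos[OF A Suc.prems(1) b])
  let ?z = "z * adj b"
  have zA: "?z \<in> A" by (rule parabolic_closed[OF A Suc.prems(1) b Suc.prems(1)])
  have n: "n = perm_length ?z" using Suc(2) perm_length_desc[OF b] by simp
  have "psi \<beta> y ?z w \<noteq> 0 \<or> psi \<beta> y ?z (w * adj b) \<noteq> 0"
    using Suc.prems(2) psi_step[OF adm b1, of ?z w] by (auto simp: tstep_def split: if_splits)
  then have "w \<in> A \<or> w * adj b \<in> A" using Suc.hyps(1)[OF n zA] by blast
  moreover have "w \<in> A" if "w * adj b \<in> A"
    using parabolic_closed[OF A Suc.prems(1) b that] by simp
  ultimately show ?case by blast
qed

lemma om_eq_0_iff: "admissible \<beta> y \<Longrightarrow> om \<beta> x (y i) = 0 \<longleftrightarrow> x = y i"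
  by (simp add: om_def admissible_def)

text \<open>The recursion adds at most one to the length of the index. On the diagonal it multiplies
  by a formal difference of two distinct values of \<open>y\<close>, nonzero by injectivity.\<close>

lemma psi_triangular:
  assumes adm: "admissible \<beta> y" and inj: "inj y" and z: "z \<in> S_pos"
  shows "psi \<beta> y z w \<noteq> 0 \<Longrightarrow> w = z \<or> perm_length w < perm_length z" and "psi \<beta> y z z \<noteq> 0"
proof -
  have "(\<forall>w. psi \<beta> y z w \<noteq> 0 \<longrightarrow> w = z \<or> perm_length w < perm_length z) \<and> psi \<beta> y z z \<noteq> 0"
    using z
  proof (induction "perm_length z" arbitrary: z)
    case 0
    then show ?case by (simp add: psi_1[OF adm] unit_fun_def)
  next
    case (Suc n)
    then have "z \<noteq> 1" by auto
    then obtain b where b: "desc z b" using exists_desc by blast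
    have b1: "b \<ge> 1" by (rule desc_S_pos[OF Suc.prems b])
    let ?z = "z * adj b"
    have lz: "perm_length z = Suc (perm_length ?z)" by (rule perm_length_desc[OF b])
    then have IH: "\<And>w. psi \<beta> y ?z w \<noteq> 0 \<Longrightarrow> w = ?z \<or> perm_length w < perm_length ?z"
        "psi \<beta> y ?z ?z \<noteq> 0"
      using Suc S_pos_mult_adj[OF Suc.prems b1] by auto
    let ?a = "om \<beta> (y (?z \<langle>$\<rangle> (b + 1))) (y (?z \<langle>$\<rangle> b))"
    have step: "psi \<beta> y z w = (if desc w b then (1 - \<beta> * ?a) * psi \<beta> y ?z w + ?a * psi \<beta> y ?z (w * adj b)
        else psi \<beta> y ?z w)" for w
      using psi_step[OF adm b1, of ?z w] by (simp add: tstep_def)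
    have "w = z \<or> perm_length w < perm_length z" if nz: "psi \<beta> y z w \<noteq> 0" for w
    proof (cases "psi \<beta> y ?z w \<noteq> 0")
      case True
      then show ?thesis using IH(1)[of w] lz by auto
    next
      case False
      then have d: "desc w b" and "psi \<beta> y ?z (w * adj b) \<noteq> 0"
        using nz unfolding step[of w] by (auto split: if_splits)
      then have "w * adj b = ?z \<or> perm_length (w * adj b) < perm_length ?z" using IH(1) by blast
      moreover have "w = z" if "w * adj b = ?z" using that mult_adj_adj by metis
      ultimately show ?thesis using lz perm_length_desc[OF d] by auto
    qed
    moreover have "psi \<beta> y ?z z = 0" using IH(1)[of z] lz by auto
    moreover have "?a \<noteq> 0"
      using om_eq_0_iff[OF adm] inj by (auto simp: inj_eq perm_apply_eq_iff)
    ultimately show ?case using step[of z] b IH(2) by auto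
  qed
  then show "psi \<beta> y z w \<noteq> 0 \<Longrightarrow> w = z \<or> perm_length w < perm_length z" "psi \<beta> y z z \<noteq> 0" by auto
qed

text \<open>Evaluate at the index \<open>w\<close> itself: longer indices vanish there, as do other
  indices of equal length, and the shorter ones have coefficient 0 by induction.\<close>

lemma psi_independent:
  assumes adm: "admissible \<beta> y" and inj: "inj y" and W: "finite W" "W \<subseteq> S_pos"
    and zero: "\<And>z. z \<in> W \<Longrightarrow> (\<Sum>w\<in>W. d w * psi \<beta> y z w) = 0" and w: "w \<in> W"
  shows "d w = 0"
  using w
proof (induction "perm_length w" arbitrary: w rule: less_induct)
  case less
  have wS: "w \<in> S_pos" using less.prems W by blast
  have "(\<Sum>v\<in>W. d v * psi \<beta> y w v) = (\<Sum>v\<in>W. if v = w then d w * psi \<beta> y w w else 0)"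
  proof (intro sum.cong refl)
    fix v assume v: "v \<in> W"
    show "d v * psi \<beta> y w v = (if v = w then d w * psi \<beta> y w w else 0)"
      using psi_triangular(1)[OF adm inj wS, of v] less.hyps[OF _ v] by auto
  qed
  then have "d w * psi \<beta> y w w = 0" using zero[OF less.prems] W less.prems by simp
  then show ?case using psi_triangular(2)[OF adm inj wS] by simp
qed

text \<open>A symmetry of the Coxeter group that is compatible with the parameters preserves the
  localizations, hence the structure constants.\<close>

locale symmetry =
  fixes \<beta> :: "'k::field" and y y' :: "int \<Rightarrow> 'k" and T :: "int perm \<Rightarrow> int perm"
    and g :: "int \<Rightarrow> int" and A A' :: "int perm set" and B :: "int set"
  assumes adm: "admissible \<beta> y" and adm': "admissible \<beta> y'" and inj: "inj y"
    and A: "parabolic A" and A': "parabolic A'" and T: "bij_betw T A A'"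
    and letters: "\<And>z b. z \<in> A \<Longrightarrow> desc z b \<Longrightarrow> b \<in> B"
    and B_pos: "\<And>b. b \<in> B \<Longrightarrow> g b \<ge> 1"
    and T_eq_1: "\<And>w. T w = 1 \<longleftrightarrow> w = 1"
    and T_adj: "\<And>w b. b \<in> B \<Longrightarrow> T (w * adj b) = T w * adj (g b)"
    and T_desc: "\<And>w b. b \<in> B \<Longrightarrow> desc (T w) (g b) \<longleftrightarrow> desc w b"
    and T_om: "\<And>z b. z \<in> A \<Longrightarrow> b \<in> B \<Longrightarrow>
      om \<beta> (y' (T z \<langle>$\<rangle> (g b + 1))) (y' (T z \<langle>$\<rangle> (g b))) = om \<beta> (y (z \<langle>$\<rangle> (b + 1))) (y (z \<langle>$\<rangle> b))"
begin

lemma A_pos: "A \<subseteq> S_pos" and A'_pos: "A' \<subseteq> S_pos"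
  using A A' by (auto simp: parabolic_def)

lemma psi_symmetry: "z \<in> A \<Longrightarrow> psi \<beta> y' (T z) (T w) = psi \<beta> y z w"
proof (induction "perm_length z" arbitrary: z w)
  case 0
  then have z: "z = 1" by simp
  have T1: "T 1 = 1" by (simp add: T_eq_1)
  show ?case unfolding z T1 psi_1[OF adm] psi_1[OF adm'] by (simp add: unit_fun_def T_eq_1)
next
  case (Suc n)
  then have "z \<noteq> 1" by auto
  then obtain b where b: "desc z b" using exists_desc by blast
  have bB: "b \<in> B" by (rule letters[OF Suc.prems b])
  have b1: "b \<ge> 1" by (rule parabolic_desc_pos[OF A Suc.prems b])
  let ?z = "z * adj b"
  have zA: "?z \<in> A" by (rule parabolic_closed[OF A Suc.prems b Suc.prems])
  have n: "n = perm_length ?z" using Suc(2) perm_length_desc[OF b] by simp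
  have IH: "psi \<beta> y' (T ?z) (T w) = psi \<beta> y ?z w" for w by (rule Suc.hyps(1)[OF n zA])
  have Tz: "T z = T ?z * adj (g b)" using T_adj[OF bB, of ?z] by simp
  have "psi \<beta> y' (T z) (T w) = tstep \<beta> (g b, om \<beta> (y (?z \<langle>$\<rangle> (b + 1))) (y (?z \<langle>$\<rangle> b))) (psi \<beta> y' (T ?z)) (T w)"
    unfolding Tz psi_step[OF adm' B_pos[OF bB]] T_om[OF zA bB] ..
  also have "\<dots> = tstep \<beta> (b, om \<beta> (y (?z \<langle>$\<rangle> (b + 1))) (y (?z \<langle>$\<rangle> b))) (psi \<beta> y ?z) w"
    using IH[of w] IH[of "w * adj b"] by (simp add: tstep_def T_desc[OF bB] T_adj[OF bB])
  also have "\<dots> = psi \<beta> y z w" using psi_step[OF adm b1, of ?z w] by simp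
  finally show ?case .
qed

text \<open>At points of \<open>A\<close> only indices in \<open>A\<close> contribute, by
  \<open>psi_support\<close>, and on these \<open>T\<close> preserves the localizations. So the
  differences of corresponding constants form a relation, which \<open>psi_independent\<close> makes
  trivial.\<close>

theorem structure_const_symmetry:
  assumes u: "u \<in> A" and v: "v \<in> A" and w: "w \<in> A"
  shows "structure_const (Gp \<beta> y') (T u) (T v) (T w) = structure_const (Gp \<beta> y) u v w"
proof -
  have TA: "T x \<in> A'" if "x \<in> A" for x using T that by (auto simp: bij_betw_def)
  have injT: "inj_on T A" using T by (auto simp: bij_betw_def)
  obtain c where c: "expands \<beta> y (Gp \<beta> y u * Gp \<beta> y v) c" "lookup c = structure_const (Gp \<beta> y) u v"
    using structure_const_expands[OF adm, of u v] u v A_pos by (metis subsetD)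
  obtain d where d: "expands \<beta> y' (Gp \<beta> y' (T u) * Gp \<beta> y' (T v)) d"
      "lookup d = structure_const (Gp \<beta> y') (T u) (T v)"
    using structure_const_expands[OF adm', of "T u" "T v"] TA u v A'_pos by (metis subsetD)
  \<comment> \<open>Contains what matters of both supports, and also \<open>w\<close>, so that the
    relation speaks about \<open>w\<close> even when both constants vanish.\<close>
  define W where "W = (keys c \<inter> A) \<union> {x \<in> A. T x \<in> keys d} \<union> {w}"
  have "finite (T ` {x \<in> A. T x \<in> keys d})" by (rule finite_subset[of _ "keys d"]) auto
  then have "finite {x \<in> A. T x \<in> keys d}"
    by (rule finite_imageD) (rule inj_on_subset[OF injT], auto)
  then have fin: "finite W" by (simp add: W_def)
  have WA: "W \<subseteq> A" using w by (auto simp: W_def)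
  have zero: "(\<Sum>x\<in>W. (lookup c x - lookup d (T x)) * psi \<beta> y z x) = 0" if z: "z \<in> W" for z
  proof -
    have zA: "z \<in> A" using z WA by blast
    have "(\<Sum>x\<in>W. lookup c x * psi \<beta> y z x) = (\<Sum>x\<in>keys c. lookup c x * psi \<beta> y z x)"
    proof (rule sum.mono_neutral_cong)
      fix x assume "x \<in> keys c - W"
      then have "x \<notin> A" by (auto simp: W_def)
      then show "lookup c x * psi \<beta> y z x = 0" using psi_support[OF adm A zA] by auto
    qed (use fin in \<open>auto simp: in_keys_iff\<close>)
    also have "\<dots> = psi \<beta> y z u * psi \<beta> y z v" using psi_expansion[OF adm c(1)] by simp
    also have "\<dots> = psi \<beta> y' (T z) (T u) * psi \<beta> y' (T z) (T v)" by (simp add: psi_symmetry[OF zA])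
    also have "\<dots> = (\<Sum>x\<in>keys d. lookup d x * psi \<beta> y' (T z) x)" by (rule psi_expansion[OF adm' d(1)])
    also have "\<dots> = (\<Sum>x\<in>T ` W. lookup d x * psi \<beta> y' (T z) x)"
    proof (rule sum.mono_neutral_cong)
      fix x assume x: "x \<in> keys d - T ` W"
      have "x \<notin> A'"
      proof
        assume "x \<in> A'"
        then obtain x' where "x' \<in> A" "x = T x'" using T by (auto simp: bij_betw_def)
        then show False using x by (auto simp: W_def)
      qed
      then show "lookup d x * psi \<beta> y' (T z) x = 0" using psi_support[OF adm' A' TA[OF zA]] by auto
    qed (use fin in \<open>auto simp: in_keys_iff\<close>)
    also have "\<dots> = (\<Sum>x\<in>W. lookup d (T x) * psi \<beta> y z x)"
      by (simp add: sum.reindex[OF inj_on_subset[OF injT WA]] psi_symmetry[OF zA])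
    finally show ?thesis by (simp add: left_diff_distrib sum_subtractf)
  qed
  have "lookup c w - lookup d (T w) = 0"
    by (rule psi_independent[OF adm inj fin _ zero]) (use WA A_pos in \<open>auto simp: W_def\<close>)
  then show ?thesis by (simp add: c(2) d(2))
qed

end

section \<open>Shifts and reflections of the integers\<close>

lemma shift_perm_apply: "shift_perm k w \<langle>$\<rangle> i = w \<langle>$\<rangle> (i - k) + k"
  by (simp add: shift_perm.rep_eq)

lift_definition flip_perm :: "int \<Rightarrow> int perm \<Rightarrow> int perm"
  is "\<lambda>c w i. c - w (c - i)"
proof (intro conjI)
  fix c :: int and w :: "int \<Rightarrow> int"
  assume w: "bij w \<and> finite {a. w a \<noteq> a}"
  have f: "bij (\<lambda>i. c - i)" by (rule bij_betw_byWitness[where f' = "\<lambda>i. c - i"]) auto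
  have "bij ((\<lambda>i. c - i) \<circ> w \<circ> (\<lambda>i. c - i))"
    by (intro bij_comp f) (use w in simp)
  then show "bij (\<lambda>i. c - w (c - i))" by (simp add: comp_def)
  have "{a. c - w (c - a) \<noteq> a} \<subseteq> (\<lambda>i. c - i) ` {a. w a \<noteq> a}"
  proof
    fix a assume "a \<in> {a. c - w (c - a) \<noteq> a}"
    then have "c - a \<in> {a. w a \<noteq> a}" by auto
    then show "a \<in> (\<lambda>i. c - i) ` {a. w a \<noteq> a}" by (rule rev_image_eqI) simp
  qed
  then show "finite {a. c - w (c - a) \<noteq> a}" using w finite_subset by blast
qed

lemma flip_perm_apply: "flip_perm c w \<langle>$\<rangle> i = c - w \<langle>$\<rangle> (c - i)"
  by (simp add: flip_perm.rep_eq)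

lemma flip_flip [simp]: "flip_perm c (flip_perm c w) = w"
  by (rule perm_eqI) (simp add: flip_perm_apply)

lemma flip_shift: "flip_perm (c + k) (shift_perm k w) = flip_perm c w"
  by (rule perm_eqI) (simp add: flip_perm_apply shift_perm_apply algebra_simps)

lemma shift_shift: "shift_perm j (shift_perm k w) = shift_perm (k + j) w"
  by (rule perm_eqI) (simp add: shift_perm_apply algebra_simps)

lemma shift_0 [simp]: "shift_perm 0 w = w"
  by (rule perm_eqI) (simp add: shift_perm_apply)

lemma flip_1 [simp]: "flip_perm c 1 = 1" and shift_1 [simp]: "shift_perm k 1 = 1"
  by (rule perm_eqI; simp add: flip_perm_apply shift_perm_apply)+

lemma flip_eq_1_iff [simp]: "flip_perm c w = 1 \<longleftrightarrow> w = 1"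
  by (metis flip_1 flip_flip)

lemma shift_eq_1_iff [simp]: "shift_perm k w = 1 \<longleftrightarrow> w = 1"
  by (metis add.right_inverse shift_0 shift_1 shift_shift)

lemma perm_length_flip [simp]: "perm_length (flip_perm c w) = perm_length w"
proof -
  let ?f = "\<lambda>(i, j). (c - j, c - i :: int)"
  have "inversions (flip_perm c w) = ?f ` inversions w"
  proof (intro equalityI subsetI)
    fix x assume "x \<in> inversions (flip_perm c w)"
    then show "x \<in> ?f ` inversions w"
      by (intro image_eqI[of _ _ "?f x"]) (auto simp: inversions_def flip_perm_apply)
  qed (auto simp: inversions_def flip_perm_apply)
  moreover have "inj_on ?f (inversions w)" by (auto simp: inj_on_def)
  ultimately show ?thesis by (simp add: perm_length_eq card_image)
qed

lemma desc_S_from: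
  assumes "w \<in> S_from r" "desc w b" shows "b \<ge> r"
proof (rule ccontr)
  assume br: "\<not> b \<ge> r"
  then have b: "w \<langle>$\<rangle> b = b" using assms by (simp add: S_from_def)
  have "w \<langle>$\<rangle> (b + 1) < b" using assms b by (simp add: desc_def)
  moreover from this have "w \<langle>$\<rangle> (w \<langle>$\<rangle> (b + 1)) = w \<langle>$\<rangle> (b + 1)"
    using assms br by (simp add: S_from_def)
  ultimately show False by (simp add: perm_apply_eq_iff)
qed

lemma parabolic_S_from: "r \<ge> 1 \<Longrightarrow> parabolic (S_from r)"
  using desc_S_from
  by (fastforce simp: parabolic_def S_pos_eq_S_from S_from_def apply_times adj_apply)

lemma desc_Sn:
  assumes "w \<in> Sn n" "desc w b" shows "1 \<le> b" "b < int n"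
proof -
  show "1 \<le> b" using assms Sn_S_pos desc_S_pos by blast
  show "b < int n"
  proof (rule ccontr)
    assume nb: "\<not> b < int n"
    then have "w \<langle>$\<rangle> (b + 1) = b + 1" using assms by (simp add: Sn_def)
    then have gt: "b + 1 < w \<langle>$\<rangle> b" using assms by (simp add: desc_def)
    then have "w \<langle>$\<rangle> (w \<langle>$\<rangle> b) = w \<langle>$\<rangle> b" using assms nb by (simp add: Sn_def)
    then show False using gt by (simp add: perm_apply_eq_iff)
  qed
qed

lemma parabolic_Sn: "parabolic (Sn n)"
  unfolding parabolic_def
proof (intro conjI ballI allI impI)
  fix z w b assume "z \<in> Sn n" "desc z b" "w \<in> Sn n"
  then show "w * adj b \<in> Sn n" using desc_Sn[of z n b] by (auto simp: Sn_def apply_times adj_apply)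
qed (auto simp: Sn_S_pos, auto simp: Sn_def)

lemma shift_adj: "shift_perm j (w * adj b) = shift_perm j w * adj (b + j)"
  by (rule perm_eqI) (auto simp: shift_perm_apply apply_times adj_apply)

lemma desc_shift: "desc (shift_perm j w) (b + j) \<longleftrightarrow> desc w b"
  by (simp add: desc_def shift_perm_apply)

text \<open>The reflection takes the pair \<open>b\<close>, \<open>b + 1\<close> to
  \<open>c - b\<close>, \<open>c - 1 - b\<close>, and a letter is named after the smaller of its two
  positions.\<close>

lemma flip_adj: "flip_perm c (w * adj b) = flip_perm c w * adj (c - 1 - b)"
  by (rule perm_eqI) (auto simp: flip_perm_apply apply_times adj_apply add.commute)

lemma desc_flip: "desc (flip_perm c w) (c - 1 - b) \<longleftrightarrow> desc w b"
  by (simp add: desc_def flip_perm_apply add.commute)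

lemma bij_betw_shift: "bij_betw (shift_perm j) (S_from r) (S_from (r + j))"
proof (rule bij_betw_byWitness[where f' = "shift_perm (- j)"])
  show "shift_perm j ` S_from r \<subseteq> S_from (r + j)" by (auto simp: S_from_def shift_perm_apply)
  show "shift_perm (- j) ` S_from (r + j) \<subseteq> S_from r" by (auto simp: S_from_def shift_perm_apply)
qed (auto simp: shift_shift)

lemma flip_Sn: "w \<in> Sn n \<Longrightarrow> flip_perm (int n + 1) w \<in> Sn n"
  by (auto simp: Sn_def flip_perm_apply)

lemma bij_betw_flip: "bij_betw (flip_perm (int n + 1)) (Sn n) (Sn n)"
  by (rule bij_betw_byWitness[where f' = "flip_perm (int n + 1)"]) (auto intro: flip_Sn)

section \<open>Structure constants under shift and reflection\<close>

lemma structure_const_shift: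
  fixes \<beta> :: "'k::field"
  assumes "admissible \<beta> y" "inj y" "0 \<le> j" "u \<in> S_pos" "v \<in> S_pos" "w \<in> S_pos"
  shows "structure_const (Gp \<beta> y) (shift_perm j u) (shift_perm j v) (shift_perm j w) =
    structure_const (Gp \<beta> (\<lambda>i. y (i + j))) u v w"
proof -
  have "symmetry \<beta> (\<lambda>i. y (i + j)) y (shift_perm j) (\<lambda>b. b + j) (S_from 1) (S_from (1 + j)) {1..}"
  proof
    show "parabolic (S_from 1)" "parabolic (S_from (1 + j))" using assms by (auto intro: parabolic_S_from)
    show "inj (\<lambda>i. y (i + j))" by (rule injI) (use assms(2) in \<open>auto dest: injD\<close>)
    show "\<And>z b. z \<in> S_from 1 \<Longrightarrow> desc z b \<Longrightarrow> b \<in> {1..}" using desc_S_from by auto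
  qed (use assms in \<open>auto simp: admissible_def bij_betw_shift shift_adj desc_shift shift_perm_apply\<close>)
  from symmetry.structure_const_symmetry[OF this] show ?thesis
    using assms by (simp add: S_pos_eq_S_from)
qed

text \<open>A reflection reverses the two positions in the parameter of \<open>psi_step\<close>;
  replacing each value by its formal inverse reverses the difference back.\<close>

lemma om_dual:
  assumes "1 - \<beta> * p \<noteq> 0" "1 - \<beta> * q \<noteq> 0"
  shows "om \<beta> (om \<beta> 0 p) (om \<beta> 0 q) = om \<beta> q p"
proof -
  have "1 - \<beta> * om \<beta> 0 q = 1 / (1 - \<beta> * q)" using assms by (simp add: om_def field_simps)
  moreover have "om \<beta> 0 p - om \<beta> 0 q = (q - p) / ((1 - \<beta> * p) * (1 - \<beta> * q))"
    using assms by (simp add: om_def divide_simps) (simp add: algebra_simps)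
  ultimately show ?thesis using assms by (simp add: om_def[of \<beta> "om \<beta> 0 p"] om_def[of \<beta> q p])
qed

lemma admissible_dual: "admissible \<beta> y \<Longrightarrow> admissible \<beta> (\<lambda>i. om \<beta> 0 (y (c - i)))"
  by (auto simp: admissible_def om_def field_simps)

lemma structure_const_flip:
  fixes \<beta> :: "'k::field"
  assumes "admissible \<beta> y" "inj y" "u \<in> Sn n" "v \<in> Sn n" "w \<in> Sn n"
  shows "structure_const (Gp \<beta> (\<lambda>i. om \<beta> 0 (y (int n + 1 - i)))) (flip_perm (int n + 1) u)
      (flip_perm (int n + 1) v) (flip_perm (int n + 1) w) = structure_const (Gp \<beta> y) u v w"
proof -
  have d: "desc (flip_perm (int n + 1) w) (int n - b) \<longleftrightarrow> desc w b" for w b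
    using desc_flip[of "int n + 1" w b] by simp
  have "symmetry \<beta> y (\<lambda>i. om \<beta> 0 (y (int n + 1 - i))) (flip_perm (int n + 1)) (\<lambda>b. int n + 1 - 1 - b)
    (Sn n) (Sn n) {1..<int n}"
  proof
    show "admissible \<beta> (\<lambda>i. om \<beta> 0 (y (int n + 1 - i)))" by (rule admissible_dual[OF assms(1)])
    show "\<And>z b. z \<in> Sn n \<Longrightarrow> desc z b \<Longrightarrow> b \<in> {1..<int n}" using desc_Sn by auto
    fix z b
    show "om \<beta> (om \<beta> 0 (y (int n + 1 - flip_perm (int n + 1) z \<langle>$\<rangle> (int n + 1 - 1 - b + 1))))
          (om \<beta> 0 (y (int n + 1 - flip_perm (int n + 1) z \<langle>$\<rangle> (int n + 1 - 1 - b)))) =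
        om \<beta> (y (z \<langle>$\<rangle> (b + 1))) (y (z \<langle>$\<rangle> b))"
      using assms(1) om_dual[of \<beta> "y (z \<langle>$\<rangle> b)" "y (z \<langle>$\<rangle> (b + 1))"]
      by (simp add: flip_perm_apply admissible_def add.commute)
  qed (use assms in \<open>auto simp: bij_betw_flip flip_adj d parabolic_Sn\<close>)
  from symmetry.structure_const_symmetry[OF this] show ?thesis using assms by simp
qed

section \<open>Specialization of rational functions\<close>

definition regular :: "(rat \<Rightarrow> 'a::field) \<Rightarrow> (int \<Rightarrow> 'a) \<Rightarrow> ratfun set" where
  "regular h a = {Fract p q | p q. msubst h a q \<noteq> 0}"

text \<open>Cross-multiplying two representations shows that the value depends on the fraction
  alone, which is what the definite description requires.\<close>

lemma ratfun_subst_Fract: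
  assumes h: "partial_hom UNIV h" and q: "msubst h a q \<noteq> 0"
  shows "ratfun_subst h a (Fract p q) = msubst h a p / msubst h a q"
  unfolding ratfun_subst_def poly_subst_eq
proof (rule the_equality)
  show "\<exists>p' q'. Fract p q = Fract p' q' \<and> msubst h a q' \<noteq> 0 \<and>
      msubst h a p / msubst h a q = msubst h a p' / msubst h a q'"
    using q by blast
next
  interpret m: partial_hom UNIV "msubst h a"
    using partial_hom.partial_hom_msubst[OF h] by simp
  fix g assume "\<exists>p' q'. Fract p q = Fract p' q' \<and> msubst h a q' \<noteq> 0 \<and> g = msubst h a p' / msubst h a q'"
  then obtain p' q' where *: "Fract p q = Fract p' q'" "msubst h a q' \<noteq> 0"
    "g = msubst h a p' / msubst h a q'" by blast
  have "q \<noteq> 0" "q' \<noteq> 0" using q *(2) m.hom_zero by auto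
  then have "p * q' = p' * q" using *(1) by (simp add: eq_fract)
  then have "msubst h a p * msubst h a q' = msubst h a p' * msubst h a q"
    by (metis m.hom_mult UNIV_I)
  then show "g = msubst h a p / msubst h a q"
    unfolding *(3) using q *(2) by (simp add: frac_eq_eq)
qed

lemma partial_hom_ratfun_subst:
  assumes h: "partial_hom UNIV h"
  shows "partial_hom (regular h a) (ratfun_subst h a)"
proof -
  interpret m: partial_hom UNIV "msubst h a"
    using partial_hom.partial_hom_msubst[OF h] by simp
  note rs = ratfun_subst_Fract[OF h]
  show ?thesis
  proof
    have one: "msubst h a 1 \<noteq> 0" by (simp add: m.hom_one)
    then show "1 \<in> regular h a" by (auto simp: regular_def One_fract_def)
    show "ratfun_subst h a 1 = 1" using rs[OF one, of 1] one by (simp add: One_fract_def)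
  next
    fix f f' assume "f \<in> regular h a" "f' \<in> regular h a"
    then obtain p q p' q' where *: "f = Fract p q" "msubst h a q \<noteq> 0" "f' = Fract p' q'" "msubst h a q' \<noteq> 0"
      by (auto simp: regular_def)
    then have q: "q \<noteq> 0" "q' \<noteq> 0" using m.hom_zero by auto
    have qq: "msubst h a (q * q') \<noteq> 0" using * by (simp add: m.hom_mult)
    have add: "f + f' = Fract (p * q' + p' * q) (q * q')" and mult: "f * f' = Fract (p * p') (q * q')"
      using * q by simp_all
    show "f + f' \<in> regular h a" "f * f' \<in> regular h a" unfolding add mult using qq by (auto simp: regular_def)
    have val: "ratfun_subst h a f = msubst h a p / msubst h a q"
      "ratfun_subst h a f' = msubst h a p' / msubst h a q'"
      by (simp_all only: *(1,3) rs[OF *(2)] rs[OF *(4)])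
    show "ratfun_subst h a (f + f') = ratfun_subst h a f + ratfun_subst h a f'"
      unfolding add rs[OF qq] val using * by (simp add: m.hom_add m.hom_mult field_simps)
    show "ratfun_subst h a (f * f') = ratfun_subst h a f * ratfun_subst h a f'"
      unfolding mult rs[OF qq] val by (simp add: m.hom_mult)
    show "- f \<in> regular h a" using * by (auto simp: regular_def)
  qed
qed

lemma regular_inverse:
  assumes h: "partial_hom UNIV h" and f: "f \<in> regular h a" "ratfun_subst h a f \<noteq> 0"
  shows "inverse f \<in> regular h a"
proof -
  obtain p q where *: "f = Fract p q" "msubst h a q \<noteq> 0" using f by (auto simp: regular_def)
  then have "msubst h a p \<noteq> 0" using f ratfun_subst_Fract[OF h *(2), of p] by auto
  then show ?thesis using * by (auto simp: regular_def)
qed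

lemma yvar_eq: "yvar i = to_frac (Var i)"
  by (simp add: yvar_def to_frac_def)

lemma yvar_regular:
  assumes h: "partial_hom UNIV h"
  shows "yvar i \<in> regular h a" "ratfun_subst h a (yvar i) = a i"
proof -
  interpret m: partial_hom UNIV "msubst h a"
    using partial_hom.partial_hom_msubst[OF h] by simp
  have one: "msubst h a 1 \<noteq> 0" by (simp add: m.hom_one)
  then show "yvar i \<in> regular h a" by (auto simp: regular_def yvar_def)
  show "ratfun_subst h a (yvar i) = a i"
    using ratfun_subst_Fract[OF h one, of "Var i"]
    by (simp add: yvar_def m.hom_one partial_hom.msubst_Var[OF h])
qed

lemma yvar_eq_iff [simp]: "yvar i = yvar j \<longleftrightarrow> i = j"
  by (simp add: yvar_eq Var_eq_iff)

lemma one_minus_yvar_neq_0: "1 - yvar i \<noteq> 0"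
proof -
  have "1 - yvar i = to_frac (1 - Var i)"
    by (simp add: yvar_eq partial_hom.hom_diff[OF partial_hom_to_frac] partial_hom.hom_one[OF partial_hom_to_frac])
  moreover have "1 - Var i \<noteq> (0 :: rat mpoly)" using one_minus_Var_neq_0[of 1 i] by simp
  ultimately show ?thesis
    by (metis partial_hom.hom_zero[OF partial_hom_to_frac] to_frac_eq_iff)
qed

lemma admissible_yvar: "\<beta> = 0 \<or> \<beta> = 1 \<Longrightarrow> admissible \<beta> (\<lambda>i. yvar (f i))"
  using one_minus_yvar_neq_0 by (auto simp: admissible_def)

lemma partial_hom_rf_const: "partial_hom UNIV rf_const"
  using partial_hom_comp[OF partial_hom_Const partial_hom_to_frac]
  by (simp add: rf_const_def[abs_def] to_frac_def)

lemma structure_const_ratfun_subst: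
  assumes h: "partial_hom UNIV h" and \<beta>: "\<beta> = 0 \<and> \<beta>' = 0 \<or> \<beta> = 1 \<and> \<beta>' = 1"
    and y: "\<And>i. y i \<in> regular h a" and adm: "admissible \<beta> y"
    and adm': "admissible \<beta>' (\<lambda>i. ratfun_subst h a (y i))"
    and uv: "u \<in> S_pos" "v \<in> S_pos"
  shows "ratfun_subst h a (structure_const (Gp \<beta> y) u v w) =
    structure_const (Gp \<beta>' (\<lambda>i. ratfun_subst h a (y i))) u v w"
proof -
  interpret r: partial_hom "regular h a" "ratfun_subst h a" by (rule partial_hom_ratfun_subst[OF h])
  have \<beta>R: "\<beta> \<in> regular h a" "ratfun_subst h a \<beta> = \<beta>'"
    using \<beta> r.one_mem r.zero_mem r.hom_one r.hom_zero by auto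
  obtain c where c: "expands \<beta> y (Gp \<beta> y u * Gp \<beta> y v) c" by (rule product_expands[OF adm uv])
  have inv: "inverse (1 - \<beta> * y i) \<in> regular h a" for i
    by (rule regular_inverse[OF h])
      (use adm' \<beta>R y in \<open>auto simp: r.hom_diff r.hom_mult r.mult_mem r.one_mem r.diff_mem r.hom_one admissible_def\<close>)
  show ?thesis
    using structure_const_hom(2)[OF partial_hom_ratfun_subst[OF h] \<beta>R(1) y inv adm c] \<beta>R(2) by simp
qed

text \<open>Transports nonvanishing from the single constants to the double ones. The parameters are
  kept general because \<open>yvar\<close> and its formal inverse are both needed.\<close>

lemma at_zero_structure_const:
  assumes \<beta>: "\<beta> = 0 \<and> \<beta>' = 0 \<or> \<beta> = 1 \<and> \<beta>' = 1"
    and y: "\<And>i. y i \<in> regular id (\<lambda>_. 0)" "\<And>i. at_zero (y i) = 0" and adm: "admissible \<beta> y"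
    and uv: "u \<in> S_pos" "v \<in> S_pos"
  shows "at_zero (structure_const (Gp \<beta> y) u v w) = structure_const (Gp \<beta>' (\<lambda>_. 0)) u v w"
proof -
  have h: "partial_hom UNIV (id :: rat \<Rightarrow> rat)" using partial_hom_id by (simp add: id_def)
  show ?thesis
    using structure_const_ratfun_subst[OF h \<beta> y(1) adm _ uv, of w] y(2) by (simp add: at_zero_def)
qed

lemma shift_y_structure_const:
  assumes uv: "u \<in> S_pos" "v \<in> S_pos"
  shows "shift_y k (structure_const (Gp 1 yvar) u v w) = structure_const (Gp 1 (\<lambda>i. yvar (i - k))) u v w"
  using structure_const_ratfun_subst[OF partial_hom_rf_const _ _ _ _ uv, of 1 1 yvar "\<lambda>i. yvar (i - k)" w]
    yvar_regular[OF partial_hom_rf_const] admissible_yvar[of 1 "\<lambda>i. i"] admissible_yvar[of 1 "\<lambda>i. i - k"]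
  by (simp add: shift_y_def)

lemma at_zero_0 [simp]: "at_zero 0 = 0"
proof -
  have "partial_hom UNIV (id :: rat \<Rightarrow> rat)" using partial_hom_id by (simp add: id_def)
  from partial_hom.hom_zero[OF partial_hom_ratfun_subst[OF this]] show ?thesis by (simp add: at_zero_def)
qed

lemma at_zero_yvar: "yvar i \<in> regular id (\<lambda>_. 0)" "at_zero (yvar i) = 0"
  and at_zero_dual: "om 1 0 (yvar i) \<in> regular id (\<lambda>_. 0)" "at_zero (om 1 0 (yvar i)) = 0"
proof -
  have h: "partial_hom UNIV (id :: rat \<Rightarrow> rat)" using partial_hom_id by (simp add: id_def)
  interpret r: partial_hom "regular id (\<lambda>_. 0)" "ratfun_subst id (\<lambda>_. 0 :: rat)"
    by (rule partial_hom_ratfun_subst[OF h])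
  note y = yvar_regular[OF h, where a = "\<lambda>_. 0"]
  show "yvar i \<in> regular id (\<lambda>_. 0)" "at_zero (yvar i) = 0" using y by (auto simp: at_zero_def)
  have "inverse (1 - yvar i) \<in> regular id (\<lambda>_. 0)"
    by (rule regular_inverse[OF h]) (use y in \<open>auto simp: r.hom_diff r.one_mem r.hom_one r.diff_mem\<close>)
  moreover have "om 1 0 (yvar i) = - yvar i * inverse (1 - yvar i)" by (simp add: om_def divide_inverse)
  ultimately show "om 1 0 (yvar i) \<in> regular id (\<lambda>_. 0)" "at_zero (om 1 0 (yvar i)) = 0"
    using y by (auto simp: at_zero_def r.hom_mult r.mult_mem r.uminus_mem r.hom_uminus)
qed

section \<open>The two bounds as maxima over the crossed positions\<close>

lemma affected_eq: "{k. w \<langle>$\<rangle> k \<noteq> k} = affected w"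
  by (auto simp: in_affected)

lemma dualcode_pos_iff: "dualcode w q > 0 \<longleftrightarrow> (\<exists>k<q. w \<langle>$\<rangle> q < w \<langle>$\<rangle> k)"
proof -
  have "finite {j. j < q \<and> w \<langle>$\<rangle> j > w \<langle>$\<rangle> q}"
    by (rule finite_subset[of _ "fst ` inversions w"]) (force simp: inversions_def image_iff, simp)
  then show ?thesis by (auto simp: dualcode_def card_gt_0_iff)
qed

lemma code_pos_iff: "code w q > 0 \<longleftrightarrow> (\<exists>k>q. w \<langle>$\<rangle> k < w \<langle>$\<rangle> q)"
proof -
  have "finite {j. j > q \<and> w \<langle>$\<rangle> j < w \<langle>$\<rangle> q}"
    by (rule finite_subset[of _ "snd ` inversions w"]) (force simp: inversions_def image_iff, simp)
  then show ?thesis by (auto simp: code_def card_gt_0_iff)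
qed

lemma Lambda_sum_eq: "Lambda_sum (j + 1) w = int (card (crossed w j))"
proof -
  have "Lambda_sum (j + 1) w = (\<Sum>q\<in>crossed w j. if q \<ge> j + 1 then Theta q w else 0)"
    unfolding Lambda_sum_def
    by (rule Sum_any.expand_superset[OF finite_crossed]) (auto simp: Theta_def dualcode_pos_iff crossed_def)
  also have "\<dots> = (\<Sum>q\<in>crossed w j. 1)"
    by (intro sum.cong) (auto simp: Theta_def dualcode_pos_iff crossed_def)
  finally show ?thesis by simp
qed

lemma crossed_flip: "q \<in> crossed (flip_perm c w) j \<longleftrightarrow> c - q \<le> c - 1 - j \<and> code w (c - q) > 0"
proof -
  have "(\<exists>k<q. w \<langle>$\<rangle> (c - k) < w \<langle>$\<rangle> (c - q)) \<longleftrightarrow> (\<exists>k>c - q. w \<langle>$\<rangle> k < w \<langle>$\<rangle> (c - q))"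
  proof
    assume "\<exists>k<q. w \<langle>$\<rangle> (c - k) < w \<langle>$\<rangle> (c - q)"
    then obtain k where "k < q" "w \<langle>$\<rangle> (c - k) < w \<langle>$\<rangle> (c - q)" by blast
    then show "\<exists>k>c - q. w \<langle>$\<rangle> k < w \<langle>$\<rangle> (c - q)" by (intro exI[of _ "c - k"]) simp
  next
    assume "\<exists>k>c - q. w \<langle>$\<rangle> k < w \<langle>$\<rangle> (c - q)"
    then obtain k where "k > c - q" "w \<langle>$\<rangle> k < w \<langle>$\<rangle> (c - q)" by blast
    then show "\<exists>k<q. w \<langle>$\<rangle> (c - k) < w \<langle>$\<rangle> (c - q)" by (intro exI[of _ "c - k"]) simp
  qed
  then show ?thesis by (auto simp: crossed_def flip_perm_apply code_pos_iff)
qed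

text \<open>Under the reflection, positive code entries up to \<open>c - 1 - j\<close> become
  positive dual code entries beyond \<open>j\<close>.\<close>

lemma lambda_sum_eq: "lambda_sum (c - 1 - j) w = int (card (crossed (flip_perm c w) j))"
proof -
  let ?A = "(\<lambda>q. c - q) ` crossed (flip_perm c w) j"
  have A: "i \<in> ?A \<longleftrightarrow> i \<le> c - 1 - j \<and> code w i > 0" for i
  proof
    assume "i \<le> c - 1 - j \<and> code w i > 0"
    then show "i \<in> ?A" by (intro image_eqI[of _ _ "c - i"]) (simp_all add: crossed_flip)
  qed (auto simp: crossed_flip)
  have "lambda_sum (c - 1 - j) w = (\<Sum>q\<in>?A. if q \<le> c - 1 - j then theta q w else 0)"
    unfolding lambda_sum_def
  proof (rule Sum_any.expand_superset)
    show "{a. (if a \<le> c - 1 - j then theta a w else 0) \<noteq> 0} \<subseteq> ?A"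
      unfolding subset_iff A by (auto simp: theta_def split: if_splits)
  qed simp
  also have "\<dots> = (\<Sum>q\<in>?A. 1)" by (intro sum.cong) (auto simp: A theta_def simp del: image_iff)
  also have "\<dots> = int (card (crossed (flip_perm c w) j))"
    by (simp add: card_image inj_on_def)
  finally show ?thesis .
qed

text \<open>The expression maximized in \<open>Xi\<close> at the index i = j + 1. With this shift
  \<open>j\<close> is the index of the variable whose degree is bounded.\<close>

definition xi_val :: "int perm \<Rightarrow> int perm \<Rightarrow> int \<Rightarrow> int" where
  "xi_val u v j = int (card (crossed u j)) + int (card (crossed v j)) + j"

definition top_pos :: "int perm \<Rightarrow> int perm \<Rightarrow> int" where
  "top_pos u v = Max (affected u \<union> affected v)"

text \<open>A predicate, because the range of \<open>j\<close> is unbounded below;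
  \<open>crossed_S_pos\<close> reduces it to the indices from 1 on.\<close>

definition xi_max :: "int perm \<Rightarrow> int perm \<Rightarrow> int \<Rightarrow> bool" where
  "xi_max u v X \<longleftrightarrow> (\<exists>j\<le>top_pos u v. xi_val u v j = X) \<and> (\<forall>j\<le>top_pos u v. xi_val u v j \<le> X)"

lemma maximum_eqI: "a \<in> A \<Longrightarrow> (\<And>x. x \<in> A \<Longrightarrow> x \<le> a) \<Longrightarrow> maximum A = a"
  unfolding maximum_def by (auto intro!: Greatest_equality)

lemma maximum_bot: "(\<And>x. x \<in> A \<Longrightarrow> x = - \<infinity>) \<Longrightarrow> maximum A = - \<infinity>"
  by (cases "A = {}") (auto simp: maximum_def intro!: maximum_eqI[unfolded maximum_def] Greatest_equality)

lemma FS_eq: "w \<noteq> 1 \<Longrightarrow> FS w = ereal (of_int (Max (affected w)))"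
  by (simp add: FS_def affected_eq)

lemma max_FS:
  assumes "affected u \<union> affected v \<noteq> {}"
  shows "max (FS u) (FS v) = ereal (of_int (top_pos u v))"
proof (cases "u = 1 \<or> v = 1")
  case True
  then show ?thesis using assms by (auto simp: top_pos_def FS_eq) (auto simp: FS_def top_pos_def affected_eq)
next
  case False
  then have "affected u \<noteq> {}" "affected v \<noteq> {}" by simp_all
  then show ?thesis using False by (simp add: FS_eq top_pos_def Max_Un of_int_max flip: ereal_max)
qed

lemma Xi_eq:
  assumes "affected u \<union> affected v \<noteq> {}" "xi_max u v X"
  shows "Xi u v = ereal (of_int X)"
proof -
  have le: "ereal (of_int i) \<le> 1 + max (FS u) (FS v) \<longleftrightarrow> i - 1 \<le> top_pos u v" for i
    unfolding max_FS[OF assms(1)] one_ereal_def plus_ereal.simps ereal_less_eq by linarith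
  have val: "Lambda_sum i u + Lambda_sum i v + i - 1 = xi_val u v (i - 1)" for i
    using Lambda_sum_eq[of "i - 1" u] Lambda_sum_eq[of "i - 1" v] by (simp add: xi_val_def)
  obtain j where j: "j \<le> top_pos u v" "xi_val u v j = X" using assms(2) by (auto simp: xi_max_def)
  show ?thesis
    unfolding Xi_def le val
  proof (rule maximum_eqI)
    show "ereal (of_int X) \<in> {ereal (of_int (xi_val u v (i - 1))) |i. i - 1 \<le> top_pos u v}"
      using j by (intro CollectI exI[of _ "j + 1"]) simp
  qed (use assms(2) in \<open>auto simp: xi_max_def\<close>)
qed

lemma affected_flip: "affected (flip_perm c w) = (\<lambda>i. c - i) ` affected w"
proof (intro equalityI subsetI)
  fix i assume "i \<in> affected (flip_perm c w)"
  then show "i \<in> (\<lambda>i. c - i) ` affected w"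
    by (intro image_eqI[of _ _ "c - i"]) (auto simp: in_affected flip_perm_apply)
qed (auto simp: in_affected flip_perm_apply)

lemma Max_reflect:
  fixes U :: "int set"
  assumes "finite U" "U \<noteq> {}" shows "Max ((\<lambda>i. c - i) ` U) = c - Min U"
  by (rule Max_eqI) (use assms imageI[OF Min_in[OF assms], of "\<lambda>i. c - i"] in auto)

lemma BS_flip: "BS w = FS (flip_perm c w) - ereal (of_int (c - 1))"
proof (cases "w = 1")
  case False
  then have "affected w \<noteq> {}" by simp
  then have "Max (affected (flip_perm c w)) = c - Min (affected w)"
    by (simp add: affected_flip Max_reflect)
  then show ?thesis using False by (simp add: BS_def FS_eq affected_eq)
qed (simp add: BS_def FS_def)

text \<open>Range and values in \<open>Omega\<close> become those of the reflected pair: the index i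
  turns into c - 1 - i, and the values drop by c - 1.\<close>

lemma Omega_eq:
  assumes "affected u \<union> affected v \<noteq> {}" "xi_max (flip_perm c u) (flip_perm c v) X"
  shows "Omega u v = ereal (of_int X) - ereal (of_int (c - 1))"
proof -
  let ?u = "flip_perm c u" and ?v = "flip_perm c v"
  have ne: "affected ?u \<union> affected ?v \<noteq> {}" using assms(1) by (simp add: affected_flip)
  have "max (BS u) (BS v) = max (FS ?u) (FS ?v) - ereal (of_int (c - 1))"
    unfolding BS_flip[of _ c] by (cases "FS ?u"; cases "FS ?v") (auto simp: max_def)
  then have BS: "max (BS u) (BS v) = ereal (of_int (top_pos ?u ?v - (c - 1)))"
    unfolding max_FS[OF ne] by simp
  have le: "- max (BS u) (BS v) \<le> ereal (of_int i) \<longleftrightarrow> c - 1 - i \<le> top_pos ?u ?v" for i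
    unfolding BS uminus_ereal.simps ereal_less_eq by linarith
  have val: "lambda_sum i u + lambda_sum i v - i = xi_val ?u ?v (c - 1 - i) - (c - 1)" for i
    using lambda_sum_eq[of c "c - 1 - i" u] lambda_sum_eq[of c "c - 1 - i" v] by (simp add: xi_val_def)
  obtain j where j: "j \<le> top_pos ?u ?v" "xi_val ?u ?v j = X" using assms(2) by (auto simp: xi_max_def)
  show ?thesis
    unfolding Omega_def le val
  proof (rule maximum_eqI)
    show "ereal (of_int X) - ereal (of_int (c - 1)) \<in>
        {ereal (of_int (xi_val ?u ?v (c - 1 - i) - (c - 1))) |i. c - 1 - i \<le> top_pos ?u ?v}"
      using j by (intro CollectI exI[of _ "c - 1 - j"]) simp
  qed (use assms(2) in \<open>auto simp: xi_max_def\<close>)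
qed

text \<open>Positions up to 1 have no larger value before them, so below the index 1 nothing new is
  counted and \<open>xi_val\<close> stays under its value at 1.\<close>

lemma crossed_S_pos:
  assumes "w \<in> S_pos" "j \<le> 1" shows "crossed w j = crossed w 1"
proof -
  have "1 < q" if "q \<in> crossed w j" for q
  proof (rule ccontr)
    assume q: "\<not> 1 < q"
    obtain k where k: "k < q" "w \<langle>$\<rangle> q < w \<langle>$\<rangle> k" using \<open>q \<in> crossed w j\<close> by (auto simp: crossed_def)
    have "w \<langle>$\<rangle> k = k" using k q assms by (simp add: S_pos_def)
    moreover have "k < w \<langle>$\<rangle> q"
    proof (cases "q = 1")
      case True
      then show ?thesis using S_from_ge[of w 1 1] assms k by (simp add: S_pos_eq_S_from)
    next
      case False
      then show ?thesis using q k assms by (simp add: S_pos_def)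
    qed
    ultimately show False using k by simp
  qed
  then show ?thesis using assms by (auto simp: crossed_def)
qed

text \<open>The last moved position p is moved by one of the two permutations. There its value is
  smaller than p, and the value p itself stands earlier, so p is crossed.\<close>

lemma top_pos_props:
  assumes "u \<in> S_pos" "v \<in> S_pos" "affected u \<union> affected v \<noteq> {}"
  shows "u \<in> Sn (nat (top_pos u v))" "v \<in> Sn (nat (top_pos u v))" "2 \<le> top_pos u v"
    and "top_pos u v \<in> crossed u (top_pos u v - 1) \<union> crossed v (top_pos u v - 1)"
proof -
  define p where "p = top_pos u v"
  have fin: "finite (affected u \<union> affected v)" by simp
  have p: "p \<in> affected u \<union> affected v" unfolding p_def top_pos_def by (rule Max_in[OF fin assms(3)])
  have le: "i \<le> p" if "i \<in> affected u \<union> affected v" for i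
    unfolding p_def top_pos_def by (rule Max_ge[OF fin that])
  have main: "2 \<le> p \<and> p \<in> crossed x (p - 1)"
    if x: "x \<in> S_pos" "p \<in> affected x" "affected x \<subseteq> affected u \<union> affected v" for x
  proof -
    have xp: "x \<langle>$\<rangle> p \<noteq> p" using x by (simp add: in_affected)
    have "x \<langle>$\<rangle> p \<in> affected x" using xp by (simp add: in_affected perm_apply_eq_iff)
    then have "x \<langle>$\<rangle> p \<le> p" using le x(3) by blast
    then have lt: "x \<langle>$\<rangle> p < p" using xp by simp
    have "\<not> p \<le> 0" using xp x(1) by (auto simp: S_pos_def)
    then have "1 \<le> p" by simp
    then have "1 \<le> x \<langle>$\<rangle> p" using S_from_ge[of x 1 p] x by (simp add: S_pos_eq_S_from)
    then have p2: "2 \<le> p" using lt by simp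
    define k where "k = inverse x \<langle>$\<rangle> p"
    have xk: "x \<langle>$\<rangle> k = p" by (simp add: k_def)
    then have "k \<noteq> p" using xp by auto
    then have "k \<in> affected x" using xk by (auto simp: in_affected)
    then have "k \<le> p" using le x(3) by blast
    then have "k < p" using \<open>k \<noteq> p\<close> by simp
    then show ?thesis using p2 lt xk by (auto simp: crossed_def)
  qed
  have "2 \<le> p \<and> p \<in> crossed u (p - 1) \<union> crossed v (p - 1)"
    using p main[of u] main[of v] assms by blast
  then show "2 \<le> top_pos u v" "top_pos u v \<in> crossed u (top_pos u v - 1) \<union> crossed v (top_pos u v - 1)"
    by (auto simp: p_def)
  have "x \<in> Sn (nat p)" if x: "x \<in> S_pos" "affected x \<subseteq> affected u \<union> affected v" for x
    unfolding Sn_def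
  proof (clarify, elim disjE)
    fix i assume "int (nat p) < i"
    then have "\<not> i \<le> p" by linarith
    then have "i \<notin> affected x" using le x(2) by blast
    then show "x \<langle>$\<rangle> i = i" by (simp add: in_affected)
  qed (use x in \<open>auto simp: S_pos_def\<close>)
  then show "u \<in> Sn (nat (top_pos u v))" "v \<in> Sn (nat (top_pos u v))" using assms by (auto simp: p_def)
qed

text \<open>At the least index where the maximum is attained both permutations have a left-to-right
  maximum, so that the bound on the degree in this variable is sharp.\<close>

lemma xi_max_exists:
  assumes u: "u \<in> S_pos" and v: "v \<in> S_pos" and ne: "affected u \<union> affected v \<noteq> {}"
  obtains X w where "xi_max u v X" "1 \<le> X"
    "\<And>i. 1 \<le> i \<Longrightarrow> card (crossed u i) + card (crossed v i) \<le> nat (int (nat X) - i)"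
    "w \<in> S_pos" "w \<notin> Sn (nat (X - 1))" "structure_const (Gp 0 (\<lambda>_. 0 :: rat)) u v w \<noteq> 0"
proof -
  define p where "p = top_pos u v"
  note props = top_pos_props[OF u v ne, folded p_def]
  define X where "X = Max (xi_val u v ` {1..p})"
  have le: "xi_val u v j \<le> X" if "1 \<le> j" "j \<le> p" for j
    unfolding X_def by (rule Max_ge) (use that in auto)
  have "X \<in> xi_val u v ` {1..p}" unfolding X_def by (rule Max_in) (use props(3) in auto)
  then have ne': "{j \<in> {1..p}. xi_val u v j = X} \<noteq> {}" by auto
  define j where "j = Min {j \<in> {1..p}. xi_val u v j = X}"
  have fin: "finite {j \<in> {1..p}. xi_val u v j = X}" by (rule finite_subset[of _ "{1..p}"]) auto
  have "j \<in> {j \<in> {1..p}. xi_val u v j = X}" unfolding j_def by (rule Min_in[OF fin ne'])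
  then have j: "1 \<le> j" "j \<le> p" "xi_val u v j = X" by auto
  have less: "xi_val u v i < X" if "1 \<le> i" "i < j" for i
  proof (rule ccontr)
    assume "\<not> xi_val u v i < X"
    then have "xi_val u v i = X" using le[of i] that j by force
    then have "j \<le> i" unfolding j_def by (intro Min_le[OF fin]) (use that j in auto)
    then show False using that by simp
  qed
  have "xi_val u v p \<ge> p" by (simp add: xi_val_def)
  then have pX: "p \<le> X" using le[of p] props(3) by simp
  have "xi_val u v i \<le> X" if "i \<le> p" for i
  proof (cases "1 \<le> i")
    case False
    then have "xi_val u v i \<le> xi_val u v 1"
      using crossed_S_pos[OF u, of i] crossed_S_pos[OF v, of i] by (simp add: xi_val_def)
    then show ?thesis using le[of 1] props(3) by simp
  qed (use le that in simp)
  then have xm: "xi_max u v X" using j by (auto simp: xi_max_def p_def)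
  have X1: "1 \<le> X" using pX props(3) by simp
  have bound: "card (crossed u i) + card (crossed v i) \<le> nat (int (nat X) - i)" if i: "1 \<le> i" for i
  proof (cases "i \<le> p")
    case True
    then show ?thesis using le[OF i] X1 by (simp add: xi_val_def)
  next
    case False
    then have "crossed u i = {}" "crossed v i = {}"
      using crossed_Sn[OF props(1), of i] crossed_Sn[OF props(2), of i] props(3) by auto
    then show ?thesis by simp
  qed
  have lrmax: "x \<langle>$\<rangle> k < x \<langle>$\<rangle> j" if x: "x \<in> S_pos" "x = u \<or> x = v" and k: "k < j" for x k
  proof (cases "j = 1")
    case True
    then show ?thesis using x k S_from_ge[of x 1 1] by (simp add: S_pos_def S_pos_eq_S_from[symmetric])
  next
    case False
    \<comment> \<open>The index grows by one and neither count can grow, so a strict increase forces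
      both counts to stay the same; thus \<open>j\<close> is crossed in neither permutation.\<close>
    then have "xi_val u v (j - 1) < xi_val u v j" using less[of "j - 1"] j by simp
    moreover have "card (crossed y j) \<le> card (crossed y (j - 1))" for y by (rule card_crossed_antimono) simp
    ultimately have eq: "card (crossed x (j - 1)) \<le> card (crossed x j)"
      using x(2) unfolding xi_val_def by (smt (verit) of_nat_le_iff)
    have "j \<notin> crossed x (j - 1)"
    proof
      assume "j \<in> crossed x (j - 1)"
      moreover have "j \<notin> crossed x j" "crossed x j \<subseteq> crossed x (j - 1)" by (auto simp: crossed_def)
      ultimately have "crossed x j \<subset> crossed x (j - 1)" by blast
      then show False using psubset_card_mono[of "crossed x (j - 1)"] eq by (simp add: not_less[symmetric])
    qed
    then have "\<not> x \<langle>$\<rangle> j < x \<langle>$\<rangle> k" using k by (auto simp: crossed_def)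
    moreover have "x \<langle>$\<rangle> k \<noteq> x \<langle>$\<rangle> j" using k by (simp add: perm_apply_eq_iff)
    ultimately show ?thesis by simp
  qed
  \<comment> \<open>If nothing were crossed beyond \<open>j\<close>, then \<open>X = j = p\<close>;
    but p is crossed, so p - 1 would already attain \<open>X\<close>, against minimality. Positivity
    also prevents truncation by \<open>nat\<close> in the final comparison with
    \<open>X - 1\<close>.\<close>
  have pos: "0 < card (crossed u j) + card (crossed v j)"
  proof (rule ccontr)
    assume "\<not> 0 < card (crossed u j) + card (crossed v j)"
    then have "X = j" using j(3) by (simp add: xi_val_def)
    then have "j = p" "X = p" using j pX by auto
    have "card (crossed u (p - 1)) > 0 \<or> card (crossed v (p - 1)) > 0"
      using props(4) by (auto simp: card_gt_0_iff)
    then have "xi_val u v (p - 1) \<ge> X" using \<open>X = p\<close> by (auto simp: xi_val_def)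
    then show False using less[of "p - 1"] \<open>j = p\<close> props(3) by simp
  qed
  have "int (nat (X - 1)) - j = int (card (crossed u j) + card (crossed v j)) - 1"
    using j(3) X1 by (simp add: xi_val_def)
  then have "nat (int (nat (X - 1)) - j) < card (crossed u j) + card (crossed v j)"
    using pos by linarith
  then obtain w where "w \<in> S_pos" "w \<notin> Sn (nat (X - 1))" "structure_const (Gp 0 (\<lambda>_. 0 :: rat)) u v w \<noteq> 0"
    using schubert_const_outside[OF u v j(1), of "nat (X - 1)"] lrmax u v by metis
  then show thesis using that xm X1 bound by blast
qed

section \<open>From membership in finite symmetric groups to FS\<close>

lemma Sn_affected_le:
  assumes "w \<in> Sn (nat X)" "1 \<le> X" "i \<in> affected w" shows "i \<le> X"
proof (rule ccontr)
  assume "\<not> i \<le> X"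
  then have "int (nat X) < i" using assms(2) by simp
  then have "w \<langle>$\<rangle> i = i" using assms(1) by (simp add: Sn_def)
  then show False using assms(3) by (simp add: in_affected)
qed

lemma FS_le:
  assumes "w \<in> Sn (nat X)" "1 \<le> X" shows "FS w \<le> ereal (of_int X)"
proof (cases "w = 1")
  case False
  then have "affected w \<noteq> {}" by simp
  then have "Max (affected w) \<in> affected w" by (intro Max_in) auto
  then have "Max (affected w) \<le> X" by (rule Sn_affected_le[OF assms])
  then show ?thesis using False by (simp add: FS_eq)
qed (simp add: FS_def)

lemma FS_eqI:
  assumes "w \<in> Sn (nat X)" "w \<notin> Sn (nat (X - 1))" "1 \<le> X"
  shows "FS w = ereal (of_int X)"
proof -
  obtain i where i: "w \<langle>$\<rangle> i \<noteq> i" "i < 1 \<or> int (nat (X - 1)) < i" using assms(2) by (auto simp: Sn_def)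
  have "\<not> (i < 1 \<or> int (nat X) < i)" using i(1) assms(1) by (auto simp: Sn_def)
  then have "\<not> i < 1" "i \<le> X" using assms(3) by auto
  then have "i = X" using i(2) assms(3) by linarith
  then have X: "X \<in> affected w" using i by (simp add: in_affected)
  have "y \<le> X" if "y \<in> affected w" for y by (rule Sn_affected_le[OF assms(1,3) that])
  then have "Max (affected w) = X" using X by (intro Max_eqI) auto
  moreover have "w \<noteq> 1" using X by auto
  ultimately show ?thesis by (simp add: FS_eq)
qed

text \<open>The degenerate case: nothing is crossed, so the support bound holds with
  \<open>n = 0\<close>. The stability numbers are then minus infinity by convention, like the maxima
  over the empty ranges in \<open>Xi\<close> and \<open>Omega\<close>.\<close>

lemma structure_const_1_1:
  assumes "admissible \<beta> y" "structure_const (Gp \<beta> y) 1 1 w \<noteq> 0"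
  shows "w = 1"
proof -
  have "crossed 1 i = {}" for i by (auto simp: crossed_def)
  then have "w \<in> Sn 0" using structure_const_support[OF assms(1) _ assms(2), of 0] by simp
  then show ?thesis by (intro perm_eqI) (auto simp: Sn_def)
qed

lemma maximum_FS_1_1:
  assumes "admissible \<beta> y"
  shows "maximum {FS w |w. w \<in> S_pos \<and> structure_const (Gp \<beta> y) 1 1 w \<noteq> 0} = - \<infinity>"
  by (rule maximum_bot) (use structure_const_1_1[OF assms] in \<open>auto simp: FS_def\<close>)

section \<open>Back-stable structure constants\<close>

lemma shift_S_pos_iff: "shift_perm k w \<in> S_pos \<longleftrightarrow> BS w \<le> ereal (of_int k)"
proof (cases "w = 1")
  case True
  then show ?thesis by (simp add: S_pos_def BS_def)
next
  case False
  have BS: "BS w = ereal (of_int (1 - Min (affected w)))" using False by (simp add: BS_def affected_eq)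
  have "BS w \<le> ereal (of_int k) \<longleftrightarrow> 1 - k \<le> Min (affected w)"
    unfolding BS ereal_less_eq of_int_le_iff by linarith
  also have "\<dots> \<longleftrightarrow> (\<forall>i\<in>affected w. 1 - k \<le> i)" using False by (intro Min_ge_iff) auto
  also have "\<dots> \<longleftrightarrow> (\<forall>i\<le>- k. w \<langle>$\<rangle> i = i)"
  proof -
    have "1 - k \<le> i \<longleftrightarrow> \<not> i \<le> - k" for i by linarith
    then show ?thesis unfolding Ball_def in_affected by blast
  qed
  also have "\<dots> \<longleftrightarrow> shift_perm k w \<in> S_pos"
  proof
    assume "\<forall>i\<le>- k. w \<langle>$\<rangle> i = i"
    then show "shift_perm k w \<in> S_pos" by (simp add: S_pos_def shift_perm_apply)
  next
    assume *: "shift_perm k w \<in> S_pos"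
    show "\<forall>i\<le>- k. w \<langle>$\<rangle> i = i"
    proof (intro allI impI)
      fix i assume "i \<le> - k"
      then have "shift_perm k w \<langle>$\<rangle> (i + k) = i + k" using * by (simp add: S_pos_def)
      then show "w \<langle>$\<rangle> i = i" by (simp add: shift_perm_apply)
    qed
  qed
  finally show ?thesis by simp
qed

lemma shift_S_pos_mono: "shift_perm k w \<in> S_pos \<Longrightarrow> k \<le> l \<Longrightarrow> shift_perm l w \<in> S_pos"
  unfolding shift_S_pos_iff by (rule order_trans) auto

lemma shift_S_pos_exists: "\<exists>k::nat. shift_perm (int k) w \<in> S_pos"
proof -
  obtain N where N: "\<And>i. \<bar>i\<bar> > N \<Longrightarrow> w \<langle>$\<rangle> i = i" using perm_eventually_fixed by blast
  have "shift_perm (int (nat N + 1)) w \<in> S_pos"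
    unfolding S_pos_def
  proof (clarify)
    fix i :: int assume "i \<le> 0"
    then have "w \<langle>$\<rangle> (i - int (nat N + 1)) = i - int (nat N + 1)" by (intro N) linarith
    then show "shift_perm (int (nat N + 1)) w \<langle>$\<rangle> i = i" by (simp add: shift_perm_apply)
  qed
  then show ?thesis by blast
qed

text \<open>Independence of the shift: moving the permutations from \<open>l\<close> to
  \<open>m\<close> by \<open>structure_const_shift\<close> compensates the change of the parameters
  from y_(i-l) to y_(i-m), so the defining description picks a unique value.\<close>

lemma C_back_double_eq:
  assumes "shift_perm k u \<in> S_pos" "shift_perm k v \<in> S_pos" "shift_perm k w \<in> S_pos"
  shows "C_back_double u v w = structure_const (Gp 1 (\<lambda>i. yvar (i - k)))
    (shift_perm k u) (shift_perm k v) (shift_perm k w)"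
proof -
  let ?E = "\<lambda>k. structure_const (Gp 1 (\<lambda>i. yvar (i - k))) (shift_perm k u) (shift_perm k v) (shift_perm k w)"
  have up: "?E l = ?E m"
    if lm: "l \<le> m" and l: "shift_perm l u \<in> S_pos" "shift_perm l v \<in> S_pos" "shift_perm l w \<in> S_pos" for l m
  proof -
    have "inj (\<lambda>i. yvar (i - m))" by (rule injI) simp
    from structure_const_shift[OF admissible_yvar[of 1 "\<lambda>i. i - m"] this _ l, of "m - l"] lm
    show ?thesis by (simp add: shift_shift algebra_simps)
  qed
  have E: "?E l = ?E k" if "shift_perm l u \<in> S_pos" "shift_perm l v \<in> S_pos" "shift_perm l w \<in> S_pos" for l
  proof (cases "l \<le> k")
    case True
    then show ?thesis by (rule up[OF _ that])
  next
    case False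
    then have "k \<le> l" by simp
    then show ?thesis by (rule up[OF _ assms, symmetric])
  qed
  have sh: "shift_y l (C_double (shift_perm l u) (shift_perm l v) (shift_perm l w)) = ?E l"
    if "shift_perm l u \<in> S_pos" "shift_perm l v \<in> S_pos" for l
    using shift_y_structure_const[OF that] by (simp add: C_double_def double_grothendieck_eq)
  show ?thesis
    unfolding C_back_double_def shift_S_pos_iff[symmetric]
  proof (rule the_equality)
    show "\<forall>l. shift_perm l u \<in> S_pos \<and> shift_perm l v \<in> S_pos \<and> shift_perm l w \<in> S_pos \<longrightarrow>
        ?E k = shift_y l (C_double (shift_perm l u) (shift_perm l v) (shift_perm l w))"
    proof (intro allI impI, elim conjE)
      fix l assume l: "shift_perm l u \<in> S_pos" "shift_perm l v \<in> S_pos" "shift_perm l w \<in> S_pos"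
      show "?E k = shift_y l (C_double (shift_perm l u) (shift_perm l v) (shift_perm l w))"
        unfolding sh[OF l(1,2)] by (rule E[OF l, symmetric])
    qed
  next
    fix c assume "\<forall>l. shift_perm l u \<in> S_pos \<and> shift_perm l v \<in> S_pos \<and> shift_perm l w \<in> S_pos \<longrightarrow>
        c = shift_y l (C_double (shift_perm l u) (shift_perm l v) (shift_perm l w))"
    then show "c = ?E k" using sh[OF assms(1,2)] assms by blast
  qed
qed

text \<open>\<open>w\<close> may move nonpositive integers, so all three are first shifted into a
  common finite symmetric group and then reflected. By \<open>flip_shift\<close> the composite is a
  reflection of the original permutations, in which the auxiliary shift has disappeared.\<close>

lemma C_back_double_flip:
  assumes u: "u \<in> Sn N" and v: "v \<in> Sn N" and w: "\<And>i. int N < i \<Longrightarrow> w \<langle>$\<rangle> i = i"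
  obtains y where "admissible 1 y" "\<forall>i. y i \<in> regular id (\<lambda>_. 0) \<and> at_zero (y i) = 0"
    "C_back_double u v w = structure_const (Gp 1 y)
      (flip_perm (int N + 1) u) (flip_perm (int N + 1) v) (flip_perm (int N + 1) w)"
proof -
  obtain k :: nat where k: "shift_perm (int k) w \<in> S_pos" using shift_S_pos_exists by blast
  have Sn: "shift_perm (int k) x \<in> Sn (N + k)"
    if "shift_perm (int k) x \<in> S_pos" "\<And>i. int N < i \<Longrightarrow> x \<langle>$\<rangle> i = i" for x
    using that by (auto simp: Sn_def S_pos_def shift_perm_apply)
  have pos: "shift_perm (int k) x \<in> S_pos" if "x \<in> Sn N" for x
    using shift_S_pos_mono[of 0 x "int k"] Sn_S_pos[OF that] by simp
  have sSn: "shift_perm (int k) u \<in> Sn (N + k)" "shift_perm (int k) v \<in> Sn (N + k)"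
    "shift_perm (int k) w \<in> Sn (N + k)"
    using Sn[OF pos[OF u]] Sn[OF pos[OF v]] Sn[OF k w] u v by (auto simp: Sn_def)
  let ?y = "\<lambda>i. om 1 0 (yvar (int (N + k) + 1 - i - int k))"
  have fl: "flip_perm (int (N + k) + 1) (shift_perm (int k) x) = flip_perm (int N + 1) x" for x
    using flip_shift[of "int N + 1" "int k" x] by (simp add: add_ac)
  have inj: "inj (\<lambda>i. yvar (i - int k))" by (rule injI) simp
  have "C_back_double u v w = structure_const (Gp 1 (\<lambda>i. yvar (i - int k)))
      (shift_perm (int k) u) (shift_perm (int k) v) (shift_perm (int k) w)"
    by (rule C_back_double_eq[OF pos[OF u] pos[OF v] k])
  also have "\<dots> = structure_const (Gp 1 ?y)
      (flip_perm (int N + 1) u) (flip_perm (int N + 1) v) (flip_perm (int N + 1) w)"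
    using structure_const_flip[OF admissible_yvar[of 1 "\<lambda>i. i - int k"] inj sSn] unfolding fl by simp
  finally have eq: "C_back_double u v w = structure_const (Gp 1 ?y)
      (flip_perm (int N + 1) u) (flip_perm (int N + 1) v) (flip_perm (int N + 1) w)" .
  have "admissible 1 ?y"
    using admissible_dual[OF admissible_yvar[of 1 "\<lambda>i. i - int k"], of "int (N + k) + 1"] by simp
  then show thesis by (rule that[OF _ _ eq]) (simp add: at_zero_dual)
qed

section \<open>The stability numbers\<close>

lemma FS_maximum:
  assumes "\<And>w. w \<in> S_pos \<Longrightarrow> c w \<noteq> (0 :: 'a::zero) \<Longrightarrow> w \<in> Sn (nat X)"
    and "1 \<le> X" "w \<in> S_pos" "w \<notin> Sn (nat (X - 1))" "c w \<noteq> 0"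
  shows "maximum {FS w |w. w \<in> S_pos \<and> c w \<noteq> 0} = ereal (of_int X)"
proof (rule maximum_eqI)
  have "FS w = ereal (of_int X)" by (rule FS_eqI) (use assms in auto)
  then show "ereal (of_int X) \<in> {FS w |w. w \<in> S_pos \<and> c w \<noteq> 0}"
    using assms by (intro CollectI exI[of _ w]) simp
qed (use assms FS_le in auto)

text \<open>One support bound covers the four families, and a single \<open>w\<close> attains it in
  all of them.\<close>

lemma stability_numbers_FS:
  assumes u: "u \<in> S_pos" and v: "v \<in> S_pos"
  shows "FS_num u v = Xi u v \<and> FS_D u v = Xi u v \<and> FS_K u v = Xi u v \<and> FS_KD u v = Xi u v"
proof (cases "affected u \<union> affected v = {}")
  case True
  then have uv: "u = 1" "v = 1" by simp_all
  have "Xi 1 1 = - \<infinity>" by (simp add: Xi_def FS_def maximum_def)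
  then show ?thesis
    unfolding uv FS_num_def FS_D_def FS_K_def FS_KD_def c_single_def c_double_def C_single_def C_double_def
      double_schubert_eq double_grothendieck_eq
    using admissible_yvar[of 1 "\<lambda>i. i"] by (simp add: maximum_FS_1_1)
next
  case False
  obtain X w where X: "xi_max u v X" "1 \<le> X"
    and bound: "\<And>i. 1 \<le> i \<Longrightarrow> card (crossed u i) + card (crossed v i) \<le> nat (int (nat X) - i)"
    and w: "w \<in> S_pos" "w \<notin> Sn (nat (X - 1))" "structure_const (Gp 0 (\<lambda>_. 0 :: rat)) u v w \<noteq> 0"
    using xi_max_exists[OF u v False] by metis
  have Xi: "Xi u v = ereal (of_int X)" by (rule Xi_eq[OF False X(1)])
  note support = structure_const_support[OF _ bound]
  \<comment> \<open>A nonzero Schubert constant forces the lengths to add up and then equals the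
    Grothendieck constant. The double constants specialize to these two, so they cannot
    vanish.\<close>
  have K: "structure_const (Gp 1 (\<lambda>_. 0 :: rat)) u v w \<noteq> 0"
    using w(3) schubert_const_eq[OF u v, of w "1 :: rat"] by (auto split: if_splits)
  have D: "structure_const (Gp 0 yvar) u v w \<noteq> 0"
    using at_zero_structure_const[of 0 0 yvar u v w] at_zero_yvar u v w(3) by auto
  have KD: "structure_const (Gp 1 yvar) u v w \<noteq> 0"
    using at_zero_structure_const[of 1 1 yvar u v w] at_zero_yvar u v K admissible_yvar[of 1 "\<lambda>i. i"] by auto
  show ?thesis
    unfolding Xi FS_num_def FS_D_def FS_K_def FS_KD_def c_single_def c_double_def C_single_def C_double_def
      double_schubert_eq double_grothendieck_eq
    by (intro conjI FS_maximum[OF _ X(2) w(1,2)] support w(3) D K KD)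
      (use admissible_yvar[of 1 "\<lambda>i. i"] in auto)
qed

lemma flip_xi_max_exists:
  assumes u: "u \<in> Sn N" and v: "v \<in> Sn N" and ne: "affected u \<union> affected v \<noteq> {}"
  obtains X w where "1 \<le> X" "Omega u v = ereal (of_int X) - ereal (of_int (int N))"
    "\<forall>i\<ge>1. card (crossed (flip_perm (int N + 1) u) i) +
      card (crossed (flip_perm (int N + 1) v) i) \<le> nat (int (nat X) - i)"
    "w \<in> S_pos" "w \<notin> Sn (nat (X - 1))"
    "structure_const (Gp 0 (\<lambda>_. 0 :: rat)) (flip_perm (int N + 1) u) (flip_perm (int N + 1) v) w \<noteq> 0"
proof -
  have "affected (flip_perm (int N + 1) u) \<union> affected (flip_perm (int N + 1) v) \<noteq> {}"
    using ne by (simp add: affected_flip)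
  then show thesis
  proof (rule xi_max_exists[OF Sn_S_pos[OF flip_Sn[OF u]] Sn_S_pos[OF flip_Sn[OF v]]])
    fix X w
    assume xm: "xi_max (flip_perm (int N + 1) u) (flip_perm (int N + 1) v) X"
      and X: "1 \<le> X"
        "\<And>i. 1 \<le> i \<Longrightarrow> card (crossed (flip_perm (int N + 1) u) i) +
          card (crossed (flip_perm (int N + 1) v) i) \<le> nat (int (nat X) - i)"
        "w \<in> S_pos" "w \<notin> Sn (nat (X - 1))"
        "structure_const (Gp 0 (\<lambda>_. 0 :: rat)) (flip_perm (int N + 1) u) (flip_perm (int N + 1) v) w \<noteq> 0"
    have "Omega u v = ereal (of_int X) - ereal (of_int (int N))" using Omega_eq[OF ne xm] by simp
    then show thesis using that X by blast
  qed
qed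

lemma stability_numbers_BS:
  assumes u: "u \<in> S_pos" and v: "v \<in> S_pos"
  shows "BS_num u v = Omega u v \<and> BS_D u v = Omega u v \<and> BS_K u v = Omega u v \<and> BS_KD u v = Omega u v"
proof -
  \<comment> \<open>The double K-theoretic support contains the other three, so only it needs an
    upper bound.\<close>
  have zero: "C_back_double u v w \<noteq> 0" if "c_back u v w \<noteq> 0 \<or> c_back_double u v w \<noteq> 0 \<or> C_back u v w \<noteq> 0" for w
    using that by (auto simp: c_back_def c_back_double_def C_back_def split: if_splits)
  obtain N1 N2 where N12: "u \<in> Sn N1" "v \<in> Sn N2" using S_pos_Sn u v by blast
  define N0 where "N0 = max N1 N2"
  have N0: "u \<in> Sn N" "v \<in> Sn N" if "N0 \<le> N" for N
    using N12 Sn_mono[of N1 N] Sn_mono[of N2 N] that by (auto simp: N0_def)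
  have large: "\<exists>N\<ge>N0. \<forall>i>int N. w \<langle>$\<rangle> i = i" for w
  proof -
    obtain M where M: "\<And>i. \<bar>i\<bar> > M \<Longrightarrow> w \<langle>$\<rangle> i = i" using perm_eventually_fixed by blast
    have "w \<langle>$\<rangle> i = i" if "i > int (max N0 (nat M))" for i by (rule M) (use that in linarith)
    then show ?thesis by (intro exI[of _ "max N0 (nat M)"]) auto
  qed
  show ?thesis
  proof (cases "affected u \<union> affected v = {}")
    case True
    then have uv: "u = 1" "v = 1" by simp_all
    have "Omega 1 1 = - \<infinity>" by (simp add: Omega_def BS_def maximum_def)
    moreover have "BS w = - \<infinity>" if nz: "C_back_double u v w \<noteq> 0" for w
    proof -
      obtain N where N: "N0 \<le> N" "\<And>i. i > int N \<Longrightarrow> w \<langle>$\<rangle> i = i" using large[of w] by blast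
      obtain y where y: "admissible 1 y" "\<forall>i. y i \<in> regular id (\<lambda>_. 0) \<and> at_zero (y i) = 0"
        "C_back_double u v w = structure_const (Gp 1 y)
          (flip_perm (int N + 1) u) (flip_perm (int N + 1) v) (flip_perm (int N + 1) w)"
        by (rule C_back_double_flip[OF N0[OF N(1)] N(2)])
      then have "structure_const (Gp 1 y) 1 1 (flip_perm (int N + 1) w) \<noteq> 0" using nz uv by simp
      from structure_const_1_1[OF y(1) this] have "w = 1" by simp
      then show ?thesis by (simp add: BS_def)
    qed
    ultimately show ?thesis
      unfolding BS_num_def BS_D_def BS_K_def BS_KD_def using zero uv
      by (auto intro!: maximum_bot)
  next
    case False
    \<comment> \<open>The centre of the reflection depends on how far right \<open>w\<close> moves
      integers, but \<open>Omega_eq\<close> yields the same number for every centre.\<close>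
    have upper: "BS w \<le> Omega u v" if nz: "C_back_double u v w \<noteq> 0" for w
    proof -
      obtain N where N: "N0 \<le> N" "\<And>i. i > int N \<Longrightarrow> w \<langle>$\<rangle> i = i" using large[of w] by blast
      obtain X w0 where X: "1 \<le> X" "Omega u v = ereal (of_int X) - ereal (of_int (int N))"
        and bound: "\<forall>i\<ge>1. card (crossed (flip_perm (int N + 1) u) i) +
          card (crossed (flip_perm (int N + 1) v) i) \<le> nat (int (nat X) - i)"
        and "w0 \<in> S_pos" "w0 \<notin> Sn (nat (X - 1))" "structure_const (Gp 0 (\<lambda>_. 0 :: rat))
          (flip_perm (int N + 1) u) (flip_perm (int N + 1) v) w0 \<noteq> 0"
        by (rule flip_xi_max_exists[OF N0[OF N(1)] False])
      obtain y where y: "admissible 1 y" "\<forall>i. y i \<in> regular id (\<lambda>_. 0) \<and> at_zero (y i) = 0"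
        "C_back_double u v w = structure_const (Gp 1 y)
          (flip_perm (int N + 1) u) (flip_perm (int N + 1) v) (flip_perm (int N + 1) w)"
        by (rule C_back_double_flip[OF N0[OF N(1)] N(2)])
      then have "flip_perm (int N + 1) w \<in> Sn (nat X)"
        using structure_const_support[OF y(1) bound[rule_format]] nz y(3) by simp
      then have "FS (flip_perm (int N + 1) w) \<le> ereal (of_int X)" using FS_le X by simp
      then show ?thesis unfolding X(2) BS_flip[of w "int N + 1"] by (intro ereal_minus_mono) auto
    qed
    obtain X w' where X: "1 \<le> X" "Omega u v = ereal (of_int X) - ereal (of_int (int N0))"
      and bound: "\<forall>i\<ge>1. card (crossed (flip_perm (int N0 + 1) u) i) +
        card (crossed (flip_perm (int N0 + 1) v) i) \<le> nat (int (nat X) - i)"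
      and w': "w' \<in> S_pos" "w' \<notin> Sn (nat (X - 1))"
        "structure_const (Gp 0 (\<lambda>_. 0 :: rat)) (flip_perm (int N0 + 1) u) (flip_perm (int N0 + 1) v) w' \<noteq> 0"
      by (rule flip_xi_max_exists[OF N0[OF order_refl] False])
    let ?w = "flip_perm (int N0 + 1) w'"
    let ?u = "flip_perm (int N0 + 1) u" and ?v = "flip_perm (int N0 + 1) v"
    have uv: "?u \<in> S_pos" "?v \<in> S_pos" using N0[of N0] flip_Sn Sn_S_pos by auto
    \<comment> \<open>For \<open>i\<close> beyond \<open>N0\<close> the reflected position
      \<open>N0 + 1 - i\<close> is at most 0, where \<open>w'\<close> is the identity.\<close>
    have fixed: "?w \<langle>$\<rangle> i = i" if "int N0 < i" for i
      using that w'(1) by (simp add: flip_perm_apply S_pos_def)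
    obtain y where y: "admissible 1 y" "\<forall>i. y i \<in> regular id (\<lambda>_. 0) \<and> at_zero (y i) = 0"
      "C_back_double u v ?w = structure_const (Gp 1 y) ?u ?v w'"
      by (rule C_back_double_flip[OF N0[OF order_refl] fixed, unfolded flip_flip])
    \<comment> \<open>Reflections preserve length, so the witness also satisfies the length
      condition of the cohomological constants and serves for all four families.\<close>
    have len: "perm_length w' = perm_length ?u + perm_length ?v"
      and K: "structure_const (Gp 1 (\<lambda>_. 0 :: rat)) ?u ?v w' \<noteq> 0"
      using w'(3) schubert_const_eq[OF uv, of w' "1 :: rat"] by (auto split: if_splits)
    have "at_zero (C_back_double u v ?w) = structure_const (Gp 1 (\<lambda>_. 0 :: rat)) ?u ?v w'"
      unfolding y(3) by (rule at_zero_structure_const) (use y uv in auto)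
    then have C: "C_back u v ?w \<noteq> 0" using K by (simp add: C_back_def)
    have "perm_length u + perm_length v = perm_length ?w" using len by simp
    then have c: "c_back u v ?w \<noteq> 0"
      using C by (simp add: c_back_def c_back_double_def C_back_def)
    have w'X: "w' \<in> Sn (nat X)" by (rule structure_const_support[OF admissible_0(1) bound[rule_format] w'(3)])
    have "BS ?w = Omega u v"
      unfolding BS_flip[of ?w "int N0 + 1"] X(2) using FS_eqI[OF w'X w'(2) X(1)] by simp
    then have max: "maximum {BS w |w. P w} = Omega u v"
      if "P ?w" "\<And>w. P w \<Longrightarrow> C_back_double u v w \<noteq> 0" for P
      by (intro maximum_eqI) (use that upper in \<open>auto intro!: exI[of _ ?w]\<close>)
    have c': "c_back_double u v ?w \<noteq> 0" using c by (auto simp: c_back_def)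
    have C': "C_back_double u v ?w \<noteq> 0" by (rule zero) (use C in blast)
    have "BS_num u v = Omega u v" unfolding BS_num_def
      using max[of "\<lambda>w. c_back u v w \<noteq> 0"] c zero by blast
    moreover have "BS_D u v = Omega u v" unfolding BS_D_def
      using max[of "\<lambda>w. c_back_double u v w \<noteq> 0"] c' zero by blast
    moreover have "BS_K u v = Omega u v" unfolding BS_K_def
      using max[of "\<lambda>w. C_back u v w \<noteq> 0"] C zero by blast
    moreover have "BS_KD u v = Omega u v" unfolding BS_KD_def
      using max[of "\<lambda>w. C_back_double u v w \<noteq> 0"] C' by blast
    ultimately show ?thesis by blast
  qed
qed

theorem theorem1:
  fixes u v :: "int perm"
  assumes "u \<in> S_pos" and "v \<in> S_pos"
  shows "(FS_num u v = Xi u v \<and> BS_num u v = Omega u v) \<and>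
         (FS_D u v = Xi u v \<and> BS_D u v = Omega u v) \<and>
         (FS_K u v = Xi u v \<and> BS_K u v = Omega u v) \<and>
         (FS_KD u v = Xi u v \<and> BS_KD u v = Omega u v)"
  using stability_numbers_FS[OF assms] stability_numbers_BS[OF assms] by blast

end
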